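(* Let $M\ge2$, let $q\in\mathbb C^\times$ not be a root of unity, and let $U$ be any finite dimensional $U_q\mathfrak{gl}_M$-module of type I, with weight spaces $U[\mu]$, $\mu\in\mathbb Z^M$. For $1\le i\le M-1$, $\mu\in\mathbb Z^M$ and $z=(z_1,\dots,z_M)$ let $$A_{i,\mu}(z)=\sum_{j=0}^\infty(-q)^j\frac{z_{i+1}-q^{|\mu_i-\mu_{i+1}|}z_i}{z_{i+1}-q^{2j+|\mu_i-\mu_{i+1}|}z_i}\,E_i^{(j+(\mu_{i+1}-\mu_i)_+)}F_i^{(j+(\mu_i-\mu_{i+1})_+)},$$ viewed as a map $U[\mu]\to U[s_i\mu]$. Then the restriction of $A_{i,\mu}(z)$ to the weight space $U[\mu]$ obeys the following relations, as identities of rational functions of $z$. (i) For $1\le i,j\le M-1$ such that $|i-j|\ge2$, $A_{i,s_j\mu}(s_jz)A_{j,\mu}(z)=A_{j,s_i\mu}(s_iz)A_{i,\mu}(z)$ in $\operatorname{Hom}(U[\mu],U[s_is_j\mu])$. (ii) For all $1\le i\le M-1$, $A_{i,s_i\mu}(s_iz)A_{i,\mu}(z)=\mathrm{id}$ in $\operatorname{End}(U[\mu])$. (iii) For $1\le i\le M-2$, $$A_{i,s_{i+1}s_i\mu}(s_{i+1}s_iz)A_{i+1,s_i\mu}(s_iz)A_{i,\mu}(z)=A_{i+1,s_is_{i+1}\mu}(s_is_{i+1}z)A_{i,s_{i+1}\mu}(s_{i+1}z)A_{i+1,\mu}(z)$$ in $\operatorname{Hom}(U[\mu],U[s_is_{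i+1}s_i\mu])$.
   Context: $[n]_q=\frac{q^n-q^{-n}}{q-q^{-1}}$, $[n]_q!=\prod_{j=1}^n[j]_q$, $[0]_q!=1$; $(x)_+=\max(x,0)$; $E_i^{(l)}=E_i^l/[l]_q!$, $F_i^{(l)}=F_i^l/[l]_q!$. $U_q\mathfrak{gl}_M$ is the algebra generated by $E_i,F_i$ ($1\le i\le M-1$) and $t_\lambda$ ($\lambda\in\mathbb Z^M$) with $t_\lambda t_\mu=t_{\lambda+\mu}$, $t_0=1$, $t_\lambda E_it_{-\lambda}=q^{(\lambda|\alpha_i)}E_i$, $t_\lambda F_it_{-\lambda}=q^{-(\lambda|\alpha_i)}F_i$, $[E_i,F_j]=\delta_{ij}\frac{K_i-K_i^{-1}}{q-q^{-1}}$ and the $q$-Serre relations of type $A_{M-1}$, where $\alpha_i=\epsilon_i-\epsilon_{i+1}$ and $K_i=t_{\alpha_i}$; $(\ |\ )$ is the standard inner product on $\mathbb Z^M=\oplus_i\mathbb Z\epsilon_i$. The weight space $U[\mu]$ is the simultaneous eigenspace of all $t_\lambda$ with eigenvalue $q^{(\mu|\lambda)}$; $U$ is of type I if it is the direct sum of its finite dimensional weight spaces. The symmetric group $S_M$ acts on $\mathbb Z^M$ and on $z=(z_1,\dots,z_M)$ by permuting coordinates; $s_i$ is the transposition of $i$ and $i+1$. On a finite dimensional module only finitely many terms of the sum defining $A_{i,\mu}(z)$ act non-trivially. *)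

theory Defs
  imports Complex_Main "HOL-Library.Groups_Big_Fun" "HOL-Combinatorics.Transposition"
begin

section \<open>Quantum integers\<close>

definition qint :: "complex \<Rightarrow> nat \<Rightarrow> complex" where
  "qint q n = (q ^ n - inverse q ^ n) / (q - inverse q)"

definition qfact :: "complex \<Rightarrow> nat \<Rightarrow> complex" where
  "qfact q n = (\<Prod>j = 1..n. qint q j)"

section \<open>The weight lattice\<close>

text \<open>Coordinates are numbered \<open>1, \<dots>, M\<close>; an element of $\mathbb{Z}^M$ is a function on \<^typ>\<open>nat\<close>
  that vanishes at the other arguments, so that equality of functions is equality in $\mathbb{Z}^M$.\<close>

definition lattice :: "nat \<Rightarrow> (nat \<Rightarrow> int) set" where
  "lattice M = {lam. \<forall>k. k \<notin> {1..M} \<longrightarrow> lam k = 0}"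

definition pairing :: "nat \<Rightarrow> (nat \<Rightarrow> int) \<Rightarrow> (nat \<Rightarrow> int) \<Rightarrow> int" where
  "pairing M lam mu = (\<Sum>k = 1..M. lam k * mu k)"

definition simple_root :: "nat \<Rightarrow> nat \<Rightarrow> int" where
  "simple_root i = (\<lambda>k. if k = i then 1 else if k = Suc i then -1 else 0)"

text \<open>The action of $s_i$ on weights and on $z = (z_1, \dots, z_M)$.\<close>

definition refl_act :: "nat \<Rightarrow> (nat \<Rightarrow> 'a) \<Rightarrow> nat \<Rightarrow> 'a" where
  "refl_act i x = x \<circ> transpose i (Suc i)"

section \<open>Modules over $U_q\mathfrak{gl}_M$\<close>

text \<open>Since $U_q\mathfrak{gl}_M$ is given by generators and relations, a module is a complex vector space
  (with scalar multiplication \<open>smul\<close>) with linear operators satisfying the relations.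
  The values of \<open>opE\<close>, \<open>opF\<close> outside \<open>{1..<M}\<close> and of \<open>opt\<close> outside
  \<open>lattice M\<close> are irrelevant.\<close>

record 'v uq_rep =
  smul :: "complex \<Rightarrow> 'v \<Rightarrow> 'v"
  opE :: "nat \<Rightarrow> 'v \<Rightarrow> 'v"
  opF :: "nat \<Rightarrow> 'v \<Rightarrow> 'v"
  opt :: "(nat \<Rightarrow> int) \<Rightarrow> 'v \<Rightarrow> 'v"

locale uq_gl_module =
  fixes M :: nat and q :: complex and U :: "'v::ab_group_add uq_rep"
  assumes vector_space_smul: "vector_space (smul U)"
    and linear_E: "i \<in> {1..<M} \<Longrightarrow> Vector_Spaces.linear (smul U) (smul U) (opE U i)"
    and linear_F: "i \<in> {1..<M} \<Longrightarrow> Vector_Spaces.linear (smul U) (smul U) (opF U i)"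
    and linear_t: "lam \<in> lattice M \<Longrightarrow> Vector_Spaces.linear (smul U) (smul U) (opt U lam)"
    and t_add: "lam \<in> lattice M \<Longrightarrow> mu \<in> lattice M \<Longrightarrow>
      opt U (\<lambda>k. lam k + mu k) v = opt U lam (opt U mu v)"
    and t_zero: "opt U (\<lambda>k. 0) v = v"
    and t_E: "lam \<in> lattice M \<Longrightarrow> i \<in> {1..<M} \<Longrightarrow>
      opt U lam (opE U i (opt U (\<lambda>k. - lam k) v)) =
        smul U (q powi pairing M lam (simple_root i)) (opE U i v)"
    and t_F: "lam \<in> lattice M \<Longrightarrow> i \<in> {1..<M} \<Longrightarrow>
      opt U lam (opF U i (opt U (\<lambda>k. - lam k) v)) =
        smul U (q powi (- pairing M lam (simple_root i))) (opF U i v)"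
    and E_F: "i \<in> {1..<M} \<Longrightarrow> j \<in> {1..<M} \<Longrightarrow>
      opE U i (opF U j v) - opF U j (opE U i v) =
        (if i = j
         then smul U (1 / (q - inverse q))
           (opt U (simple_root i) v - opt U (\<lambda>k. - simple_root i k) v)
         else 0)"
    and E_E_far: "i \<in> {1..<M} \<Longrightarrow> j \<in> {1..<M} \<Longrightarrow> \<bar>int i - int j\<bar> \<ge> 2 \<Longrightarrow>
      opE U i (opE U j v) = opE U j (opE U i v)"
    and F_F_far: "i \<in> {1..<M} \<Longrightarrow> j \<in> {1..<M} \<Longrightarrow> \<bar>int i - int j\<bar> \<ge> 2 \<Longrightarrow>
      opF U i (opF U j v) = opF U j (opF U i v)"
    and E_Serre: "i \<in> {1..<M} \<Longrightarrow> j \<in> {1..<M} \<Longrightarrow> \<bar>int i - int j\<bar> = 1 \<Longrightarrow>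
      opE U i (opE U i (opE U j v)) - smul U (q + inverse q) (opE U i (opE U j (opE U i v)))
        + opE U j (opE U i (opE U i v)) = 0"
    and F_Serre: "i \<in> {1..<M} \<Longrightarrow> j \<in> {1..<M} \<Longrightarrow> \<bar>int i - int j\<bar> = 1 \<Longrightarrow>
      opF U i (opF U i (opF U j v)) - smul U (q + inverse q) (opF U i (opF U j (opF U i v)))
        + opF U j (opF U i (opF U i v)) = 0"

definition weight_space ::
    "nat \<Rightarrow> complex \<Rightarrow> 'v::ab_group_add uq_rep \<Rightarrow> (nat \<Rightarrow> int) \<Rightarrow> 'v set" where
  "weight_space M q U mu =
    {v. \<forall>lam \<in> lattice M. opt U lam v = smul U (q powi pairing M mu lam) v}"

text \<open>The second conjunct states that the module is the (internal) direct sum of its weight spaces: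
  every vector is a finite sum of weight vectors in exactly one way.\<close>

definition type_I :: "nat \<Rightarrow> complex \<Rightarrow> 'v::ab_group_add uq_rep \<Rightarrow> bool" where
  "type_I M q U \<longleftrightarrow>
    (\<forall>mu \<in> lattice M. \<exists>B. finite B \<and> module.span (smul U) B = weight_space M q U mu) \<and>
    (\<forall>v. \<exists>!f. (\<forall>mu \<in> lattice M. f mu \<in> weight_space M q U mu) \<and>
      (\<forall>mu. mu \<notin> lattice M \<longrightarrow> f mu = 0) \<and> finite {mu. f mu \<noteq> 0} \<and> v = Sum_any f)"

section \<open>The operators $A_{i,\mu}(z)$\<close>

definition divE :: "complex \<Rightarrow> 'v uq_rep \<Rightarrow> nat \<Rightarrow> nat \<Rightarrow> 'v \<Rightarrow> 'v" where
  "divE q U i l v = smul U (1 / qfact q l) ((opE U i ^^ l) v)"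

definition divF :: "complex \<Rightarrow> 'v uq_rep \<Rightarrow> nat \<Rightarrow> nat \<Rightarrow> 'v \<Rightarrow> 'v" where
  "divF q U i l v = smul U (1 / qfact q l) ((opF U i ^^ l) v)"

text \<open>Here \<^term>\<open>nat x\<close> is $(x)_+$ for an integer $x$.\<close>

definition A_term ::
    "complex \<Rightarrow> 'v uq_rep \<Rightarrow> nat \<Rightarrow> (nat \<Rightarrow> int) \<Rightarrow> nat \<Rightarrow> 'v \<Rightarrow> 'v" where
  "A_term q U i mu j v =
    divE q U i (j + nat (mu (Suc i) - mu i)) (divF q U i (j + nat (mu i - mu (Suc i))) v)"

definition A_denom :: "complex \<Rightarrow> nat \<Rightarrow> (nat \<Rightarrow> int) \<Rightarrow> (nat \<Rightarrow> complex) \<Rightarrow> nat \<Rightarrow> complex" where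
  "A_denom q i mu z j = z (Suc i) - q ^ (2 * j + nat \<bar>mu i - mu (Suc i)\<bar>) * z i"

text \<open>The numerator is the denominator for $j = 0$. \<^const>\<open>Sum_any\<close> sums the nonzero terms, of which
  there are finitely many if the module is finite dimensional and \<open>q\<close> is not a root of unity.\<close>

definition A_op ::
    "complex \<Rightarrow> 'v::ab_group_add uq_rep \<Rightarrow> nat \<Rightarrow> (nat \<Rightarrow> int) \<Rightarrow> (nat \<Rightarrow> complex) \<Rightarrow> 'v \<Rightarrow> 'v" where
  "A_op q U i mu z v =
    Sum_any (\<lambda>j. smul U ((- q) ^ j *
        ((z (Suc i) - q ^ nat \<bar>mu i - mu (Suc i)\<bar> * z i) / A_denom q i mu z j))
      (A_term q U i mu j v))"

text \<open>The points \<open>z\<close> at which no denominator of a term acting nontrivially on $U[\mu]$ vanishes; they form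
  then the complement of finitely many hyperplanes. There the value of the rational function $A_{i,\mu}(z)$ is
  given by \<^const>\<open>A_op\<close>; in particular, division by zero plays no role. An identity of rational functions
  is stated as equality of the values at all points where every operator occurring in it is regular.\<close>

definition A_regular ::
    "nat \<Rightarrow> complex \<Rightarrow> 'v::ab_group_add uq_rep \<Rightarrow> nat \<Rightarrow> (nat \<Rightarrow> int) \<Rightarrow> (nat \<Rightarrow> complex) \<Rightarrow> bool" where
  "A_regular M q U i mu z \<longleftrightarrow>
    (\<forall>j. (\<exists>v \<in> weight_space M q U mu. A_term q U i mu j v \<noteq> 0) \<longrightarrow> A_denom q i mu z j \<noteq> 0)"

end

theory Submission
  imports Defs "HOL-Library.Poly_Mapping" "HOL-Computational_Algebra.Polynomial"
begin

text \<open>The operators are realised by singular vectors of induced modules, where the relations become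
  relations between lowering operators; rational functions enter only at the end, through a density
  argument. Throughout, the roles of the two kinds of generators are interchanged: the operator
  \<open>F\<^sub>i\<close> of the module, which $A_{i,\mu}(z)$ applies first, is treated as a raising operator \<open>E\<close>, and
  \<open>E\<^sub>i\<close> as a lowering operator \<open>F\<close>; weights change their sign accordingly.

  Two adjacent nodes generate a copy of the quantum group of type $A_2$. For an integral weight \<open>p\<close> let $X_p$ be the module induced
  from the Borel module \<open>U\<close> twisted by the character \<open>p\<close>. It is the tensor product of a Verma module
  with \<open>U\<close>, and as a vector space it consists of combinations of PBW monomials in the lowering
  operators with coefficients in \<open>U\<close>. For generic weights every weight vector \<open>u\<close> of \<open>U\<close> is the
  coefficient at the monomial 1 of a singular vector \<open>w\<close>, one that all raising operators
  annihilate: it arises from $1 \otimes u$ by a product of factors $C - c$, where \<open>C\<close> is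
  the Casimir operator (\<open>singular_vector_exists\<close>).

  Let \<open>N - 1\<close> and \<open>n - 1\<close> be the \<open>i\<close>-th coordinates of \<open>p\<close> and of the weight of \<open>w\<close>, with \<open>N, n \<ge> 1\<close>. Then $f_i^n w$ is
  singular again, and it lies in the image of the injective intertwiner \<open>J\<close> from
  $X_{s_i \cdot p}$ to $X_p$ that extends the embedding of Verma modules. The coefficient at 1 of its
  preimage is, up to an explicit nonzero scalar, $A_{i,\mu}(z) u$ for
  $z_i / z_{i+1} = q^{n+N}$ (\<open>step\<close>, \<open>step_op_A_sum\<close>). The vector \<open>u\<close> can be recovered by
  reading off another coefficient, and the formula for that is $A_{i,s_i\mu}(s_i z)$
  (\<open>step_inverse\<close>, \<open>step_op_inv_A_sum\<close>); this is unitarity.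

  For the braid relation three such steps are made along each of the two reduced words of the
  longest permutation. The lowering operators of both words agree by the quantum Verma identity
  (\<open>verma_identity\<close>). The composites of intertwiners agree for the same reason: on weight vectors
  each of them is a divided power of an operator \<open>dl i\<close>, and these operators satisfy the \<open>q\<close>-Serre
  relations as well (\<open>J_braid\<close>). As the intertwiners are injective, both words lead to the same
  singular vector (\<open>braid_integral\<close>), and the scalars coincide because each of them depends only
  on the values of the two weights at a positive root.

  The ratios $q^{n+N}$ that occur are Zariski dense. After multiplication by the denominators of the terms
  acting nontrivially, both sides of a relation are polynomial functions of \<open>z\<close>
  (\<open>clear_denominators_word\<close>), so the relation holds wherever both sides are regular
  (\<open>A_words_agree\<close>).\<close>

section \<open>Quantum numbers\<close>

text \<open>Powers of \<open>q\<close> are kept in the form \<open>q powi x\<close>, so that products of them are normalised by adding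
  exponents.\<close>

declare power_int_of_nat [simp del] power_int_numeral [simp del] power_int_1_right [simp del] power_int_minus1_right [simp del]

definition qnum :: "complex \<Rightarrow> int \<Rightarrow> complex" where
  "qnum q x = (q powi x - q powi (- x)) / (q - inverse q)"

locale quantum_parameter =
  fixes q :: complex
  assumes q_nonzero [simp]: "q \<noteq> 0"
    and not_root_of_unity: "n \<ge> 1 \<Longrightarrow> q ^ n \<noteq> 1"
begin

abbreviation qn :: "int \<Rightarrow> complex" where "qn \<equiv> qnum q"
abbreviation qf :: "nat \<Rightarrow> complex" where "qf \<equiv> qfact q"

lemma powi_eq_1_iff: "q powi x = 1 \<longleftrightarrow> x = 0"
proof
  assume *: "q powi x = 1"
  show "x = 0"
  proof (rule ccontr)
    assume "x \<noteq> 0"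
    have "q ^ nat \<bar>x\<bar> = 1"
    proof (cases "x \<ge> 0")
      case True then show ?thesis using * by (simp add: power_int_def)
    next
      case False then show ?thesis using * by (simp add: power_int_def power_inverse)
    qed
    moreover have "nat \<bar>x\<bar> \<ge> 1" using \<open>x \<noteq> 0\<close> by simp
    ultimately show False using not_root_of_unity by blast
  qed
qed simp

lemma powi_eq_iff: "q powi x = q powi y \<longleftrightarrow> x = y"
proof -
  have "q powi x = q powi y \<longleftrightarrow> q powi (x - y) = 1"
    by (simp add: power_int_diff)
  then show ?thesis by (simp add: powi_eq_1_iff)
qed

lemma q_minus_inverse_nonzero [simp]: "q - inverse q \<noteq> 0"
proof
  assume "q - inverse q = 0"
  then have "q powi 1 = q powi (- 1)" by (simp add: power_int_minus power_int_1_right power_int_minus1_right)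
  then show False unfolding powi_eq_iff by simp
qed

lemma q_square_nonzero [simp]: "q * q - 1 \<noteq> 0" "q\<^sup>2 - 1 \<noteq> 0" "q * q \<noteq> 1" "q\<^sup>2 \<noteq> 1"
  using not_root_of_unity[of 2] by (simp_all add: power2_eq_square)

lemma q_neq_inverse [simp]: "q \<noteq> inverse q" "inverse q \<noteq> q"
  using q_minus_inverse_nonzero by auto

lemma qnum_eq_0_iff [simp]: "qn x = 0 \<longleftrightarrow> x = 0"
proof -
  have "qn x = 0 \<longleftrightarrow> q powi x = q powi (- x)" by (simp add: qnum_def)
  then show ?thesis unfolding powi_eq_iff by auto
qed

lemma qnum_simps [simp]: "qn 0 = 0" "qn 1 = 1" "qn (- x) = - qn x"
  by (simp_all add: qnum_def power_int_minus minus_divide_left power_int_1_right power_int_minus1_right)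

lemma qint_eq_qnum: "qint q n = qn (int n)"
  by (simp add: qint_def qnum_def power_int_minus power_inverse power_int_of_nat)

lemma qfact_0 [simp]: "qf 0 = 1" by (simp add: qfact_def)

lemma qfact_Suc: "qf (Suc n) = qn (int (Suc n)) * qf n"
  by (simp add: qfact_def qint_eq_qnum del: of_nat_Suc)

lemma qfact_nonzero [simp]: "qf n \<noteq> 0"
  by (induction n) (simp_all add: qfact_Suc del: of_nat_Suc)

text \<open>Inverse factorials extended by zero to the negative integers, where the recursion stays
  valid because \<open>qnum q 0 = 0\<close>; summation ranges then need no attention.\<close>

definition ifac :: "int \<Rightarrow> complex" where
  "ifac x = (if x < 0 then 0 else 1 / qf (nat x))"

lemma ifac_of_nat [simp]: "ifac (int n) = 1 / qf n"
  by (simp add: ifac_def)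

lemma ifac_0 [simp]: "ifac 0 = 1" by (simp add: ifac_def)

lemma ifac_neg [simp]: "x < 0 \<Longrightarrow> ifac x = 0"
  by (simp add: ifac_def)

lemma ifac_rec: "ifac (x - 1) = qn x * ifac x"
proof (cases "x \<le> 0")
  case True then show ?thesis by (auto simp: ifac_def)
next
  case False
  then obtain n where "x = int (Suc n)" using zero_less_imp_eq_int[of x] by (metis not0_implies_Suc not_le of_nat_0 less_irrefl)
  then show ?thesis by (simp add: ifac_def qfact_Suc nat_add_distrib)
qed

lemma ifac_rec': "ifac x = qn (x + 1) * ifac (x + 1)"
  using ifac_rec[of "x + 1"] by simp

definition qscale :: complex where "qscale = 1 / (q - inverse q)"

lemma qscale_nonzero [simp]: "qscale \<noteq> 0" by (simp add: qscale_def)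

lemma qscale_kappa: "qscale * (q - inverse q) = 1" by (simp add: qscale_def)

lemma qnum_alt: "qn x = qscale * (q powi x - q powi (- x))"
  by (simp add: qnum_def qscale_def)

lemma powi_mult: "q powi x * q powi y = q powi (x + y)"
  and powi_mult_left: "q powi x * (q powi y * z) = q powi (x + y) * z"
  by (simp_all add: power_int_add)

lemma powi_shift: "q * q powi x = q powi (1 + x)" "inverse q * q powi x = q powi (- 1 + x)"
    "q powi x * q = q powi (1 + x)" "q powi x * inverse q = q powi (- 1 + x)"
  by (simp_all add: power_int_add power_int_diff divide_inverse power_int_1_right power_int_minus1_right)

lemma pow_powi: "q ^ n = q powi int n"
  by (simp add: power_int_of_nat)

lemma q_powi: "q = q powi 1" "inverse q = q powi (- 1)"
  by (simp_all add: power_int_minus power_int_1_right power_int_minus1_right)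

lemmas qsimps = qnum_alt powi_mult powi_mult_left algebra_simps

lemma qnum_split: "q powi (- k) * qn (s + 1 - k) + q powi (s + 1 - k) * qn k = qn (s + 1)"
  by (simp add: qsimps)

text \<open>The coefficients in the straightening of $f^s g^r$. Their symmetry in \<open>s\<close> and \<open>r\<close> is what makes
  the Verma identity true.\<close>

definition straighten_coeff :: "nat \<Rightarrow> nat \<Rightarrow> nat \<Rightarrow> complex" where
  "straighten_coeff s r k = q powi ((int s - int k) * (int r - int k)) * qf s * qf r *
     ifac (int s - int k) * ifac (int r - int k) * ifac (int k)"

lemma straighten_coeff_commute: "straighten_coeff s r k = straighten_coeff r s k"
  by (simp add: straighten_coeff_def mult_ac)

lemma straighten_coeff_zero: "k > s \<Longrightarrow> straighten_coeff s r k = 0" "k > r \<Longrightarrow> straighten_coeff s r k = 0"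
  by (simp_all add: straighten_coeff_def)

lemma straighten_coeff_Suc:
  "straighten_coeff (Suc s) r k = q powi (int r - 2 * int k) * straighten_coeff s r k +
     (if k = 0 then 0 else qn (int r - int k + 1) * straighten_coeff s r (k - 1))"
proof -
  define A where "A = qf s * qf r * ifac (int s + 1 - int k) * ifac (int r - int k) * ifac (int k)"
  define Z where "Z = q powi ((int s + 1 - int k) * (int r - int k))"
  have L: "straighten_coeff (Suc s) r k = Z * qn (int s + 1) * A"
    by (simp add: straighten_coeff_def A_def Z_def qfact_Suc algebra_simps)
  have i1: "ifac (int s - int k) = qn (int s + 1 - int k) * ifac (int s + 1 - int k)"
    using ifac_rec[of "int s + 1 - int k"] by simp
  have p1: "q powi (int r - 2 * int k) * q powi ((int s - int k) * (int r - int k)) = Z * q powi (- int k)"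
    by (simp add: Z_def powi_mult algebra_simps)
  have R1: "q powi (int r - 2 * int k) * straighten_coeff s r k = (Z * q powi (- int k)) * qn (int s + 1 - int k) * A"
    by (simp add: straighten_coeff_def A_def i1 flip: p1)
  have R2: "(if k = 0 then 0 else qn (int r - int k + 1) * straighten_coeff s r (k - 1)) =
      Z * q powi (int s + 1 - int k) * qn (int k) * A"
  proof (cases k)
    case (Suc l)
    have i2: "ifac (int r - int k) = qn (int r - int k + 1) * ifac (int r - int k + 1)"
      using ifac_rec[of "int r - int k + 1"] by simp
    have i3: "ifac (int l) = qn (int k) * ifac (int k)"
      using ifac_rec[of "int k"] Suc by simp
    have p2: "q powi ((int s - int l) * (int r - int l)) = Z * q powi (int s + 1 - int k)"
      by (simp add: Z_def powi_mult algebra_simps Suc)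
    have e: "int s - int l = int s + 1 - int k" "int r - int l = int r - int k + 1"
      using Suc by simp_all
    have "straighten_coeff s r l = Z * q powi (int s + 1 - int k) * qf s * qf r * ifac (int s + 1 - int k) *
        ifac (int r - int k + 1) * (qn (int k) * ifac (int k))"
      unfolding straighten_coeff_def p2 i3 unfolding e by simp
    then show ?thesis unfolding A_def i2 using Suc by simp
  qed simp
  show ?thesis unfolding L R1 R2
    using qnum_split[of "int k" "int s"] by (simp add: algebra_simps flip: distrib_left)
qed

lemma qnum_two: "qn 2 = q powi 1 + q powi (- 1)"
  by (simp add: qnum_def power_int_minus field_simps power2_eq_square power_int_numeral power_int_1_right power_int_minus1_right)

end

section \<open>The quantum Verma identity\<close>

locale complex_vector_space = vector_space s for s :: "complex \<Rightarrow> 'x::ab_group_add \<Rightarrow> 'x"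
begin

lemma linear_add: "Vector_Spaces.linear s s f \<Longrightarrow> f (x + y) = f x + f y"
  and linear_scale: "Vector_Spaces.linear s s f \<Longrightarrow> f (s c x) = s c (f x)"
  and linear_zero: "Vector_Spaces.linear s s f \<Longrightarrow> f 0 = 0"
  and linear_diff: "Vector_Spaces.linear s s f \<Longrightarrow> f (x - y) = f x - f y"
  and linear_minus: "Vector_Spaces.linear s s f \<Longrightarrow> f (- x) = - f x"
  and linear_sum: "Vector_Spaces.linear s s f \<Longrightarrow> f (sum g A) = (\<Sum>a\<in>A. f (g a))"
  using module_hom.add module_hom.scale module_hom.zero module_hom.diff module_hom.neg module_hom.sum
    Vector_Spaces.linear.axioms(3) by metis+

lemma linear_funpow:
  assumes "Vector_Spaces.linear s s f"
  shows "Vector_Spaces.linear s s (f ^^ n)"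
proof (induction n)
  case 0 show ?case unfolding Vector_Spaces.linear_iff by (simp add: vector_space_axioms)
next
  case (Suc n)
  show ?case using Suc.IH assms unfolding Vector_Spaces.linear_iff by simp
qed

lemma linearI:
  assumes "\<And>x y. f (x + y) = f x + f y" "\<And>c x. f (s c x) = s c (f x)"
  shows "Vector_Spaces.linear s s f"
  unfolding Vector_Spaces.linear_iff using assms by (simp add: vector_space_axioms)

lemmas linear_rules = linear_add linear_scale linear_zero linear_diff linear_minus linear_sum

end

text \<open>Two operators with the \<open>q\<close>-Serre relations. The brackets \<open>h\<close> of \<open>f\<close> and \<open>g\<close> then \<open>q\<close>-commute with both, so
  that every word can be straightened.\<close>

locale serre_pair = quantum_parameter q + complex_vector_space s
  for q :: complex and s :: "complex \<Rightarrow> 'x::ab_group_add \<Rightarrow> 'x" (infixr \<open>*s\<close> 75) +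
  fixes f g :: "'x \<Rightarrow> 'x"
  assumes linear_f: "Vector_Spaces.linear s s f" and linear_g: "Vector_Spaces.linear s s g"
    and serre_f: "f (f (g x)) = qnum q 2 *s f (g (f x)) - g (f (f x))"
    and serre_g: "g (g (f x)) = qnum q 2 *s g (f (g x)) - f (g (g x))"
begin

definition h :: "'x \<Rightarrow> 'x" where "h x = f (g x) - q *s g (f x)"

lemma linear_h: "Vector_Spaces.linear s s h"
  by (rule linearI) (simp_all add: h_def linear_rules[OF linear_f] linear_rules[OF linear_g] algebra_simps)

lemmas lin = linear_rules[OF linear_f] linear_rules[OF linear_g] linear_rules[OF linear_h]
  linear_rules[OF linear_funpow[OF linear_f]] linear_rules[OF linear_funpow[OF linear_g]]
  linear_rules[OF linear_funpow[OF linear_h]]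

lemma f_h: "f (h x) = q powi (- 1) *s h (f x)"
  by (simp add: h_def lin serre_f qnum_two scale_right_diff_distrib scale_left_distrib power_int_minus power_int_1_right power_int_minus1_right)

lemma h_g: "h (g x) = q powi (- 1) *s g (h x)"
  by (simp add: h_def lin serre_g qnum_two scale_right_diff_distrib scale_left_distrib power_int_minus power_int_1_right power_int_minus1_right)

lemma h_gpow: "h ((g ^^ r) x) = q powi (- int r) *s (g ^^ r) (h x)"
  by (induction r) (simp_all add: h_g lin powi_mult)

lemma f_gpow: "f ((g ^^ r) x) = q powi int r *s (g ^^ r) (f x) + qn (int r) *s (g ^^ (r - 1)) (h x)"
proof (induction r)
  case (Suc r)
  have fg: "f (g y) = q *s g (f y) + h y" for y by (simp add: h_def)
  have rec: "q * qn (int r) + q powi (- int r) = qn (1 + int r)"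
    using qnum_split[of "int r" "int r"] by (simp add: power_int_minus mult.commute add.commute power_int_1_right power_int_minus1_right)
  show ?case
  proof (cases r)
    case 0 then show ?thesis by (simp add: fg power_int_1_right power_int_minus1_right)
  next
    case (Suc r')
    have g: "g ((g ^^ (r - Suc 0)) y) = (g ^^ r) y" for y using Suc by simp
    show ?thesis
      by (simp add: fg lin Suc.IH h_gpow g powi_shift scale_right_distrib add.assoc rec flip: scale_left_distrib)
  qed
qed simp

lemma f_hpow: "f ((h ^^ r) x) = q powi (- int r) *s (h ^^ r) (f x)"
  by (induction r) (simp_all add: f_h lin powi_mult)

text \<open>The ordered monomials; these are the PBW monomials of the subalgebra generated by \<open>f\<close> and \<open>g\<close>.\<close>

definition pbw :: "nat \<Rightarrow> nat \<Rightarrow> nat \<Rightarrow> 'x \<Rightarrow> 'x" where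
  "pbw a b c x = (g ^^ a) ((h ^^ b) ((f ^^ c) x))"

lemma f_pbw: "f (pbw a b c x) =
    q powi (int a - int b) *s pbw a b (Suc c) x + qn (int a) *s pbw (a - 1) (Suc b) c x"
  by (simp add: pbw_def f_gpow f_hpow lin powi_mult flip: diff_conv_add_uminus)

lemma straighten:
  "(f ^^ n) ((g ^^ r) x) = (\<Sum>k\<le>n. straighten_coeff n r k *s pbw (r - k) k (n - k) x)"
proof (induction n)
  case 0 show ?case by (simp add: straighten_coeff_def pbw_def)
next
  case (Suc n)
  have coef: "straighten_coeff n r k * qn (int (r - k)) = straighten_coeff n r k * qn (int r - int k)"
    and coef': "straighten_coeff n r k * q powi (int (r - k) - int k) = straighten_coeff n r k * q powi (int r - int k * 2)" for k
    by (cases "k \<le> r"; simp add: of_nat_diff straighten_coeff_zero algebra_simps)+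
  have "(f ^^ Suc n) ((g ^^ r) x) =
    (\<Sum>k\<le>n. (q powi (int r - 2 * int k) * straighten_coeff n r k) *s pbw (r - k) k (Suc n - k) x) +
    (\<Sum>k\<le>n. (qn (int r - int k) * straighten_coeff n r k) *s pbw (r - Suc k) (Suc k) (n - k) x)"
    unfolding funpow.simps comp_def Suc.IH
    by (simp add: lin f_pbw scale_right_distrib sum.distrib Suc_diff_le coef coef' mult.commute[of "q powi _" "straighten_coeff _ _ _"] mult.commute[of "qn _" "straighten_coeff _ _ _"] mult.commute[of 2])
  also have "(\<Sum>k\<le>n. (q powi (int r - 2 * int k) * straighten_coeff n r k) *s pbw (r - k) k (Suc n - k) x)
    = (\<Sum>k\<le>Suc n. (q powi (int r - 2 * int k) * straighten_coeff n r k) *s pbw (r - k) k (Suc n - k) x)"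
    by (simp add: straighten_coeff_zero)
  also have "(\<Sum>k\<le>n. (qn (int r - int k) * straighten_coeff n r k) *s pbw (r - Suc k) (Suc k) (n - k) x)
    = (\<Sum>k\<le>Suc n. (if k = 0 then 0 else qn (int r - int k + 1) * straighten_coeff n r (k - 1)) *s pbw (r - k) k (Suc n - k) x)"
    by (simp add: sum.atMost_Suc_shift del: sum.atMost_Suc)
  finally show ?case
    by (simp only: straighten_coeff_Suc scale_left_distrib sum.distrib)
qed

lemma straighten_upto:
  assumes "N \<ge> n"
  shows "(f ^^ n) ((g ^^ r) x) = (\<Sum>k\<le>N. straighten_coeff n r k *s pbw (r - k) k (n - k) x)"
  unfolding straighten using assms by (intro sum.mono_neutral_left) (auto simp: straighten_coeff_zero)

text \<open>Both sides, straightened into PBW monomials, have the coefficient of $g^{a+b-k} h^k f^{a+b-k}$ indexed by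
  $(b, a+b)$ on the left and by $(a+b, b)$ on the right.\<close>

theorem verma_identity:
  "(f ^^ b) ((g ^^ (a + b)) ((f ^^ a) x)) = (g ^^ a) ((f ^^ (a + b)) ((g ^^ b) x))"
proof -
  have m1: "pbw (a + b - k) k (b - k) ((f ^^ a) x) = pbw (a + b - k) k (a + b - k) x" if "k \<le> b" for k
    using that by (simp add: pbw_def add.commute flip: funpow_add[THEN fun_cong, unfolded comp_def])
  have m2: "(g ^^ a) (pbw (b - k) k (a + b - k) x) = pbw (a + b - k) k (a + b - k) x" if "k \<le> b" for k
    using that by (simp add: pbw_def flip: funpow_add[THEN fun_cong, unfolded comp_def])
  have "(f ^^ b) ((g ^^ (a + b)) ((f ^^ a) x)) =
    (\<Sum>k\<le>a + b. straighten_coeff b (a + b) k *s pbw (a + b - k) k (b - k) ((f ^^ a) x))"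
    by (rule straighten_upto) simp
  also have "\<dots> = (\<Sum>k\<le>a + b. straighten_coeff (a + b) b k *s (g ^^ a) (pbw (b - k) k (a + b - k) x))"
  proof (intro sum.cong refl)
    fix k
    show "straighten_coeff b (a + b) k *s pbw (a + b - k) k (b - k) ((f ^^ a) x) =
      straighten_coeff (a + b) b k *s (g ^^ a) (pbw (b - k) k (a + b - k) x)"
      by (cases "k \<le> b") (simp_all add: m1 m2 straighten_coeff_zero straighten_coeff_commute[of b])
  qed
  also have "\<dots> = (g ^^ a) ((f ^^ (a + b)) ((g ^^ b) x))"
    unfolding straighten by (simp add: lin)
  finally show ?thesis .
qed

end

section \<open>Linear maps out of finitely supported functions\<close>

definition extend :: "('k \<Rightarrow> 'v::ab_group_add \<Rightarrow> 'w::ab_group_add) \<Rightarrow> ('k \<Rightarrow>\<^sub>0 'v) \<Rightarrow> 'w" where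
  "extend g \<phi> = (\<Sum>k\<in>Poly_Mapping.keys \<phi>. g k (Poly_Mapping.lookup \<phi> k))"

lemma extend_single:
  assumes "\<And>k. g k 0 = 0"
  shows "extend g (Poly_Mapping.single k x) = g k x"
  using assms by (cases "x = 0") (simp_all add: extend_def)

lemma extend_add:
  assumes "\<And>k x y. g k (x + y) = g k x + g k y"
  shows "extend g (\<phi> + \<psi>) = extend g \<phi> + extend g \<psi>"
proof -
  have "g k 0 = 0" for k using assms[of k 0 0] by simp
  then show ?thesis unfolding extend_def using assms by (intro setsum_keys_plus_distrib) auto
qed

lemma sum_single: "(\<Sum>k\<in>Poly_Mapping.keys \<phi>. Poly_Mapping.single k (Poly_Mapping.lookup \<phi> k)) = \<phi>"
proof (rule poly_mapping_eqI)
  fix k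
  have "Poly_Mapping.lookup (\<Sum>k\<in>Poly_Mapping.keys \<phi>. Poly_Mapping.single k (Poly_Mapping.lookup \<phi> k)) k =
    (\<Sum>l\<in>Poly_Mapping.keys \<phi>. if l = k then Poly_Mapping.lookup \<phi> l else 0)"
    by (simp add: lookup_sum lookup_single when_def)
  also have "\<dots> = Poly_Mapping.lookup \<phi> k" by (simp add: in_keys_iff)
  finally show "Poly_Mapping.lookup (\<Sum>k\<in>Poly_Mapping.keys \<phi>. Poly_Mapping.single k (Poly_Mapping.lookup \<phi> k)) k =
    Poly_Mapping.lookup \<phi> k" .
qed

lemma poly_mapping_additive_induct [case_names single add]:
  fixes \<phi> :: "'k \<Rightarrow>\<^sub>0 'v::ab_group_add"
  assumes "\<And>k x. P (Poly_Mapping.single k x)" "\<And>\<phi> \<psi>. P \<phi> \<Longrightarrow> P \<psi> \<Longrightarrow> P (\<phi> + \<psi>)"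
  shows "P \<phi>"
proof -
  have "P (\<Sum>k\<in>A. Poly_Mapping.single k (Poly_Mapping.lookup \<phi> k))" if "finite A" for A
    using that
  proof (induction A)
    case empty show ?case using assms(1)[of undefined 0] by simp
  next
    case (insert k A) then show ?case by (simp add: assms)
  qed
  from this[of "Poly_Mapping.keys \<phi>"] show ?thesis by (simp add: sum_single)
qed

lemma lookup_map: "g 0 = 0 \<Longrightarrow> Poly_Mapping.lookup (Poly_Mapping.map g \<phi>) k = g (Poly_Mapping.lookup \<phi> k)"
  by (simp add: map.rep_eq when_def)

section \<open>The induced modules\<close>

text \<open>The entry at \<open>(a, b, c)\<close> is the coefficient of the PBW monomial $f_2^a f_3^b f_1^c$, where
  $f_3 = f_1 f_2 - q f_2 f_1$. The nodes 1 and 2 of $A_2$ are \<open>False\<close> and \<open>True\<close>, and \<open>cart\<close> is the Cartan matrix.\<close>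

type_synonym 'v induced = "nat \<times> nat \<times> nat \<Rightarrow>\<^sub>0 'v"

definition cart :: "bool \<Rightarrow> bool \<Rightarrow> int" where "cart i j = (if i = j then 2 else -1)"

lemma cart_simps [simp]: "cart i i = 2" "cart i (\<not> i) = -1" "cart (\<not> i) i = -1"
  "cart True False = -1" "cart False True = -1"
  by (simp_all add: cart_def)

text \<open>A weight module over the positive Borel subalgebra. The last axiom says that weight vectors span; as an induction
  principle it lets an identity of linear maps be checked on them.\<close>

locale borel_module = quantum_parameter q + complex_vector_space s
  for q :: complex and s :: "complex \<Rightarrow> 'v::ab_group_add \<Rightarrow> 'v" (infixr \<open>*s\<close> 75) +
  fixes E K Ki :: "bool \<Rightarrow> 'v \<Rightarrow> 'v"
  assumes linear_E: "Vector_Spaces.linear s s (E i)"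
    and linear_K: "Vector_Spaces.linear s s (K i)"
    and linear_Ki: "Vector_Spaces.linear s s (Ki i)"
    and Ki_K: "Ki i (K i x) = x"
    and K_E: "K i (E j x) = q powi cart i j *s E j (K i x)"
    and E_serre: "E i (E i (E (\<not> i) x)) = qnum q 2 *s E i (E (\<not> i) (E i x)) - E (\<not> i) (E i (E i x))"
    and weight_generated: "\<And>P. (\<And>h x. (\<And>i. K i x = q powi h i *s x) \<Longrightarrow> P x) \<Longrightarrow>
      (\<And>x y. P x \<Longrightarrow> P y \<Longrightarrow> P (x + y)) \<Longrightarrow> P x"
begin

definition wt :: "(bool \<Rightarrow> int) \<Rightarrow> 'v \<Rightarrow> bool" where
  "wt h x \<longleftrightarrow> (\<forall>i. K i x = q powi h i *s x)"

lemmas lin = linear_rules[OF linear_E] linear_rules[OF linear_K] linear_rules[OF linear_Ki]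

lemma K_wt: "wt h x \<Longrightarrow> K i x = q powi h i *s x"
  by (simp add: wt_def)

lemma Ki_wt: "wt h x \<Longrightarrow> Ki i x = q powi (- h i) *s x"
proof -
  assume h: "wt h x"
  have "x = Ki i (q powi h i *s x)" using Ki_K[of i x] K_wt[OF h, of i] by simp
  also have "\<dots> = q powi h i *s Ki i x" by (simp add: lin)
  finally have "q powi (- h i) *s x = q powi (- h i) *s q powi h i *s Ki i x" by simp
  then show ?thesis by (simp add: powi_mult)
qed

lemma wt_E: "wt h x \<Longrightarrow> wt (\<lambda>j. h j + cart j i) (E i x)"
  by (simp add: wt_def K_E lin powi_mult add.commute)

lemma wt_scale: "wt h x \<Longrightarrow> wt h (c *s x)"
  by (simp add: wt_def lin mult.commute)

definition sX :: "complex \<Rightarrow> 'v induced \<Rightarrow> 'v induced" (infixr \<open>*x\<close> 75)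
  where "c *x \<phi> = Poly_Mapping.map (s c) \<phi>"

lemma lookup_sX [simp]: "Poly_Mapping.lookup (c *x \<phi>) k = c *s Poly_Mapping.lookup \<phi> k"
  by (simp add: sX_def lookup_map)

lemma sX_single [simp]: "c *x Poly_Mapping.single k x = Poly_Mapping.single k (c *s x)"
  by (rule poly_mapping_eqI) (simp add: lookup_single when_def)

sublocale X: complex_vector_space sX
  by unfold_locales (rule poly_mapping_eqI; simp add: lookup_add algebra_simps)+

text \<open>By this an operator on the induced module can be defined by its effect on multiples of PBW monomials.\<close>

lemma linear_extend:
  assumes "\<And>k. Vector_Spaces.linear s sX (g k)"
  shows "Vector_Spaces.linear sX sX (extend g)"
proof (rule X.linearI)
  have g: "g k (x + y) = g k x + g k y" "g k (c *s x) = c *x g k x" "g k 0 = 0" for k x y c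
    using assms[of k] module_hom.add[OF Vector_Spaces.linear.axioms(3)] module_hom.scale[OF Vector_Spaces.linear.axioms(3)]
      module_hom.zero[OF Vector_Spaces.linear.axioms(3)] by blast+
  show "extend g (\<phi> + \<psi>) = extend g \<phi> + extend g \<psi>" for \<phi> \<psi>
    by (rule extend_add) (rule g)
  show "extend g (c *x \<phi>) = c *x extend g \<phi>" for c \<phi>
  proof (induction \<phi> rule: poly_mapping_additive_induct)
    case (single k x) then show ?case by (simp add: extend_single g)
  next
    case (add \<phi> \<psi>) then show ?case by (simp add: extend_add g X.scale_right_distrib)
  qed
qed

lemma X_linear_eqI:
  assumes "Vector_Spaces.linear sX sX A" "Vector_Spaces.linear sX sX B"
    and "\<And>a b c h x. wt h x \<Longrightarrow> A (Poly_Mapping.single (a, b, c) x) = B (Poly_Mapping.single (a, b, c) x)"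
  shows "A \<phi> = B \<phi>"
proof (induction \<phi> rule: poly_mapping_additive_induct)
  case (single k x)
  obtain a b c where k: "k = (a, b, c)" by (cases k)
  show ?case unfolding k
  proof (rule weight_generated[of _ x])
    fix h x assume "\<And>i. K i x = q powi h i *s x"
    then show "A (Poly_Mapping.single (a, b, c) x) = B (Poly_Mapping.single (a, b, c) x)"
      by (intro assms(3)[of h]) (simp add: wt_def)
  next
    fix x y
    assume "A (Poly_Mapping.single (a, b, c) x) = B (Poly_Mapping.single (a, b, c) x)"
      "A (Poly_Mapping.single (a, b, c) y) = B (Poly_Mapping.single (a, b, c) y)"
    then show "A (Poly_Mapping.single (a, b, c) (x + y)) = B (Poly_Mapping.single (a, b, c) (x + y))"
      by (simp add: single_add X.linear_add[OF assms(1)] X.linear_add[OF assms(2)])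
  qed
next
  case (add \<phi> \<psi>)
  then show ?case by (simp add: X.linear_add[OF assms(1)] X.linear_add[OF assms(2)])
qed

abbreviation sg :: "nat \<Rightarrow> nat \<Rightarrow> nat \<Rightarrow> 'v \<Rightarrow> 'v induced" where
  "sg a b c x \<equiv> Poly_Mapping.single (a, b, c) x"

text \<open>Left multiplication by the lowering operators, in PBW coordinates. The formula for \<open>f\<^sub>1\<close> moves it past $f_2^a f_3^b$.\<close>

definition fX :: "bool \<Rightarrow> 'v induced \<Rightarrow> 'v induced" where
  "fX i = extend (\<lambda>(a, b, c) x. if i then sg (Suc a) b c x
     else sg a b (Suc c) (q powi (int a - int b) *s x) + sg (a - 1) (Suc b) c (qn (int a) *s x))"

text \<open>Right multiplication of the PBW monomial by the lowering operators; it commutes with the left one.\<close>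

definition rX :: "bool \<Rightarrow> 'v induced \<Rightarrow> 'v induced" where
  "rX i = extend (\<lambda>(a, b, c) x. if i
     then sg (Suc a) b c (q powi (int c - int b) *s x) + sg a (Suc b) (c - 1) (qn (int c) *s x)
     else sg a b (Suc c) x)"

text \<open>The \<open>q\<close>-number of the coroot shifted by \<open>n\<close>: multiplication by \<open>[h i + n]\<close> on vectors of weight \<open>h\<close>.\<close>

definition Hop :: "bool \<Rightarrow> int \<Rightarrow> 'v \<Rightarrow> 'v" where
  "Hop i n x = qscale *s (q powi n *s K i x - q powi (- n) *s Ki i x)"

text \<open>The raising operators: \<open>e\<close> is moved past the monomial to the coefficient \<open>x\<close>, on which it acts as \<open>E\<close>; the
  remaining terms are the commutators with $f_2^a$, $f_3^b$ and $f_1^c$. The Cartan part of \<open>x\<close> is shifted by \<open>p\<close>.\<close>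

definition eX :: "(bool \<Rightarrow> int) \<Rightarrow> bool \<Rightarrow> 'v induced \<Rightarrow> 'v induced" where
  "eX p i = extend (\<lambda>(a, b, c) x. sg a b c (E i x) + (if i
     then sg (a - 1) b c (qn (int a) *s Hop i (p i - int b + int c - int a + 1) x)
        - sg a (b - 1) (Suc c) ((q powi (2 - int b + p i + int c) * qn (int b)) *s K i x)
     else sg (Suc a) (b - 1) c ((q powi (2 * int c - p i) * qn (int b)) *s Ki i x)
        + sg a b (c - 1) (qn (int c) *s Hop i (p i - int c + 1) x)))"

definition kX :: "(bool \<Rightarrow> int) \<Rightarrow> bool \<Rightarrow> 'v induced \<Rightarrow> 'v induced" where
  "kX p i = extend (\<lambda>(a, b, c) x. sg a b c
     (q powi (p i - cart i True * int a - int b - cart i False * int c) *s K i x))"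

definition kiX :: "(bool \<Rightarrow> int) \<Rightarrow> bool \<Rightarrow> 'v induced \<Rightarrow> 'v induced" where
  "kiX p i = extend (\<lambda>(a, b, c) x. sg a b c
     (q powi - (p i - cart i True * int a - int b - cart i False * int c) *s Ki i x))"

lemma Hop_wt: "wt h x \<Longrightarrow> Hop i n x = qn (h i + n) *s x"
  by (simp add: Hop_def K_wt Ki_wt qsimps flip: scale_left_diff_distrib)

lemma Hop_lin: "Hop i n (x + y) = Hop i n x + Hop i n y" "Hop i n (c *s x) = c *s Hop i n x" "Hop i n 0 = 0"
  by (simp_all add: Hop_def lin algebra_simps)

lemma linear_sXI:
  "(\<And>x y. g (x + y) = g x + g y) \<Longrightarrow> (\<And>c x. g (c *s x) = c *x g x) \<Longrightarrow> Vector_Spaces.linear s sX g"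
  unfolding Vector_Spaces.linear_iff by (simp add: vector_space_axioms X.vector_space_axioms)

lemma linear_ops [simp]: "Vector_Spaces.linear sX sX (fX i)" "Vector_Spaces.linear sX sX (rX i)"
  "Vector_Spaces.linear sX sX (eX p i)" "Vector_Spaces.linear sX sX (kX p i)" "Vector_Spaces.linear sX sX (kiX p i)"
  unfolding fX_def rX_def eX_def kX_def kiX_def
  by (rule linear_extend, rule linear_sXI;
      simp add: case_prod_unfold single_add single_diff scale_right_distrib lin Hop_lin X.scale_right_distrib
        X.scale_right_diff_distrib mult_ac)+

lemmas linX = linear_ops[THEN X.linear_add] linear_ops[THEN X.linear_scale] linear_ops[THEN X.linear_zero]
  linear_ops[THEN X.linear_diff] linear_ops[THEN X.linear_minus] linear_ops[THEN X.linear_sum]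

lemma f_single:
  "fX True (sg a b c x) = sg (Suc a) b c x"
  "fX False (sg a b c x) = sg a b (Suc c) (q powi (int a - int b) *s x) + sg (a - 1) (Suc b) c (qn (int a) *s x)"
  by (simp_all add: fX_def extend_single split: prod.splits)

lemma r_single:
  "rX False (sg a b c x) = sg a b (Suc c) x"
  "rX True (sg a b c x) = sg (Suc a) b c (q powi (int c - int b) *s x) + sg a (Suc b) (c - 1) (qn (int c) *s x)"
  by (simp_all add: rX_def extend_single split: prod.splits)

lemma e_single:
  "eX p i (sg a b c x) = sg a b c (E i x) + (if i
     then sg (a - 1) b c (qn (int a) *s Hop i (p i - int b + int c - int a + 1) x)
        - sg a (b - 1) (Suc c) ((q powi (2 - int b + p i + int c) * qn (int b)) *s K i x)
     else sg (Suc a) (b - 1) c ((q powi (2 * int c - p i) * qn (int b)) *s Ki i x)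
        + sg a b (c - 1) (qn (int c) *s Hop i (p i - int c + 1) x))"
  by (simp add: eX_def extend_single Hop_lin lin split: prod.splits)

lemma k_single:
  "kX p i (sg a b c x) = sg a b c (q powi (p i - cart i True * int a - int b - cart i False * int c) *s K i x)"
  "kiX p i (sg a b c x) = sg a b c (q powi - (p i - cart i True * int a - int b - cart i False * int c) *s Ki i x)"
  by (simp_all add: kX_def kiX_def extend_single lin split: prod.splits)

section \<open>Relations between the operators on the induced module\<close>

lemma int_norm: "- numeral w - x = - x - numeral w" "- 1 - x = - x - 1" for x :: int by simp_all

lemmas qnorm = qsimps int_norm

lemmas op_single = f_single r_single e_single k_single

lemma lookup_single_if: "Poly_Mapping.lookup (sg a b c x) k = (if k = (a, b, c) then x else 0)"
  by (auto simp: lookup_single when_def)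

text \<open>An equality of combinations of a fixed vector is reduced to an equality of complex coefficients.\<close>

lemma collect:
  "c *s x + d *s x = (c + d) *s x" "x + d *s x = (1 + d) *s x" "c *s x + x = (c + 1) *s x" "x + x = 2 *s x"
  "c *s x - d *s x = (c - d) *s x" "x - d *s x = (1 - d) *s x" "c *s x - x = (c - 1) *s x"
  "(c *s x = d *s x) \<longleftrightarrow> c = d \<or> x = 0" "(x = d *s x) \<longleftrightarrow> 1 = d \<or> x = 0"
  "(c *s x = x) \<longleftrightarrow> c = 1 \<or> x = 0"
  using scale_cancel_right[of 1 x d] scale_cancel_right[of c x 1] scale_left_distrib[of 1 1 x]
  by (simp_all add: scale_left_distrib scale_left_diff_distrib)

lemma linear_comp: "Vector_Spaces.linear sX sX A \<Longrightarrow> Vector_Spaces.linear sX sX B \<Longrightarrow> Vector_Spaces.linear sX sX (\<lambda>x. A (B x))"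
  by (rule X.linearI) (simp_all add: X.linear_rules)
lemma linear_plus: "Vector_Spaces.linear sX sX A \<Longrightarrow> Vector_Spaces.linear sX sX B \<Longrightarrow> Vector_Spaces.linear sX sX (\<lambda>x. A x + B x)"
  by (rule X.linearI) (simp_all add: X.linear_rules X.scale_right_distrib)
lemma linear_minus': "Vector_Spaces.linear sX sX A \<Longrightarrow> Vector_Spaces.linear sX sX B \<Longrightarrow> Vector_Spaces.linear sX sX (\<lambda>x. A x - B x)"
  by (rule X.linearI) (simp_all add: X.linear_rules X.scale_right_diff_distrib)
lemma linear_scaled: "Vector_Spaces.linear sX sX A \<Longrightarrow> Vector_Spaces.linear sX sX (\<lambda>x. c *x A x)"
  by (rule X.linearI) (simp_all add: X.linear_rules X.scale_right_distrib mult.commute)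

lemmas linear_intros = linear_comp[OF linear_ops(1)] linear_comp[OF linear_ops(2)] linear_comp[OF linear_ops(3)]
  linear_comp[OF linear_ops(4)] linear_comp[OF linear_ops(5)] linear_plus linear_minus' linear_scaled

lemmas expand_ops = op_single linX powi_mult powi_shift lin X.scale_right_distrib X.scale_right_diff_distrib Hop_lin

definition f3X :: "'v induced \<Rightarrow> 'v induced" where
  "f3X = extend (\<lambda>(a, b, c) x. sg a (Suc b) c (q powi (- int a) *s x))"

definition r3X :: "'v induced \<Rightarrow> 'v induced" where
  "r3X = extend (\<lambda>(a, b, c) x. sg a (Suc b) c (q powi (- int c) *s x))"

lemma linear_3: "Vector_Spaces.linear sX sX f3X" "Vector_Spaces.linear sX sX r3X"
  unfolding f3X_def r3X_def
  by (rule linear_extend, rule linear_sXI;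
      simp add: case_prod_unfold single_add scale_right_distrib lin X.scale_right_distrib mult_ac)+

lemmas linear_intros3 = linear_intros linear_comp[OF linear_3(1)] linear_comp[OF linear_3(2)]

lemma single_3: "f3X (sg a b c x) = sg a (Suc b) c (q powi (- int a) *s x)"
   "r3X (sg a b c x) = sg a (Suc b) c (q powi (- int c) *s x)"
  by (simp_all add: f3X_def r3X_def extend_single lin split: prod.splits)

lemma qn_Suc: "qn (1 + x) = q powi 1 * qn x + q powi (- x)" "qn (1 + x) = q powi (- 1) * qn x + q powi x"
  using qnum_split[of x x] qnum_split[of 1 x] by (simp_all add: mult.commute add.commute)

lemma f_r12: "q powi (c - b) * qn (1 + a) + qn c * q powi (a - (1 + b)) =
    q powi (a - b) * qn (1 + c) + qn a * q powi (c - (1 + b))"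
  by (simp add: qsimps)

lemma sg_add: "sg a b c (u *s x) + sg a b c (v *s x) = sg a b c ((u + v) *s x)"
  "sg a b c (u *s x) + (sg a b c (v *s x) + y) = sg a b c ((u + v) *s x) + y"
  by (simp_all add: single_add scale_left_distrib)

lemma f_r_FT: "fX False (rX True \<phi>) = rX True (fX False \<phi>)"
proof (rule X_linear_eqI[where A = "\<lambda>\<phi>. fX False (rX True \<phi>)"])
  fix a b c h x
  assume "wt h x"
  have na: "int (a - Suc 0) = int a - 1" if "a > 0" using that by simp
  have nc: "int (c - Suc 0) = int c - 1" if "c > 0" using that by simp
  have "fX False (rX True (sg a b c x)) = sg (Suc a) b (Suc c) (q powi (int c + int a - 2 * int b + 1) *s x) +
     sg a (Suc b) c ((q powi (int c - int b) * qn (1 + int a) + qn (int c) * q powi (int a - (1 + int b))) *s x) +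
     sg (a - 1) (Suc (Suc b)) (c - 1) ((qn (int a) * qn (int c)) *s x)"
    by (cases c) (simp_all add: expand_ops single_add scale_left_distrib algebra_simps)
  also have "\<dots> = rX True (fX False (sg a b c x))"
    by (subst f_r12)
      (cases a; simp add: expand_ops single_add scale_left_distrib algebra_simps)
  finally show "fX False (rX True (sg a b c x)) = rX True (fX False (sg a b c x))" .
qed (rule linear_ops linear_3 | rule linear_intros3)+

lemma f_r: "fX i (rX j \<phi>) = rX j (fX i \<phi>)"
proof (cases "i \<or> \<not> j")
  case True
  show ?thesis
    by (rule X_linear_eqI[where A = "\<lambda>\<phi>. fX i (rX j \<phi>)"]; ((rule linear_ops linear_3 | rule linear_intros3)+)?)
      (use True in \<open>cases i; cases j; simp add: expand_ops algebra_simps\<close>)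
next
  case False
  then show ?thesis by (simp add: f_r_FT)
qed

lemma f12: "fX False (fX True \<phi>) = q powi 1 *x fX True (fX False \<phi>) + f3X \<phi>"
proof (rule X_linear_eqI[where A = "\<lambda>\<phi>. fX False (fX True \<phi>)"])
  fix a b c h x
  assume "wt h x"
  show "fX False (fX True (sg a b c x)) = q powi 1 *x fX True (fX False (sg a b c x)) + f3X (sg a b c x)"
    by (cases a) (use qn_Suc(1)[of "int a"] in \<open>simp_all add: expand_ops single_3 single_add scale_left_distrib algebra_simps\<close>)
qed (rule linear_ops linear_3 | rule linear_intros3)+

lemma f13: "fX False (f3X \<phi>) = q powi (- 1) *x f3X (fX False \<phi>)"
proof (rule X_linear_eqI[where A = "\<lambda>\<phi>. fX False (f3X \<phi>)"])
  fix a b c h x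
  assume "wt h x"
  show "fX False (f3X (sg a b c x)) = q powi (- 1) *x f3X (fX False (sg a b c x))"
    by (cases a) (simp_all add: expand_ops single_3 X.linear_rules[OF linear_3(1)] powi_mult_left algebra_simps)
qed (rule linear_ops linear_3 | rule linear_intros3)+

lemma f32: "f3X (fX True \<phi>) = q powi (- 1) *x fX True (f3X \<phi>)"
  by (rule X_linear_eqI[where A = "\<lambda>\<phi>. f3X (fX True \<phi>)"]; ((rule linear_ops linear_3 | rule linear_intros3)+)?)
    (simp add: expand_ops single_3 X.linear_rules[OF linear_3(1)] powi_mult_left algebra_simps)

lemma f_serre: "fX i (fX i (fX (\<not> i) \<phi>)) = qn 2 *x fX i (fX (\<not> i) (fX i \<phi>)) - fX (\<not> i) (fX i (fX i \<phi>))"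
proof -
  have 3: "f3X \<phi> = fX False (fX True \<phi>) - q powi 1 *x fX True (fX False \<phi>)" for \<phi> by (simp add: f12)
  show ?thesis
  proof (cases i)
    case False
    have "fX False (fX False (fX True \<phi>)) = q powi 1 *x fX False (fX True (fX False \<phi>)) +
      q powi (- 1) *x (fX False (fX True (fX False \<phi>)) - q powi 1 *x fX True (fX False (fX False \<phi>)))"
      using f13[of \<phi>] unfolding 3 by (simp add: linX diff_eq_eq)
    then show ?thesis using False
      by (simp add: qnum_two X.scale_right_diff_distrib X.scale_left_distrib powi_mult)
  next
    case True
    have "fX False (fX True (fX True \<phi>)) = q powi 1 *x fX True (fX False (fX True \<phi>)) +
      q powi (- 1) *x (fX True (fX False (fX True \<phi>)) - q powi 1 *x fX True (fX True (fX False \<phi>)))"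
      using f32[of \<phi>] unfolding 3 by (simp add: linX diff_eq_eq)
    then show ?thesis using True
      by (simp add: qnum_two X.scale_right_diff_distrib X.scale_left_distrib powi_mult)
  qed
qed

lemma r21: "rX True (rX False \<phi>) = q powi 1 *x rX False (rX True \<phi>) + r3X \<phi>"
proof (rule X_linear_eqI[where A = "\<lambda>\<phi>. rX True (rX False \<phi>)"])
  fix a b c h x
  assume "wt h x"
  show "rX True (rX False (sg a b c x)) = q powi 1 *x rX False (rX True (sg a b c x)) + r3X (sg a b c x)"
    by (cases c) (use qn_Suc(1)[of "int c"] in \<open>simp_all add: expand_ops single_3 single_add scale_left_distrib algebra_simps\<close>)
qed (rule linear_ops linear_3 | rule linear_intros3)+

lemma r31: "r3X (rX False \<phi>) = q powi (- 1) *x rX False (r3X \<phi>)"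
  by (rule X_linear_eqI[where A = "\<lambda>\<phi>. r3X (rX False \<phi>)"]; ((rule linear_ops linear_3 | rule linear_intros3)+)?)
    (simp add: expand_ops single_3 X.linear_rules[OF linear_3(2)] powi_mult_left algebra_simps)

lemma r23: "rX True (r3X \<phi>) = q powi (- 1) *x r3X (rX True \<phi>)"
proof (rule X_linear_eqI[where A = "\<lambda>\<phi>. rX True (r3X \<phi>)"])
  fix a b c h x
  assume "wt h x"
  show "rX True (r3X (sg a b c x)) = q powi (- 1) *x r3X (rX True (sg a b c x))"
    by (cases c) (simp_all add: expand_ops single_3 X.linear_rules[OF linear_3(2)] powi_mult_left algebra_simps)
qed (rule linear_ops linear_3 | rule linear_intros3)+

lemma r_serre: "rX i (rX i (rX (\<not> i) \<phi>)) = qn 2 *x rX i (rX (\<not> i) (rX i \<phi>)) - rX (\<not> i) (rX i (rX i \<phi>))"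
proof -
  have 3: "r3X \<phi> = rX True (rX False \<phi>) - q powi 1 *x rX False (rX True \<phi>)" for \<phi> by (simp add: r21)
  show ?thesis
  proof (cases i)
    case True
    have "rX True (rX True (rX False \<phi>)) = q powi 1 *x rX True (rX False (rX True \<phi>)) +
      q powi (- 1) *x (rX True (rX False (rX True \<phi>)) - q powi 1 *x rX False (rX True (rX True \<phi>)))"
      using r23[of \<phi>] unfolding 3 by (simp add: linX diff_eq_eq)
    then show ?thesis using True
      by (simp add: qnum_two X.scale_right_diff_distrib X.scale_left_distrib powi_mult)
  next
    case False
    have "rX True (rX False (rX False \<phi>)) = q powi 1 *x rX False (rX True (rX False \<phi>)) +
      q powi (- 1) *x (rX False (rX True (rX False \<phi>)) - q powi 1 *x rX False (rX False (rX True \<phi>)))"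
      using r31[of \<phi>] unfolding 3 by (simp add: linX diff_eq_eq)
    then show ?thesis using False
      by (simp add: qnum_two X.scale_right_diff_distrib X.scale_left_distrib powi_mult)
  qed
qed

definition HX :: "(bool \<Rightarrow> int) \<Rightarrow> bool \<Rightarrow> 'v induced \<Rightarrow> 'v induced" where
  "HX p i \<phi> = qscale *x (kX p i \<phi> - kiX p i \<phi>)"

lemma HX_single: "wt h x \<Longrightarrow> HX p i (sg a b c x) =
    sg a b c (qn (h i + p i - cart i True * int a - int b - cart i False * int c) *s x)"
  by (simp add: HX_def k_single K_wt Ki_wt powi_mult qnum_alt algebra_simps flip: single_diff scale_left_diff_distrib)

lemma linear_HX: "Vector_Spaces.linear sX sX (HX p i)"
  unfolding HX_def by (rule linear_ops linear_3 | rule linear_intros3)+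

lemmas linear_all = linear_ops linear_3 linear_HX

lemma e_single_wt:
  assumes "wt h x"
  shows "eX p i (sg a b c x) = sg a b c (E i x) + (if i
     then sg (a - 1) b c ((qn (int a) * qn (h i + p i - int b + int c - int a + 1)) *s x)
        - sg a (b - 1) (Suc c) ((q powi (2 - int b + (h i + p i) + int c) * qn (int b)) *s x)
     else sg (Suc a) (b - 1) c ((q powi (2 * int c - (h i + p i)) * qn (int b)) *s x)
        + sg a b (c - 1) ((qn (int c) * qn (h i + p i - int c + 1)) *s x))"
   "eX p i (sg a b c (u *s x)) = sg a b c (u *s E i x) + (if i
     then sg (a - 1) b c ((u * (qn (int a) * qn (h i + p i - int b + int c - int a + 1))) *s x)
        - sg a (b - 1) (Suc c) ((u * (q powi (2 - int b + (h i + p i) + int c) * qn (int b))) *s x)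
     else sg (Suc a) (b - 1) c ((u * (q powi (2 * int c - (h i + p i)) * qn (int b))) *s x)
        + sg a b (c - 1) ((u * (qn (int c) * qn (h i + p i - int c + 1))) *s x))"
proof -
  have e: "(q powi (2 - int b + p i + int c) * qn (int b)) * q powi h i = q powi (2 - int b + (h i + p i) + int c) * qn (int b)"
    "(q powi (2 * int c - p i) * qn (int b)) * q powi (- h i) = q powi (2 * int c - (h i + p i)) * qn (int b)"
    by (simp_all add: qsimps)
  show *: "eX p i (sg a b c x) = sg a b c (E i x) + (if i
     then sg (a - 1) b c ((qn (int a) * qn (h i + p i - int b + int c - int a + 1)) *s x)
        - sg a (b - 1) (Suc c) ((q powi (2 - int b + (h i + p i) + int c) * qn (int b)) *s x)
     else sg (Suc a) (b - 1) c ((q powi (2 * int c - (h i + p i)) * qn (int b)) *s x)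
        + sg a b (c - 1) ((qn (int c) * qn (h i + p i - int c + 1)) *s x))"
    by (simp only: e_single Hop_wt[OF assms] K_wt[OF assms] Ki_wt[OF assms] scale_scale e) (simp add: algebra_simps)
  have "eX p i (sg a b c (u *s x)) = u *x eX p i (sg a b c x)" by (simp flip: linX(8))
  then show "eX p i (sg a b c (u *s x)) = sg a b c (u *s E i x) + (if i
     then sg (a - 1) b c ((u * (qn (int a) * qn (h i + p i - int b + int c - int a + 1))) *s x)
        - sg a (b - 1) (Suc c) ((u * (q powi (2 - int b + (h i + p i) + int c) * qn (int b))) *s x)
     else sg (Suc a) (b - 1) c ((u * (q powi (2 * int c - (h i + p i)) * qn (int b))) *s x)
        + sg a b (c - 1) ((u * (qn (int c) * qn (h i + p i - int c + 1))) *s x))"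
    by (simp add: * X.scale_right_distrib X.scale_right_diff_distrib)
qed

lemma powi_mult_across:
  "q powi x * (qn y * q powi z) = qn y * q powi (x + z)"
  "q powi x * (qn y * (q powi z * u)) = qn y * (q powi (x + z) * u)"
  by (simp_all add: powi_mult powi_mult_left mult.left_commute)

lemmas expand_e = powi_mult powi_mult_left powi_mult_across f_single linX X.scale_right_distrib X.scale_right_diff_distrib

lemma e_f_FT: "eX p False (fX True \<phi>) = fX True (eX p False \<phi>)"
  by (rule X_linear_eqI[where A = "\<lambda>\<phi>. eX p False (fX True \<phi>)"]; ((rule linear_all | rule linear_intros3)+)?)
    (simp add: expand_ops)

lemma e_f_TT: "eX p True (fX True \<phi>) = fX True (eX p True \<phi>) + HX p True \<phi>"
proof (rule X_linear_eqI[where A = "\<lambda>\<phi>. eX p True (fX True \<phi>)"])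
  fix a b c h x
  assume w: "wt h x"
  define G where "G = h True + p True - int b + int c"
  have id: "qn (1 + A) * qn (G - A) = qn A * qn (G - A + 1) + qn (G - 2 * A)" for A
  proof -
    have "qn (1 + A) * qn (G - A) = qn A * qn (G - A + 1) + qn 1 * qn (G - 2 * A)"
      by (simp add: qsimps del: qnum_simps)
    then show ?thesis by simp
  qed
  have F: "sg a b c ((qn (1 + int a) * qn (G - int a)) *s x) =
    sg a b c ((qn (int a) * qn (G - int a + 1)) *s x) + sg a b c (qn (G - 2 * int a) *s x)"
    by (simp add: id single_add scale_left_distrib)
  show "eX p True (fX True (sg a b c x)) = fX True (eX p True (sg a b c x)) + HX p True (sg a b c x)"
    using F by (cases a) (simp_all add: expand_e HX_single[OF w] e_single_wt[OF w] G_def algebra_simps)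
qed (rule linear_all | rule linear_intros3)+

lemma e_f_FF: "eX p False (fX False \<phi>) = fX False (eX p False \<phi>) + HX p False \<phi>"
proof (rule X_linear_eqI[where A = "\<lambda>\<phi>. eX p False (fX False \<phi>)"])
  fix a b c h x
  assume w: "wt h x"
  define G where "G = h False + p False"
  have id: "q powi (A - B) * (qn (1 + C) * qn (G - C)) + qn A * (q powi (2 * C - G) * qn (1 + B)) =
    qn B * (q powi (2 * C - G) * qn (1 + A)) + q powi (A - B) * (qn C * qn (G - C + 1)) + qn (G - 2 * C + A - B)" for A B C
  proof -
    have "q powi (A - B) * (qn (1 + C) * qn (G - C)) + qn A * (q powi (2 * C - G) * qn (1 + B)) =
    qn B * (q powi (2 * C - G) * qn (1 + A)) + q powi (A - B) * (qn C * qn (G - C + 1)) + qn 1 * qn (G - 2 * C + A - B)"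
      by (simp add: qsimps del: qnum_simps)
    then show ?thesis by simp
  qed
  have F: "sg a b c ((q powi (int a - int b) * (qn (1 + int c) * qn (G - int c))) *s x) + sg a b c ((qn (int a) * (q powi (2 * int c - G) * qn (1 + int b))) *s x) =
    sg a b c ((qn (int b) * (q powi (2 * int c - G) * qn (1 + int a))) *s x) + sg a b c ((q powi (int a - int b) * (qn (int c) * qn (G - int c + 1))) *s x)
    + sg a b c (qn (G - 2 * int c + int a - int b) *s x)"
    by (simp add: id flip: single_add scale_left_distrib)
  show "eX p False (fX False (sg a b c x)) = fX False (eX p False (sg a b c x)) + HX p False (sg a b c x)"
    using F by (cases a; cases b; cases c) (simp_all add: expand_e HX_single[OF w] e_single_wt[OF w] G_def algebra_simps)
qed (rule linear_all | rule linear_intros3)+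

lemma e_f_TF: "eX p True (fX False \<phi>) = fX False (eX p True \<phi>)"
proof (rule X_linear_eqI[where A = "\<lambda>\<phi>. eX p True (fX False \<phi>)"])
  fix a b c h x
  assume w: "wt h x"
  define H where "H = h True + p True"
  have id: "q powi (A - B) * (qn A * qn (H + C + 2 - B - A)) + qn B * (q powi (2 - B + H + C) * qn A) =
    qn A * (q powi (1 - B + H + C) * qn (1 + B)) + q powi (A - 1 - B) * (qn A * qn (H - B + C - A + 1))" for A B C
    by (simp add: qsimps)
  have F: "sg (a - 1) b (Suc c) ((q powi (int a - int b) * (qn (int a) * qn (H + int c + 2 - int b - int a))) *s x) +
     sg (a - 1) b (Suc c) ((qn (int b) * (q powi (2 - int b + H + int c) * qn (int a))) *s x) =
    sg (a - 1) b (Suc c) ((qn (int a) * (q powi (1 - int b + H + int c) * qn (1 + int b))) *s x) +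
    sg (a - 1) b (Suc c) ((q powi (int a - 1 - int b) * (qn (int a) * qn (H - int b + int c - int a + 1))) *s x)"
    by (simp add: id flip: single_add scale_left_distrib)
  show "eX p True (fX False (sg a b c x)) = fX False (eX p True (sg a b c x))"
    using F by (cases a; cases b; cases "a - 1") (simp_all add: expand_e HX_single[OF w] e_single_wt[OF w] H_def algebra_simps)
qed (rule linear_all | rule linear_intros3)+

lemma e_f: "eX p i (fX j \<phi>) = fX j (eX p i \<phi>) + (if i = j then HX p i \<phi> else 0)"
  by (cases i; cases j; simp add: e_f_FT e_f_TT e_f_FF e_f_TF)

lemma k_f: "kX p i (fX j \<phi>) = q powi (- cart i j) *x fX j (kX p i \<phi>)"
proof (rule X_linear_eqI[where A = "\<lambda>\<phi>. kX p i (fX j \<phi>)"])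
  fix a b c h x assume w: "wt h x"
  show "kX p i (fX j (sg a b c x)) = q powi (- cart i j) *x fX j (kX p i (sg a b c x))"
    by (cases i; cases j; cases a; simp add: f_single k_single K_wt[OF w] linX lin powi_mult powi_mult_left powi_mult_across X.scale_right_distrib cart_def algebra_simps)
qed (rule linear_all | rule linear_intros3)+

lemma k_r: "kX p i (rX j \<phi>) = q powi (- cart i j) *x rX j (kX p i \<phi>)"
proof (rule X_linear_eqI[where A = "\<lambda>\<phi>. kX p i (rX j \<phi>)"])
  fix a b c h x assume w: "wt h x"
  show "kX p i (rX j (sg a b c x)) = q powi (- cart i j) *x rX j (kX p i (sg a b c x))"
    by (cases i; cases j; cases c; simp add: r_single k_single K_wt[OF w] linX lin powi_mult powi_mult_left powi_mult_across X.scale_right_distrib cart_def algebra_simps)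
qed (rule linear_all | rule linear_intros3)+

lemma linear_ident: "Vector_Spaces.linear sX sX (\<lambda>x. x)"
  by (rule X.linearI) simp_all

lemma ki_k: "kiX p i (kX p i \<phi>) = \<phi>"
proof (rule X_linear_eqI[where A = "\<lambda>\<phi>. kiX p i (kX p i \<phi>)"])
  fix a b c h x assume w: "wt h x"
  show "kiX p i (kX p i (sg a b c x)) = sg a b c x"
    by (simp add: k_single K_wt[OF w] Ki_wt[OF w] lin powi_mult)
qed (rule linear_all linear_ident | rule linear_intros3)+

text \<open>The induced module is generated by its vectors $1 \otimes x$ under the lowering operators.\<close>

lemma X_induct [case_names gen add scale f]:
  assumes "\<And>h x. wt h x \<Longrightarrow> P (sg 0 0 0 x)" "\<And>\<phi> \<psi>. P \<phi> \<Longrightarrow> P \<psi> \<Longrightarrow> P (\<phi> + \<psi>)"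
    "\<And>c \<phi>. P \<phi> \<Longrightarrow> P (c *x \<phi>)" "\<And>i \<phi>. P \<phi> \<Longrightarrow> P (fX i \<phi>)"
  shows "P \<phi>"
proof (induction \<phi> rule: poly_mapping_additive_induct)
  case (single k x)
  have diff: "P (\<phi> - \<psi>)" if "P \<phi>" "P \<psi>" for \<phi> \<psi>
    using assms(2)[OF that(1) assms(3)[OF that(2), of "- 1"]] by simp
  have f3: "P (f3X \<phi>)" if "P \<phi>" for \<phi>
  proof -
    have "f3X \<phi> = fX False (fX True \<phi>) - q powi 1 *x fX True (fX False \<phi>)" by (simp add: f12)
    then show ?thesis using diff[of "fX False (fX True \<phi>)" "q powi 1 *x fX True (fX False \<phi>)"] assms(3,4) that by simp
  qed
  obtain a b c where k: "k = (a, b, c)" by (cases k)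
  have 0: "P (sg 0 0 0 x)"
  proof (rule weight_generated[of _ x])
    show "P (sg 0 0 0 x)" if "\<And>i. K i x = q powi h i *s x" for h x
      by (rule assms(1)[of h]) (simp add: wt_def that)
    show "P (sg 0 0 0 (x + y))" if "P (sg 0 0 0 x)" "P (sg 0 0 0 y)" for x y
      using assms(2)[OF that] by (simp add: single_add)
  qed
  have 1: "P (sg 0 0 c x)" for c
  proof (induction c)
    case (Suc c) then show ?case using assms(4)[of "sg 0 0 c x" False] by (simp add: f_single)
  qed (rule 0)
  have 2: "P (sg 0 b c x)" for b c
  proof (induction b)
    case (Suc b) then show ?case using f3[of "sg 0 b c x"] by (simp add: single_3)
  qed (rule 1)
  have "P (sg a b c x)" for a b c
  proof (induction a)
    case (Suc a) then show ?case using assms(4)[of "sg a b c x" True] by (simp add: f_single)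
  qed (rule 2)
  then show ?case by (simp add: k)
next
  case (add \<phi> \<psi>) then show ?case by (rule assms(2))
qed

lemma X_linear_f_eqI:
  assumes "Vector_Spaces.linear sX sX A" "Vector_Spaces.linear sX sX B"
    and "\<And>h x. wt h x \<Longrightarrow> A (sg 0 0 0 x) = B (sg 0 0 0 x)"
    and "\<And>i \<phi>. A \<phi> = B \<phi> \<Longrightarrow> A (fX i \<phi>) = B (fX i \<phi>)"
  shows "A \<phi> = B \<phi>"
  by (induction \<phi> rule: X_induct) (simp_all add: assms X.linear_rules[OF assms(1)] X.linear_rules[OF assms(2)])

lemma k_HX: "kX p l (HX p i \<phi>) = HX p i (kX p l \<phi>)"
proof (rule X_linear_eqI[where A = "\<lambda>\<phi>. kX p l (HX p i \<phi>)"])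
  fix a b c h x assume w: "wt h x"
  show "kX p l (HX p i (sg a b c x)) = HX p i (kX p l (sg a b c x))"
    by (simp add: HX_single[OF w] HX_single[OF wt_scale[OF w]] k_single K_wt[OF w] lin mult_ac)
qed (rule linear_all | rule linear_intros3 | rule linear_comp[OF linear_HX])+

lemma k_e: "kX p l (eX p i \<phi>) = q powi (cart l i) *x eX p i (kX p l \<phi>)"
proof (rule X_linear_f_eqI[where A = "\<lambda>\<phi>. kX p l (eX p i \<phi>)"])
  fix h x assume w: "wt h x"
  show "kX p l (eX p i (sg 0 0 0 x)) = q powi (cart l i) *x eX p i (kX p l (sg 0 0 0 x))"
    by (simp add: e_single k_single K_wt[OF w] K_wt[OF wt_E[OF w]] linX lin powi_mult algebra_simps)
next
  fix j \<phi>
  assume "kX p l (eX p i \<phi>) = q powi cart l i *x eX p i (kX p l \<phi>)"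
  then show "kX p l (eX p i (fX j \<phi>)) = q powi cart l i *x eX p i (kX p l (fX j \<phi>))"
    by (simp add: e_f linX k_f k_HX powi_mult X.scale_right_distrib)
qed (rule linear_all | rule linear_intros3)+

text \<open>The operator of the shifted coroot on the induced module; with the shift explicit, it can be moved past \<open>e\<close>.\<close>

definition HS :: "int \<Rightarrow> (bool \<Rightarrow> int) \<Rightarrow> bool \<Rightarrow> 'v induced \<Rightarrow> 'v induced" where
  "HS n p i \<phi> = qscale *x (q powi n *x kX p i \<phi> - q powi (- n) *x kiX p i \<phi>)"

lemma HX_HS: "HX p i \<phi> = HS 0 p i \<phi>" by (simp add: HX_def HS_def)

lemma ki_e: "kiX p i (eX p j \<phi>) = q powi (- cart i j) *x eX p j (kiX p i \<phi>)"
proof -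
  have k_ki: "kX p i (kiX p i \<phi>) = \<phi>" for \<phi>
  proof (rule X_linear_eqI[where A = "\<lambda>\<phi>. kX p i (kiX p i \<phi>)"])
    fix a b c h x assume w: "wt h x"
    show "kX p i (kiX p i (sg a b c x)) = sg a b c x"
      by (simp add: k_single K_wt[OF w] Ki_wt[OF w] lin powi_mult)
  qed (rule linear_all linear_ident | rule linear_intros3)+
  have "eX p j \<phi> = q powi (- cart i j) *x kX p i (eX p j (kiX p i \<phi>))"
    by (simp add: k_e k_ki powi_mult)
  then have "kiX p i (eX p j \<phi>) = q powi (- cart i j) *x kiX p i (kX p i (eX p j (kiX p i \<phi>)))"
    by (simp add: linX)
  then show ?thesis by (simp add: ki_k)
qed

lemma HS_e: "HS n p i (eX p j \<phi>) = eX p j (HS (n + cart i j) p i \<phi>)"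
  by (simp add: HS_def k_e ki_e linX powi_mult X.scale_right_diff_distrib algebra_simps)

lemma HS_sum: "HS (n + 1) p i \<phi> + HS (n - 1) p i \<phi> = qn 2 *x HS n p i \<phi>"
proof -
  have "HS (n + 1) p i \<phi> + HS (n - 1) p i \<phi> =
    (qscale * (q powi (n + 1) + q powi (n - 1))) *x kX p i \<phi> - (qscale * (q powi (- 1 - n) + q powi (1 - n))) *x kiX p i \<phi>"
    by (simp add: HS_def X.scale_right_diff_distrib X.scale_left_distrib algebra_simps)
  also have "q powi (n + 1) + q powi (n - 1) = qn 2 * q powi n"
    unfolding qnum_two by (simp add: qsimps)
  also have "q powi (- 1 - n) + q powi (1 - n) = qn 2 * q powi (- n)"
    unfolding qnum_two by (simp add: qsimps)
  finally show ?thesis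
    by (simp add: HS_def X.scale_right_diff_distrib mult_ac)
qed

lemma e_linears: "eX p i (x + y) = eX p i x + eX p i y" "eX p i (c *x x) = c *x eX p i x" "eX p i (x - y) = eX p i x - eX p i y" "eX p i 0 = 0"
  "fX j (x + y) = fX j x + fX j y" "fX j (c *x x) = c *x fX j x" "fX j (x - y) = fX j x - fX j y" "fX j 0 = 0"
  by (simp_all add: linX)

text \<open>The defect of the relation vanishes on $1 \otimes x$ and commutes with the lowering operators.\<close>

lemma e_serre: "eX p i (eX p i (eX p (\<not> i) \<phi>)) = qn 2 *x eX p i (eX p (\<not> i) (eX p i \<phi>)) - eX p (\<not> i) (eX p i (eX p i \<phi>))"
proof (rule X_linear_f_eqI[where A = "\<lambda>\<phi>. eX p i (eX p i (eX p (\<not> i) \<phi>))"])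
  fix h x assume w: "wt h x"
  have "eX p i (sg 0 0 0 y) = sg 0 0 0 (E i y)" for i y by (simp add: e_single)
  then show "eX p i (eX p i (eX p (\<not> i) (sg 0 0 0 x))) = qn 2 *x eX p i (eX p (\<not> i) (eX p i (sg 0 0 0 x))) - eX p (\<not> i) (eX p i (eX p i (sg 0 0 0 x)))"
    by (simp add: E_serre single_diff)
next
  fix j \<phi>
  define o' where "o' = (\<not> i)"
  assume IH: "eX p i (eX p i (eX p (\<not> i) \<phi>)) = qn 2 *x eX p i (eX p (\<not> i) (eX p i \<phi>)) - eX p (\<not> i) (eX p i (eX p i \<phi>))"
  have hs: "HS 1 p i \<phi> = qn 2 *x HS 0 p i \<phi> - HS (- 1) p i \<phi>" "HS 2 p i \<phi> = qn 2 *x HS 1 p i \<phi> - HS 0 p i \<phi>"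
    "HS 0 p o' \<phi> = qn 2 *x HS (- 1) p o' \<phi> - HS (- 2) p o' \<phi>"
    using HS_sum[of 0 p i \<phi>] HS_sum[of 1 p i \<phi>] HS_sum[of "-1" p o' \<phi>] by (simp_all add: eq_diff_eq)
  have H1: "eX p i (eX p o' (HS 1 p i \<phi>)) = qn 2 *x eX p i (eX p o' (HS 0 p i \<phi>)) - eX p i (eX p o' (HS (- 1) p i \<phi>))"
    by (simp only: hs(1) e_linears)
  have H2: "eX p o' (eX p i (HS 2 p i \<phi>)) = qn 2 *x eX p o' (eX p i (HS 1 p i \<phi>)) - eX p o' (eX p i (HS 0 p i \<phi>))"
    by (simp only: hs(2) e_linears)
  have H3: "eX p i (eX p i (HS 0 p o' \<phi>)) = qn 2 *x eX p i (eX p i (HS (- 1) p o' \<phi>)) - eX p i (eX p i (HS (- 2) p o' \<phi>))"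
    by (simp only: hs(3) e_linears)
  have o: "(o' = i) = False" "(i = o') = False" "cart i o' = -1" "cart o' i = -1" by (simp_all add: o'_def)
  have "(eX p i (eX p i (eX p o' (fX j \<phi>)))) = qn 2 *x eX p i (eX p o' (eX p i (fX j \<phi>))) - eX p o' (eX p i (eX p i (fX j \<phi>)))"
  proof (cases "j = i")
    case True
    then show ?thesis
      by (simp add: e_f o e_linears HX_HS HS_e IH[folded o'_def] H1 H2 X.scale_right_distrib algebra_simps)
  next
    case False
    then have "j = o'" by (auto simp: o'_def)
    then show ?thesis
      by (simp add: e_f o e_linears HX_HS HS_e IH[folded o'_def] H3 X.scale_right_distrib algebra_simps)
  qed
  then show "eX p i (eX p i (eX p (\<not> i) (fX j \<phi>))) = qn 2 *x eX p i (eX p (\<not> i) (eX p i (fX j \<phi>))) - eX p (\<not> i) (eX p i (eX p i (fX j \<phi>)))"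
    by (simp add: o'_def)
qed (rule linear_all | rule linear_intros3)+

section \<open>Weights and the Casimir element\<close>

definition wtX :: "(bool \<Rightarrow> int) \<Rightarrow> (bool \<Rightarrow> int) \<Rightarrow> 'v induced \<Rightarrow> bool" where
  "wtX p h \<phi> \<longleftrightarrow> (\<forall>i. kX p i \<phi> = q powi h i *x \<phi>)"

lemma wtX_f: "wtX p h \<phi> \<Longrightarrow> wtX p (\<lambda>j. h j - cart j i) (fX i \<phi>)"
  and wtX_e: "wtX p h \<phi> \<Longrightarrow> wtX p (\<lambda>j. h j + cart j i) (eX p i \<phi>)"
  and wtX_scale: "wtX p h \<phi> \<Longrightarrow> wtX p h (c *x \<phi>)"
  and wtX_add: "wtX p h \<phi> \<Longrightarrow> wtX p h \<psi> \<Longrightarrow> wtX p h (\<phi> + \<psi>)"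
  and wtX_diff: "wtX p h \<phi> \<Longrightarrow> wtX p h \<psi> \<Longrightarrow> wtX p h (\<phi> - \<psi>)"
  and wtX_0: "wtX p h 0"
  by (simp_all add: wtX_def k_f k_e linX powi_mult mult.commute X.scale_right_distrib X.scale_right_diff_distrib)

lemma ki_wtX: "wtX p h \<phi> \<Longrightarrow> kiX p i \<phi> = q powi (- h i) *x \<phi>"
proof -
  assume h: "wtX p h \<phi>"
  have "\<phi> = kiX p i (q powi h i *x \<phi>)" using ki_k[of p i \<phi>] h by (simp add: wtX_def)
  also have "\<dots> = q powi h i *x kiX p i \<phi>" by (simp add: linX)
  finally have "q powi (- h i) *x \<phi> = q powi (- h i) *x q powi h i *x kiX p i \<phi>" by simp
  then show ?thesis by (simp add: powi_mult)
qed

lemma HX_wtX: "wtX p h \<phi> \<Longrightarrow> HX p i \<phi> = qn (h i) *x \<phi>"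
  using ki_wtX[of p h \<phi> i] by (simp add: HX_def wtX_def qnum_alt flip: X.scale_left_diff_distrib)

definition e3X :: "(bool \<Rightarrow> int) \<Rightarrow> 'v induced \<Rightarrow> 'v induced" where
  "e3X p \<phi> = eX p True (eX p False \<phi>) - q powi 1 *x eX p False (eX p True \<phi>)"

lemma f3X_eq: "f3X \<phi> = fX False (fX True \<phi>) - q powi 1 *x fX True (fX False \<phi>)"
  by (simp add: f12)

lemma linear_e3X: "Vector_Spaces.linear sX sX (e3X p)"
  unfolding e3X_def by (rule linear_all | rule linear_intros3)+

lemmas lin3 = X.linear_rules[OF linear_3(1)] X.linear_rules[OF linear_e3X] linX

lemma e1_e3: "eX p False (e3X p \<phi>) = q powi 1 *x e3X p (eX p False \<phi>)"
  by (simp add: e3X_def linX e_serre[of p False \<phi>, simplified] qnum_two X.scale_right_diff_distrib X.scale_right_distrib X.scale_left_distrib powi_mult)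

lemma e2_e3: "eX p True (e3X p \<phi>) = q powi (- 1) *x e3X p (eX p True \<phi>)"
  by (simp add: e3X_def linX e_serre[of p True \<phi>, simplified] qnum_two X.scale_right_diff_distrib X.scale_right_distrib X.scale_left_distrib powi_mult)

lemma wtX_3:
  assumes "wtX p h \<phi>"
  shows "wtX p (\<lambda>j. h j + 1) (e3X p \<phi>)" "wtX p (\<lambda>j. h j - 1) (f3X \<phi>)"
proof -
  have c: "cart j True + cart j False = 1" for j by (cases j) (simp_all add: cart_def)
  have "wtX p (\<lambda>j. h j + 1) (eX p True (eX p False \<phi>))" "wtX p (\<lambda>j. h j + 1) (eX p False (eX p True \<phi>))"
    using wtX_e[OF wtX_e[OF assms, of False], of True] wtX_e[OF wtX_e[OF assms, of True], of False] c
    by (simp_all add: algebra_simps)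
  then show "wtX p (\<lambda>j. h j + 1) (e3X p \<phi>)" unfolding e3X_def by (intro wtX_diff wtX_scale)
  have "wtX p (\<lambda>j. h j - 1) (fX True (fX False \<phi>))" "wtX p (\<lambda>j. h j - 1) (fX False (fX True \<phi>))"
    using wtX_f[OF wtX_f[OF assms, of False], of True] wtX_f[OF wtX_f[OF assms, of True], of False] c
    by (simp_all add: algebra_simps)
  then show "wtX p (\<lambda>j. h j - 1) (f3X \<phi>)" unfolding f3X_eq by (intro wtX_diff wtX_scale)
qed

context
  fixes p h \<phi> assumes w: "wtX p h \<phi>"
begin

lemma qn_diff: "qn (x + 1) - q powi 1 * qn x = q powi (- x)" "qn x - q powi 1 * qn (x + 1) = - (q powi (x + 1))"
  "qn x - q powi 1 * qn (x - 1) = q powi (1 - x)" "qn (x - 1) - q powi 1 * qn x = - (q powi x)"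
  using qn_Suc(1)[of x] qn_Suc(1)[of "x - 1"] qn_Suc(2)[of x] qn_Suc(2)[of "x - 1"]
  by (simp_all add: add.commute algebra_simps powi_mult powi_mult_left)

lemma e1_f3: "eX p False (f3X \<phi>) = f3X (eX p False \<phi>) + q powi (- h False) *x fX True \<phi>"
  using qn_diff(1)[of "h False"]
  by (simp add: f3X_eq linX e_f HX_wtX[OF w] HX_wtX[OF wtX_f[OF w]] cart_def X.scale_right_distrib algebra_simps
    flip: X.scale_left_diff_distrib)

lemma e2_f3: "eX p True (f3X \<phi>) = f3X (eX p True \<phi>) - q powi (h True + 1) *x fX False \<phi>"
proof -
  have "qn (h True) + q powi (1 + h True) = q powi 1 * qn (1 + h True)"
    using qn_diff(2)[of "h True"] by (simp add: algebra_simps)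
  from arg_cong[OF this, of "\<lambda>c. c *x fX False \<phi>"] show ?thesis
    by (simp add: f3X_eq linX e_f HX_wtX[OF w] HX_wtX[OF wtX_f[OF w]] cart_def X.scale_right_distrib algebra_simps)
qed

lemma e3_f1: "e3X p (fX False \<phi>) = fX False (e3X p \<phi>) + q powi (1 - h False) *x eX p True \<phi>"
  using qn_diff(3)[of "h False"]
  by (simp add: e3X_def linX e_f HX_wtX[OF w] HX_wtX[OF wtX_e[OF w]] cart_def X.scale_right_distrib algebra_simps
    flip: X.scale_left_diff_distrib)

lemma e3_f2: "e3X p (fX True \<phi>) = fX True (e3X p \<phi>) - q powi (h True) *x eX p False \<phi>"
proof -
  have "q powi h True + qn (h True - 1) = q powi 1 * qn (h True)"
    using qn_diff(4)[of "h True"] by (simp add: algebra_simps)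
  from arg_cong[OF this, of "\<lambda>c. c *x eX p False \<phi>"] show ?thesis
    by (simp add: e3X_def linX e_f HX_wtX[OF w] HX_wtX[OF wtX_e[OF w]] cart_def X.scale_right_distrib algebra_simps)
qed

end

text \<open>The value of the Casimir operator on a singular vector of weight \<open>(l1, l2, l3)\<close> for the quantum group of \<open>gl\<^sub>3\<close>.\<close>

definition casimir_value :: "int \<Rightarrow> int \<Rightarrow> int \<Rightarrow> complex" where
  "casimir_value l1 l2 l3 = q powi (2 * l1 + 2) + q powi (2 * l2) + q powi (2 * l3 - 2)"

definition kappa :: complex where "kappa = (q powi 1 - q powi (- 1)) * (q powi 1 - q powi (- 1))"

text \<open>The Casimir operator, written for vectors of weight \<open>(l1, l2, l3)\<close>, on which its Cartan part is a
  scalar. This is why the weight is a parameter, and why it is shifted in the commutation rules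
  with the raising and lowering operators.\<close>

definition casimir :: "(bool \<Rightarrow> int) \<Rightarrow> int \<Rightarrow> int \<Rightarrow> int \<Rightarrow> 'v induced \<Rightarrow> 'v induced" where
  "casimir p l1 l2 l3 \<phi> = casimir_value l1 l2 l3 *x \<phi> + (kappa * q powi (l1 + l2 + 1)) *x fX False (eX p False \<phi>)
    + (kappa * q powi (l2 + l3 - 1)) *x fX True (eX p True \<phi>)
    + (kappa * q powi (l1 + l3 - 1)) *x f3X (e3X p \<phi>)"

text \<open>The weight of type $A_2$ underlying a weight of \<open>gl\<^sub>3\<close>.\<close>

definition gl3_weight :: "int \<Rightarrow> int \<Rightarrow> int \<Rightarrow> bool \<Rightarrow> int" where
  "gl3_weight l1 l2 l3 = (\<lambda>i. if i then l2 - l3 else l1 - l2)"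

lemma kappa_qn: "kappa * (q powi y * qn x) = q powi (y + x + 1) + q powi (y - x - 1) - q powi (y + x - 1) - q powi (y - x + 1)"
proof -
  have 1: "(q powi 1 - q powi (- 1)) * qscale = 1"
    using qscale_kappa by (simp add: power_int_1_right power_int_minus1_right mult.commute)
  have "kappa * (q powi y * qn x) = ((q powi 1 - q powi (- 1)) * qscale) * ((q powi 1 - q powi (- 1)) * (q powi y * (q powi x - q powi (- x))))"
    by (simp add: kappa_def qnum_alt mult_ac)
  then show ?thesis unfolding 1 by (simp add: powi_mult powi_mult_left algebra_simps)
qed

lemma casimir_value_shift:
  "casimir_value l1 l2 l3 + kappa * (q powi (l1 + l2 + 1) * qn (l1 - l2 + 2)) = casimir_value (l1 + 1) (l2 - 1) l3"
  "casimir_value l1 l2 l3 + kappa * (q powi (l2 + l3 - 1) * qn (l2 - l3 + 2)) = casimir_value l1 (l2 + 1) (l3 - 1)"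
  "casimir_value (l1 - 1) (l2 + 1) l3 + kappa * (q powi (l1 + l2 + 1) * qn (l1 - l2)) = casimir_value l1 l2 l3"
  "casimir_value l1 (l2 - 1) (l3 + 1) + kappa * (q powi (l2 + l3 - 1) * qn (l2 - l3)) = casimir_value l1 l2 l3"
  unfolding kappa_qn by (simp_all add: casimir_value_def algebra_simps)

context
  fixes p l1 l2 l3 \<phi> assumes w: "wtX p (gl3_weight l1 l2 l3) \<phi>"
begin

lemma e1_casimir: "eX p False (casimir p l1 l2 l3 \<phi>) = casimir p (l1 + 1) (l2 - 1) l3 (eX p False \<phi>)"
proof -
  have A: "eX p False (fX False (eX p False \<phi>)) = fX False (eX p False (eX p False \<phi>)) + qn (l1 - l2 + 2) *x eX p False \<phi>"
    using HX_wtX[OF wtX_e[OF w, of False], of False] by (simp add: e_f gl3_weight_def cart_def)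
  have B: "eX p False (fX True (eX p True \<phi>)) = fX True (eX p False (eX p True \<phi>))" by (simp add: e_f)
  have C: "eX p False (f3X (e3X p \<phi>)) = q powi 1 *x f3X (e3X p (eX p False \<phi>)) + q powi (- (l1 - l2 + 1)) *x fX True (e3X p \<phi>)"
    using e1_f3[OF wtX_3(1)[OF w]] by (simp add: e1_e3 gl3_weight_def lin3)
  have D: "fX True (eX p True (eX p False \<phi>)) = fX True (e3X p \<phi>) + q powi 1 *x fX True (eX p False (eX p True \<phi>))"
    by (simp add: e3X_def linX)
  have "eX p False (casimir p l1 l2 l3 \<phi>) = (casimir_value l1 l2 l3 + kappa * (q powi (l1 + l2 + 1) * qn (l1 - l2 + 2))) *x eX p False \<phi>
     + (kappa * q powi (l1 + l2 + 1)) *x fX False (eX p False (eX p False \<phi>))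
     + (kappa * q powi (l2 + l3 - 1)) *x fX True (eX p False (eX p True \<phi>))
     + (kappa * q powi (l1 + l3)) *x f3X (e3X p (eX p False \<phi>))
     + (kappa * q powi (l2 + l3 - 2)) *x fX True (e3X p \<phi>)"
    by (simp add: casimir_def linX A B C X.scale_right_distrib X.scale_left_distrib powi_mult mult.assoc algebra_simps)
  also have "\<dots> = casimir p (l1 + 1) (l2 - 1) l3 (eX p False \<phi>)"
    unfolding casimir_value_shift casimir_def D by (simp add: X.scale_right_distrib powi_mult mult.assoc algebra_simps)
  finally show ?thesis .
qed

lemma e2_casimir: "eX p True (casimir p l1 l2 l3 \<phi>) = casimir p l1 (l2 + 1) (l3 - 1) (eX p True \<phi>)"
proof -
  have A: "eX p True (fX True (eX p True \<phi>)) = fX True (eX p True (eX p True \<phi>)) + qn (l2 - l3 + 2) *x eX p True \<phi>"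
    using HX_wtX[OF wtX_e[OF w, of True], of True] by (simp add: e_f gl3_weight_def cart_def)
  have D: "fX False (eX p True (eX p False \<phi>)) = fX False (e3X p \<phi>) + q powi 1 *x fX False (eX p False (eX p True \<phi>))"
    by (simp add: e3X_def linX)
  have B: "eX p True (fX False (eX p False \<phi>)) = fX False (e3X p \<phi>) + q powi 1 *x fX False (eX p False (eX p True \<phi>))"
    by (simp add: e_f D)
  have C: "eX p True (f3X (e3X p \<phi>)) = q powi (- 1) *x f3X (e3X p (eX p True \<phi>)) - q powi (l2 - l3 + 2) *x fX False (e3X p \<phi>)"
    using e2_f3[OF wtX_3(1)[OF w]] by (simp add: e2_e3 gl3_weight_def lin3 algebra_simps)
  have "eX p True (casimir p l1 l2 l3 \<phi>) = (casimir_value l1 l2 l3 + kappa * (q powi (l2 + l3 - 1) * qn (l2 - l3 + 2))) *x eX p True \<phi>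
     + (kappa * q powi (l1 + l2 + 2)) *x fX False (eX p False (eX p True \<phi>))
     + (kappa * q powi (l2 + l3 - 1)) *x fX True (eX p True (eX p True \<phi>))
     + (kappa * q powi (l1 + l3 - 2)) *x f3X (e3X p (eX p True \<phi>))"
    by (simp add: casimir_def linX A B C X.scale_right_distrib X.scale_right_diff_distrib X.scale_left_distrib powi_mult mult.assoc algebra_simps)
  also have "\<dots> = casimir p l1 (l2 + 1) (l3 - 1) (eX p True \<phi>)"
    unfolding casimir_value_shift casimir_def by (simp add: X.scale_right_distrib powi_mult mult.assoc algebra_simps)
  finally show ?thesis .
qed

lemma f1_casimir: "fX False (casimir p l1 l2 l3 \<phi>) = casimir p (l1 - 1) (l2 + 1) l3 (fX False \<phi>)"
proof -
  have A: "eX p False (fX False \<phi>) = fX False (eX p False \<phi>) + qn (l1 - l2) *x \<phi>"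
    using HX_wtX[OF w, of False] by (simp add: e_f gl3_weight_def)
  have B: "eX p True (fX False \<phi>) = fX False (eX p True \<phi>)" by (simp add: e_f)
  have C: "e3X p (fX False \<phi>) = fX False (e3X p \<phi>) + q powi (1 - (l1 - l2)) *x eX p True \<phi>"
    using e3_f1[OF w] by (simp add: gl3_weight_def)
  have D: "fX False (fX True \<psi>) = q powi 1 *x fX True (fX False \<psi>) + f3X \<psi>" for \<psi> by (rule f12)
  have F: "f3X (fX False \<psi>) = q powi 1 *x fX False (f3X \<psi>)" for \<psi>
    by (simp add: f13 powi_mult)
  have "casimir p (l1 - 1) (l2 + 1) l3 (fX False \<phi>) = (casimir_value (l1 - 1) (l2 + 1) l3 + kappa * (q powi (l1 + l2 + 1) * qn (l1 - l2))) *x fX False \<phi>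
     + (kappa * q powi (l1 + l2 + 1)) *x fX False (fX False (eX p False \<phi>))
     + (kappa * q powi (l2 + l3)) *x fX True (fX False (eX p True \<phi>))
     + (kappa * q powi (l2 + l3 - 1)) *x f3X (eX p True \<phi>)
     + (kappa * q powi (l1 + l3 - 1)) *x fX False (f3X (e3X p \<phi>))"
    by (simp add: casimir_def lin3 A B C F X.scale_right_distrib X.scale_right_diff_distrib X.scale_left_distrib powi_mult mult.assoc algebra_simps)
  also have "\<dots> = fX False (casimir p l1 l2 l3 \<phi>)"
    unfolding casimir_value_shift casimir_def by (simp add: lin3 D X.scale_right_distrib powi_mult mult.assoc algebra_simps)
  finally show ?thesis by simp
qed

lemma f2_casimir: "fX True (casimir p l1 l2 l3 \<phi>) = casimir p l1 (l2 - 1) (l3 + 1) (fX True \<phi>)"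
proof -
  have A: "eX p True (fX True \<phi>) = fX True (eX p True \<phi>) + qn (l2 - l3) *x \<phi>"
    using HX_wtX[OF w, of True] by (simp add: e_f gl3_weight_def)
  have B: "eX p False (fX True \<phi>) = fX True (eX p False \<phi>)" by (simp add: e_f)
  have C: "e3X p (fX True \<phi>) = fX True (e3X p \<phi>) - q powi (l2 - l3) *x eX p False \<phi>"
    using e3_f2[OF w] by (simp add: gl3_weight_def)
  have D: "fX False (fX True \<psi>) = q powi 1 *x fX True (fX False \<psi>) + f3X \<psi>" for \<psi> by (rule f12)
  have F: "f3X (fX True \<psi>) = q powi (- 1) *x fX True (f3X \<psi>)" for \<psi> by (rule f32)
  have "casimir p l1 (l2 - 1) (l3 + 1) (fX True \<phi>) = (casimir_value l1 (l2 - 1) (l3 + 1) + kappa * (q powi (l2 + l3 - 1) * qn (l2 - l3))) *x fX True \<phi>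
     + (kappa * q powi (l1 + l2 + 1)) *x fX True (fX False (eX p False \<phi>))
     + (kappa * q powi (l2 + l3 - 1)) *x fX True (fX True (eX p True \<phi>))
     + (kappa * q powi (l1 + l3 - 1)) *x fX True (f3X (e3X p \<phi>))"
    by (simp add: casimir_def lin3 A B C D F X.scale_right_distrib X.scale_right_diff_distrib X.scale_left_distrib powi_mult mult.assoc algebra_simps)
  also have "\<dots> = fX True (casimir p l1 l2 l3 \<phi>)"
    unfolding casimir_value_shift casimir_def by (simp add: lin3 X.scale_right_distrib powi_mult mult.assoc algebra_simps)
  finally show ?thesis by simp
qed

end

section \<open>Singular vectors\<close>

lemma lookup_k: "Poly_Mapping.lookup (kX p i \<phi>) (a, b, c) =
    q powi (p i - cart i True * int a - int b - cart i False * int c) *s K i (Poly_Mapping.lookup \<phi> (a, b, c))"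
proof (induction \<phi> rule: poly_mapping_additive_induct)
  case (single k x)
  obtain a' b' c' where k: "k = (a', b', c')" by (cases k)
  show ?case unfolding k by (simp add: k_single lookup_single_if lin)
next
  case (add \<phi> \<psi>) then show ?case by (simp add: linX lookup_add lin scale_right_distrib)
qed

lemma wtX_lookup: "wtX p h \<phi> \<longleftrightarrow>
  (\<forall>a b c. wt (\<lambda>i. h i - p i + cart i True * int a + int b + cart i False * int c) (Poly_Mapping.lookup \<phi> (a, b, c)))"
proof -
  have "kX p i \<phi> = q powi h i *x \<phi> \<longleftrightarrow> (\<forall>a b c. K i (Poly_Mapping.lookup \<phi> (a, b, c)) =
    q powi (h i - p i + cart i True * int a + int b + cart i False * int c) *s Poly_Mapping.lookup \<phi> (a, b, c))" for i
  proof -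
    have *: "q powi m *s K i x = q powi h i *s x \<longleftrightarrow> K i x = q powi (h i - m) *s x" for m x
    proof
      assume "q powi m *s K i x = q powi h i *s x"
      then have "q powi (- m) *s q powi m *s K i x = q powi (- m) *s q powi h i *s x" by simp
      then show "K i x = q powi (h i - m) *s x" by (simp add: powi_mult)
    qed (simp add: powi_mult)
    have "kX p i \<phi> = q powi h i *x \<phi> \<longleftrightarrow> (\<forall>k. Poly_Mapping.lookup (kX p i \<phi>) k = Poly_Mapping.lookup (q powi h i *x \<phi>) k)"
      by (metis poly_mapping_eqI)
    then show ?thesis by (simp add: lookup_k * split_paired_all algebra_simps)
  qed
  then show ?thesis unfolding wtX_def wt_def by blast
qed

lemma wtX_gen: "wtX p h (sg 0 0 0 x) \<longleftrightarrow> wt (\<lambda>i. h i - p i) x"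
proof
  assume "wtX p h (sg 0 0 0 x)"
  from this[unfolded wtX_lookup, rule_format, of 0 0 0] show "wt (\<lambda>i. h i - p i) x" by simp
next
  assume "wt (\<lambda>i. h i - p i) x"
  then show "wtX p h (sg 0 0 0 x)" by (simp add: wtX_def k_single wt_def powi_mult)
qed

lemma linear_casimir: "Vector_Spaces.linear sX sX (casimir p l1 l2 l3)"
  unfolding casimir_def by (rule linear_all linear_ident linear_e3X | rule linear_intros3 linear_comp[OF linear_e3X])+

lemma wtX_casimir:
  assumes "wtX p h \<phi>" shows "wtX p h (casimir p l1 l2 l3 \<phi>)"
proof -
  have "wtX p h (fX i (eX p i \<phi>))" for i using wtX_f[OF wtX_e[OF assms, of i], of i] by simp
  moreover have "wtX p h (f3X (e3X p \<phi>))" using wtX_3(2)[OF wtX_3(1)[OF assms]] by simp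
  ultimately show ?thesis unfolding casimir_def using assms by (intro wtX_add wtX_scale)
qed

text \<open>The list records which scalars \<open>c\<close> occur in a product of factors \<open>C - c\<close>; on the coefficient at 1 the product acts
  by the product of the differences between the Casimir value and these scalars.\<close>

primrec casimir_product :: "(bool \<Rightarrow> int) \<Rightarrow> int \<Rightarrow> int \<Rightarrow> int \<Rightarrow> complex list \<Rightarrow> 'v induced \<Rightarrow> 'v induced" where
  "casimir_product p l1 l2 l3 [] \<phi> = \<phi>"
| "casimir_product p l1 l2 l3 (c # cs) \<phi> = casimir_product p l1 l2 l3 cs (casimir p l1 l2 l3 \<phi> - c *x \<phi>)"

lemma linear_casimir_product: "Vector_Spaces.linear sX sX (casimir_product p l1 l2 l3 cs)"
proof (induction cs)
  case Nil show ?case using linear_ident by simp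
next
  case (Cons c cs)
  then show ?case
    by (intro X.linearI) (simp_all add: X.linear_rules[OF Cons.IH] X.linear_rules[OF linear_casimir] X.scale_right_distrib
      X.scale_right_diff_distrib mult.commute algebra_simps flip: X.linear_add[OF Cons.IH] X.linear_scale[OF Cons.IH])
qed

lemmas linCas = X.linear_rules[OF linear_casimir] X.linear_rules[OF linear_casimir_product]

lemma casimir_product_intertwines:
  assumes "\<And>\<phi>. wtX p h \<phi> \<Longrightarrow> T (casimir p l1 l2 l3 \<phi>) = casimir p m1 m2 m3 (T \<phi>)"
    and "Vector_Spaces.linear sX sX T" and "wtX p h \<phi>"
  shows "T (casimir_product p l1 l2 l3 cs \<phi>) = casimir_product p m1 m2 m3 cs (T \<phi>)"
  using assms(3)
proof (induction cs arbitrary: \<phi>)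
  case (Cons c cs)
  then show ?case
    using Cons.IH[OF wtX_diff[OF wtX_casimir[OF Cons.prems, of l1 l2 l3] wtX_scale[OF Cons.prems, of c]]]
    by (simp add: X.linear_rules[OF assms(2)] assms(1))
qed simp

lemma wtX_casimir_product: "wtX p h \<phi> \<Longrightarrow> wtX p h (casimir_product p l1 l2 l3 cs \<phi>)"
  by (induction cs arbitrary: \<phi>) (simp_all add: wtX_casimir wtX_diff wtX_scale)

lemma casimir_product_append: "casimir_product p l1 l2 l3 (cs @ ds) \<phi> = casimir_product p l1 l2 l3 ds (casimir_product p l1 l2 l3 cs \<phi>)"
  by (induction cs arbitrary: \<phi>) simp_all

lemma casimir_product_casimir: "casimir_product p l1 l2 l3 cs (casimir p l1 l2 l3 \<phi>) = casimir p l1 l2 l3 (casimir_product p l1 l2 l3 cs \<phi>)"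
  by (induction cs arbitrary: \<phi>) (simp_all add: linCas)

lemma casimir_product_commute: "casimir_product p l1 l2 l3 cs (casimir_product p l1 l2 l3 ds \<phi>) = casimir_product p l1 l2 l3 ds (casimir_product p l1 l2 l3 cs \<phi>)"
  by (induction ds arbitrary: \<phi>) (simp_all add: linCas casimir_product_casimir)

lemma casimir_product_zero_mono:
  assumes "casimir_product p l1 l2 l3 cs \<phi> = 0" "\<exists>as bs. ds = as @ cs @ bs"
  shows "casimir_product p l1 l2 l3 ds \<phi> = 0"
proof -
  obtain as bs where "ds = as @ cs @ bs" using assms(2) by blast
  then show ?thesis
    by (simp add: casimir_product_append) (metis casimir_product_commute assms(1) X.linear_zero linear_casimir_product)
qed

lemma e_gen: "eX p i (sg 0 0 0 x) = sg 0 0 0 (E i x)" by (simp add: e_single)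

definition E3 :: "'v \<Rightarrow> 'v" where "E3 x = E True (E False x) - q powi 1 *s E False (E True x)"

lemma e3_gen: "e3X p (sg 0 0 0 x) = sg 0 0 0 (E3 x)"
  by (simp add: e3X_def e_gen E3_def single_diff)

lemma raised_weight: "wt (\<lambda>i. gl3_weight l1 l2 l3 i - p i) x \<Longrightarrow> wt (\<lambda>i. gl3_weight (l1 + 1) (l2 - 1) l3 i - p i) (E False x)"
  "wt (\<lambda>i. gl3_weight l1 l2 l3 i - p i) x \<Longrightarrow> wt (\<lambda>i. gl3_weight l1 (l2 + 1) (l3 - 1) i - p i) (E True x)"
  "wt (\<lambda>i. gl3_weight l1 l2 l3 i - p i) x \<Longrightarrow> wt (\<lambda>i. gl3_weight (l1 + 1) l2 (l3 - 1) i - p i) (E3 x)"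
proof -
  have eq: "wt h x \<Longrightarrow> (\<And>i. h i = h' i) \<Longrightarrow> wt h' x" for h h' x by (simp add: wt_def)
  show 1: "wt (\<lambda>i. gl3_weight (l1 + 1) (l2 - 1) l3 i - p i) (E False x)" if "wt (\<lambda>i. gl3_weight l1 l2 l3 i - p i) x" for l1 l2 l3 x
    by (rule eq[OF wt_E[OF that, of False]]) (simp add: gl3_weight_def cart_def)
  show 2: "wt (\<lambda>i. gl3_weight l1 (l2 + 1) (l3 - 1) i - p i) (E True x)" if "wt (\<lambda>i. gl3_weight l1 l2 l3 i - p i) x" for l1 l2 l3 x
    by (rule eq[OF wt_E[OF that, of True]]) (simp add: gl3_weight_def cart_def)
  show "wt (\<lambda>i. gl3_weight (l1 + 1) l2 (l3 - 1) i - p i) (E3 x)" if w: "wt (\<lambda>i. gl3_weight l1 l2 l3 i - p i) x"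
    using 2[OF 1[OF w]] 1[OF 2[OF w]] by (simp add: E3_def wt_def lin scale_right_diff_distrib mult.commute)
qed

end

text \<open>Boundedness of the weights makes the operators \<open>E\<close> nilpotent, with a bound that is uniform in the vector.\<close>

locale bounded_borel_module = borel_module q s E K Ki
  for q :: complex and s :: "complex \<Rightarrow> 'v::ab_group_add \<Rightarrow> 'v" (infixr \<open>*s\<close> 75) and E K Ki +
  fixes D :: nat
  assumes bounded: "(\<And>i. K i x = q powi h i *s x) \<Longrightarrow> x \<noteq> 0 \<Longrightarrow> \<bar>h i\<bar> \<le> int D"
begin

lemma wt_bounded: "wt h x \<Longrightarrow> \<bar>h i\<bar> > int D \<Longrightarrow> x = 0"
  using bounded[of x h i] by (force simp: wt_def)

text \<open>The Casimir values at the weights obtained from \<open>(l1, l2, l3)\<close> by adding \<open>b\<close> times the first and \<open>c\<close> times the second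
  simple root, at most \<open>B\<close> of them in total.\<close>

definition raised :: "nat \<Rightarrow> int \<Rightarrow> int \<Rightarrow> int \<Rightarrow> complex set" where
  "raised B l1 l2 l3 = {casimir_value (l1 + int b) (l2 - int b + int c) (l3 - int c) | b c. b + c \<le> B}"

lemma raised_mono:
  "raised B (l1 + 1) (l2 - 1) l3 \<subseteq> raised (Suc B) l1 l2 l3"
  "raised B l1 (l2 + 1) (l3 - 1) \<subseteq> raised (Suc B) l1 l2 l3"
  "raised B (l1 + 1) l2 (l3 - 1) \<subseteq> raised (Suc (Suc B)) l1 l2 l3"
  "B \<le> B' \<Longrightarrow> raised B l1 l2 l3 \<subseteq> raised B' l1 l2 l3"
  "casimir_value l1 l2 l3 \<in> raised B l1 l2 l3"
proof -
  show "raised B (l1 + 1) (l2 - 1) l3 \<subseteq> raised (Suc B) l1 l2 l3"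
  proof
    fix z assume "z \<in> raised B (l1 + 1) (l2 - 1) l3"
    then obtain b c where "z = casimir_value (l1 + 1 + int b) (l2 - 1 - int b + int c) (l3 - int c)" "b + c \<le> B" unfolding raised_def by blast
    then have "z = casimir_value (l1 + int (Suc b)) (l2 - int (Suc b) + int c) (l3 - int c)" "Suc b + c \<le> Suc B" by (simp_all add: algebra_simps)
    then show "z \<in> raised (Suc B) l1 l2 l3" unfolding raised_def by blast
  qed
  show "raised B l1 (l2 + 1) (l3 - 1) \<subseteq> raised (Suc B) l1 l2 l3"
  proof
    fix z assume "z \<in> raised B l1 (l2 + 1) (l3 - 1)"
    then obtain b c where "z = casimir_value (l1 + int b) (l2 + 1 - int b + int c) (l3 - 1 - int c)" "b + c \<le> B" unfolding raised_def by blast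
    then have "z = casimir_value (l1 + int b) (l2 - int b + int (Suc c)) (l3 - int (Suc c))" "b + Suc c \<le> Suc B" by (simp_all add: algebra_simps)
    then show "z \<in> raised (Suc B) l1 l2 l3" unfolding raised_def by blast
  qed
  show "raised B (l1 + 1) l2 (l3 - 1) \<subseteq> raised (Suc (Suc B)) l1 l2 l3"
  proof
    fix z assume "z \<in> raised B (l1 + 1) l2 (l3 - 1)"
    then obtain b c where "z = casimir_value (l1 + 1 + int b) (l2 - int b + int c) (l3 - 1 - int c)" "b + c \<le> B" unfolding raised_def by blast
    then have "z = casimir_value (l1 + int (Suc b)) (l2 - int (Suc b) + int (Suc c)) (l3 - int (Suc c))" "Suc b + Suc c \<le> Suc (Suc B)" by (simp_all add: algebra_simps)
    then show "z \<in> raised (Suc (Suc B)) l1 l2 l3" unfolding raised_def by blast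
  qed
  show "B \<le> B' \<Longrightarrow> raised B l1 l2 l3 \<subseteq> raised B' l1 l2 l3"
    unfolding raised_def by (force intro: order_trans)
  show "casimir_value l1 l2 l3 \<in> raised B l1 l2 l3"
    unfolding raised_def by (rule CollectI, rule exI[of _ 0], rule exI[of _ 0]) simp
qed

text \<open>On $1 \otimes x$ the operator \<open>C\<close> minus its expected value produces $f_i (1 \otimes E_i x)$ and the like, which have
  a vector of larger weight inside. As weights are bounded, iterating this ends with 0.\<close>

lemma annihilated:
  assumes "wt (\<lambda>i. gl3_weight l1 l2 l3 i - p i) x" "2 * int D + p False + p True - (l1 - l3) \<le> int B"
  shows "\<exists>cs. casimir_product p l1 l2 l3 cs (sg 0 0 0 x) = 0 \<and> set cs \<subseteq> raised B l1 l2 l3"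
  using assms
proof (induction B arbitrary: l1 l2 l3 x rule: less_induct)
  case (less B)
  note w = less.prems(1)
  show ?case
  proof (cases "x = 0")
    case True then show ?thesis by (intro exI[of _ "[]"]) simp
  next
    case False
    have small: "E False x = 0" "E True x = 0" if "B = 0"
    proof -
      have "\<exists>i. \<bar>gl3_weight (l1 + 1) (l2 - 1) l3 i - p i\<bar> > int D"
      proof (rule ccontr)
        assume "\<not> ?thesis"
        then have "\<bar>gl3_weight (l1 + 1) (l2 - 1) l3 False - p False\<bar> \<le> int D" "\<bar>gl3_weight (l1 + 1) (l2 - 1) l3 True - p True\<bar> \<le> int D"
          by (meson not_le)+
        then show False using less.prems(2) that by (simp add: gl3_weight_def)
      qed
      then show "E False x = 0" using wt_bounded[OF raised_weight(1)[OF w]] by blast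
      have "\<exists>i. \<bar>gl3_weight l1 (l2 + 1) (l3 - 1) i - p i\<bar> > int D"
      proof (rule ccontr)
        assume "\<not> ?thesis"
        then have "\<bar>gl3_weight l1 (l2 + 1) (l3 - 1) False - p False\<bar> \<le> int D" "\<bar>gl3_weight l1 (l2 + 1) (l3 - 1) True - p True\<bar> \<le> int D"
          by (meson not_le)+
        then show False using less.prems(2) that by (simp add: gl3_weight_def)
      qed
      then show "E True x = 0" using wt_bounded[OF raised_weight(2)[OF w]] by blast
    qed
    have small2: "E3 x = 0" if "B \<le> 1"
    proof -
      have "\<exists>i. \<bar>gl3_weight (l1 + 1) l2 (l3 - 1) i - p i\<bar> > int D"
      proof (rule ccontr)
        assume "\<not> ?thesis"
        then have "\<bar>gl3_weight (l1 + 1) l2 (l3 - 1) False - p False\<bar> \<le> int D" "\<bar>gl3_weight (l1 + 1) l2 (l3 - 1) True - p True\<bar> \<le> int D"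
          by (meson not_le)+
        then show False using less.prems(2) that by (simp add: gl3_weight_def)
      qed
      then show ?thesis using wt_bounded[OF raised_weight(3)[OF w]] by blast
    qed
    obtain cs1 where cs1: "casimir_product p (l1 + 1) (l2 - 1) l3 cs1 (sg 0 0 0 (E False x)) = 0" "set cs1 \<subseteq> raised B l1 l2 l3"
    proof (cases B)
      case 0 then show ?thesis using small that[of "[]"] by simp
    next
      case (Suc B')
      then show ?thesis using less.IH[of B', OF _ raised_weight(1)[OF w]] less.prems(2) raised_mono(1)[of B' l1 l2 l3] that
        by (auto simp: algebra_simps)
    qed
    obtain cs2 where cs2: "casimir_product p l1 (l2 + 1) (l3 - 1) cs2 (sg 0 0 0 (E True x)) = 0" "set cs2 \<subseteq> raised B l1 l2 l3"
    proof (cases B)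
      case 0 then show ?thesis using small that[of "[]"] by simp
    next
      case (Suc B')
      then show ?thesis using less.IH[of B', OF _ raised_weight(2)[OF w]] less.prems(2) raised_mono(2)[of B' l1 l2 l3] that
        by (auto simp: algebra_simps)
    qed
    obtain cs3 where cs3: "casimir_product p (l1 + 1) l2 (l3 - 1) cs3 (sg 0 0 0 (E3 x)) = 0" "set cs3 \<subseteq> raised B l1 l2 l3"
    proof (cases "B \<le> 1")
      case True then show ?thesis using small2 that[of "[]"] by simp
    next
      case False
      then obtain B' where "B = Suc (Suc B')" by (metis One_nat_def not_less_eq_eq Suc_le_D le_SucI not_le_imp_less Suc_lessE)
      then show ?thesis using less.IH[of B', OF _ raised_weight(3)[OF w]] less.prems(2) raised_mono(3)[of B' l1 l2 l3] that
        by (auto simp: algebra_simps)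
    qed
    define cs where "cs = cs1 @ cs2 @ cs3"
    have sub: "\<exists>as bs. cs = as @ cs1 @ bs" "\<exists>as bs. cs = as @ cs2 @ bs" "\<exists>as bs. cs = as @ cs3 @ bs"
      unfolding cs_def by (metis append.assoc append_Nil append_Nil2)+
    have w1: "wtX p (gl3_weight (l1 + 1) (l2 - 1) l3) (sg 0 0 0 (E False x))"
      and w2: "wtX p (gl3_weight l1 (l2 + 1) (l3 - 1)) (sg 0 0 0 (E True x))"
      and w3: "wtX p (gl3_weight (l1 + 1) l2 (l3 - 1)) (sg 0 0 0 (E3 x))"
      using raised_weight[OF w] by (simp_all add: wtX_gen)
    have k1: "casimir_product p l1 l2 l3 cs (fX False (sg 0 0 0 (E False x))) = 0"
    proof -
      have "fX False (casimir_product p (l1 + 1) (l2 - 1) l3 cs (sg 0 0 0 (E False x))) = casimir_product p l1 l2 l3 cs (fX False (sg 0 0 0 (E False x)))"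
        by (rule casimir_product_intertwines[OF _ linear_ops(1) w1]) (drule f1_casimir, simp)
      then show ?thesis using casimir_product_zero_mono[OF cs1(1) sub(1)] by (simp add: linX)
    qed
    have k2: "casimir_product p l1 l2 l3 cs (fX True (sg 0 0 0 (E True x))) = 0"
    proof -
      have "fX True (casimir_product p l1 (l2 + 1) (l3 - 1) cs (sg 0 0 0 (E True x))) = casimir_product p l1 l2 l3 cs (fX True (sg 0 0 0 (E True x)))"
        by (rule casimir_product_intertwines[OF _ linear_ops(1) w2]) (drule f2_casimir, simp)
      then show ?thesis using casimir_product_zero_mono[OF cs2(1) sub(2)] by (simp add: linX)
    qed
    have f3_casimir: "f3X (casimir p (l1 + 1) l2 (l3 - 1) \<phi>) = casimir p l1 l2 l3 (f3X \<phi>)" if v: "wtX p (gl3_weight (l1 + 1) l2 (l3 - 1)) \<phi>" for \<phi>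
    proof -
      have g: "wtX p h \<phi> \<Longrightarrow> (\<And>i. h i = h' i) \<Longrightarrow> wtX p h' \<phi>" for h h' \<phi> by (simp add: wtX_def)
      have v1: "wtX p (gl3_weight l1 (l2 + 1) (l3 - 1)) (fX False \<phi>)"
        by (rule g[OF wtX_f[OF v, of False]]) (simp add: gl3_weight_def cart_def)
      have v2: "wtX p (gl3_weight (l1 + 1) (l2 - 1) l3) (fX True \<phi>)"
        by (rule g[OF wtX_f[OF v, of True]]) (simp add: gl3_weight_def cart_def)
      show ?thesis
        using f1_casimir[OF v] f2_casimir[OF v] f1_casimir[OF v2] f2_casimir[OF v1] by (simp add: f3X_eq linCas linX)
    qed
    have k3: "casimir_product p l1 l2 l3 cs (f3X (sg 0 0 0 (E3 x))) = 0"
    proof -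
      have "f3X (casimir_product p (l1 + 1) l2 (l3 - 1) cs (sg 0 0 0 (E3 x))) = casimir_product p l1 l2 l3 cs (f3X (sg 0 0 0 (E3 x)))"
        by (rule casimir_product_intertwines[OF _ linear_3(1) w3]) (drule f3_casimir, simp)
      then show ?thesis using casimir_product_zero_mono[OF cs3(1) sub(3)] by (simp add: lin3)
    qed
    have "casimir_product p l1 l2 l3 (casimir_value l1 l2 l3 # cs) (sg 0 0 0 x) = 0"
      by (simp add: casimir_def e_gen e3_gen linCas k1 k2 k3)
    moreover have "set (casimir_value l1 l2 l3 # cs) \<subseteq> raised B l1 l2 l3"
      using cs1(2) cs2(2) cs3(2) raised_mono(5) by (simp add: cs_def)
    ultimately show ?thesis by blast
  qed
qed

text \<open>The coefficient at 1 ignores everything that a lowering operator has produced.\<close>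

lemma lookup_f_0: "Poly_Mapping.lookup (fX i \<phi>) (0, 0, 0) = 0"
proof (induction \<phi> rule: poly_mapping_additive_induct)
  case (single k x)
  obtain a b c where k: "k = (a, b, c)" by (cases k)
  show ?case unfolding k by (cases i) (simp_all add: f_single lookup_add lookup_single_if)
next
  case (add \<phi> \<psi>) then show ?case by (simp add: linX lookup_add)
qed

lemma lookup_casimir_product_0: "Poly_Mapping.lookup (casimir_product p l1 l2 l3 cs \<phi>) (0, 0, 0) =
    prod_list (map (\<lambda>c. casimir_value l1 l2 l3 - c) cs) *s Poly_Mapping.lookup \<phi> (0, 0, 0)"
  by (induction cs arbitrary: \<phi>)
    (simp_all add: casimir_def f3X_eq lookup_add lookup_minus lookup_f_0 mult.commute flip: scale_left_diff_distrib)

text \<open>Apply to $1 \otimes u$ the factors that annihilate $1 \otimes E_1 u$ and $1 \otimes E_2 u$: the result is singular since \<open>C\<close> commutes with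
  the raising operators. Its coefficient at 1 is a multiple of \<open>u\<close> by a product of differences of Casimir values, nonzero by
  genericity.\<close>

theorem singular_vector_exists:
  assumes u: "wt (\<lambda>i. gl3_weight l1 l2 l3 i - p i) u"
    and generic: "\<And>b c. 0 < b + c \<Longrightarrow> b + c \<le> 4 * D + 2 \<Longrightarrow> casimir_value (l1 + int b) (l2 - int b + int c) (l3 - int c) \<noteq> casimir_value l1 l2 l3"
  shows "\<exists>w. wtX p (gl3_weight l1 l2 l3) w \<and> (\<forall>i. eX p i w = 0) \<and> Poly_Mapping.lookup w (0, 0, 0) = u"
proof (cases "u = 0")
  case True then show ?thesis by (intro exI[of _ 0]) (simp add: wtX_0 linX)
next
  case False
  have "\<bar>gl3_weight l1 l2 l3 i - p i\<bar> \<le> int D" for i using wt_bounded[OF u, of i] False by force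
  from this[of True] this[of False] have B: "2 * int D + p False + p True - (l1 - l3) \<le> int (4 * D)"
    by (simp add: gl3_weight_def)
  obtain cs1 where cs1: "casimir_product p (l1 + 1) (l2 - 1) l3 cs1 (sg 0 0 0 (E False u)) = 0" "set cs1 \<subseteq> raised (4 * D) (l1 + 1) (l2 - 1) l3"
    using annihilated[OF raised_weight(1)[OF u], of "4 * D"] B by auto
  obtain cs2 where cs2: "casimir_product p l1 (l2 + 1) (l3 - 1) cs2 (sg 0 0 0 (E True u)) = 0" "set cs2 \<subseteq> raised (4 * D) l1 (l2 + 1) (l3 - 1)"
    using annihilated[OF raised_weight(2)[OF u], of "4 * D"] B by auto
  define cs where "cs = cs1 @ cs2"
  define w where "w = casimir_product p l1 l2 l3 cs (sg 0 0 0 u)"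
  have wu: "wtX p (gl3_weight l1 l2 l3) (sg 0 0 0 u)" using u by (simp add: wtX_gen)
  have "eX p False w = casimir_product p (l1 + 1) (l2 - 1) l3 cs (sg 0 0 0 (E False u))"
    unfolding w_def e_gen[of p _ u, symmetric] by (rule casimir_product_intertwines[OF _ linear_ops(3) wu]) (rule e1_casimir)
  also have "\<dots> = 0" by (simp add: cs_def casimir_product_append cs1 linCas)
  finally have e1: "eX p False w = 0" .
  have "eX p True w = casimir_product p l1 (l2 + 1) (l3 - 1) cs (sg 0 0 0 (E True u))"
    unfolding w_def e_gen[of p _ u, symmetric] by (rule casimir_product_intertwines[OF _ linear_ops(3) wu]) (rule e2_casimir)
  also have "\<dots> = casimir_product p l1 (l2 + 1) (l3 - 1) cs1 (casimir_product p l1 (l2 + 1) (l3 - 1) cs2 (sg 0 0 0 (E True u)))"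
    by (simp add: cs_def casimir_product_append casimir_product_commute)
  also have "\<dots> = 0" by (simp add: cs2 linCas)
  finally have e2: "eX p True w = 0" .
  define P where "P = prod_list (map (\<lambda>c. casimir_value l1 l2 l3 - c) cs)"
  have "casimir_value l1 l2 l3 \<noteq> z" if z: "z \<in> set cs" for z
  proof -
    have "z \<in> raised (4 * D) (l1 + 1) (l2 - 1) l3 \<or> z \<in> raised (4 * D) l1 (l2 + 1) (l3 - 1)"
      using z cs1(2) cs2(2) by (auto simp: cs_def)
    then obtain b c where "b + c \<le> 4 * D" "z = casimir_value (l1 + 1 + int b) (l2 - 1 - int b + int c) (l3 - int c) \<or> z = casimir_value (l1 + int b) (l2 + 1 - int b + int c) (l3 - 1 - int c)"
      unfolding raised_def by blast
    then show ?thesis using generic[of "Suc b" c] generic[of b "Suc c"] by (auto simp: algebra_simps)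
  qed
  then have "P \<noteq> 0" unfolding P_def by (auto simp: prod_list_zero_iff)
  have w0: "Poly_Mapping.lookup w (0, 0, 0) = P *s u"
    by (simp add: w_def lookup_casimir_product_0 P_def lookup_single_if)
  have ww: "wtX p (gl3_weight l1 l2 l3) w" unfolding w_def by (rule wtX_casimir_product[OF wu])
  show ?thesis
  proof (intro exI[of _ "inverse P *x w"] conjI allI)
    show "wtX p (gl3_weight l1 l2 l3) (inverse P *x w)" by (rule wtX_scale[OF ww])
    show "eX p i (inverse P *x w) = 0" for i using e1 e2 by (cases i) (simp_all add: linX)
    show "Poly_Mapping.lookup (inverse P *x w) (0, 0, 0) = u" using \<open>P \<noteq> 0\<close> by (simp add: w0)
  qed
qed

end

section \<open>The intertwiner of a simple reflection\<close>

lemma funpow_commute_apply: "(\<And>x. A (B x) = B (A x)) \<Longrightarrow> (A ^^ n) (B x) = B ((A ^^ n) x)"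
  by (induction n) simp_all

text \<open>A Borel module on which the lowering operator of the single node \<open>i\<close> acts as well. With only one such node
  the case of rank one is covered too: the other raising operator may then be 0.\<close>

locale step_module = bounded_borel_module q s E K Ki D
  for q :: complex and s :: "complex \<Rightarrow> 'v::ab_group_add \<Rightarrow> 'v" (infixr \<open>*s\<close> 75) and E K Ki D +
  fixes i :: bool and F :: "'v \<Rightarrow> 'v"
  assumes linear_F: "Vector_Spaces.linear s s F"
    and K_F: "K j (F x) = q powi (- cart j i) *s F (K j x)"
    and E_F: "E i (F x) = F (E i x) + Hop i 0 x"
    and E_F_other: "E (\<not> i) (F x) = F (E (\<not> i) x)"
begin

lemmas linF = linear_rules[OF linear_F] linear_rules[OF linear_funpow[OF linear_F]]
lemmas linEpow = linear_rules[OF linear_funpow[OF linear_E]]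

lemma wt_F: "wt h x \<Longrightarrow> wt (\<lambda>j. h j - cart j i) (F x)"
  by (simp add: wt_def K_F linF powi_mult)

lemma wt_eq: "wt h x \<Longrightarrow> (\<And>j. h j = h' j) \<Longrightarrow> wt h' x" by (simp add: wt_def)

lemma wt_Fpow: "wt h x \<Longrightarrow> wt (\<lambda>j. h j - int k * cart j i) ((F ^^ k) x)"
proof (induction k)
  case (Suc k)
  show ?case using wt_F[OF Suc.IH[OF Suc.prems]] by (auto intro: wt_eq simp: algebra_simps)
qed simp

lemma wt_Epow: "wt h x \<Longrightarrow> wt (\<lambda>j. h j + int k * cart j i) ((E i ^^ k) x)"
proof (induction k)
  case (Suc k)
  show ?case using wt_E[OF Suc.IH[OF Suc.prems], of i] by (auto intro: wt_eq simp: algebra_simps)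
qed simp

lemma Fpow_zero:
  assumes "k > D" shows "(F ^^ k) x = 0"
proof (rule weight_generated[of _ x])
  fix h x assume "\<And>i. K i x = q powi h i *s x"
  then have w: "wt h x" by (simp add: wt_def)
  show "(F ^^ k) x = 0"
  proof (cases "x = 0")
    case False
    then have "\<bar>h i\<bar> \<le> int D" using wt_bounded[OF w, of i] by force
    then show ?thesis using wt_bounded[OF wt_Fpow[OF w, of k], of i] assms by simp
  qed (simp add: linF)
qed (simp add: linF)

lemma Epow_zero:
  assumes "k > D" shows "(E i ^^ k) x = 0"
proof (rule weight_generated[of _ x])
  fix h x assume "\<And>i. K i x = q powi h i *s x"
  then have w: "wt h x" by (simp add: wt_def)
  show "(E i ^^ k) x = 0"
  proof (cases "x = 0")
    case False
    then have "\<bar>h i\<bar> \<le> int D" using wt_bounded[OF w, of i] by force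
    then show ?thesis using wt_bounded[OF wt_Epow[OF w, of k], of i] assms by simp
  qed (simp add: linEpow)
qed (simp add: linEpow)

lemma power_commutator_scalar: "qn m * qn (h - m + 1) + qn (h - 2 * m) = qn (m + 1) * qn (h - m)"
proof -
  have "qn m * qn (h - m + 1) + qn 1 * qn (h - 2 * m) = qn (m + 1) * qn (h - m)"
    by (simp add: qsimps del: qnum_simps)
  then show ?thesis by simp
qed

lemma E_Fpow: "wt h x \<Longrightarrow> E i ((F ^^ k) x) = (F ^^ k) (E i x) + (qn (int k) * qn (h i - int k + 1)) *s (F ^^ (k - 1)) x"
proof (induction k)
  case (Suc k)
  have H: "Hop i 0 ((F ^^ k) x) = qn (h i - 2 * int k) *s (F ^^ k) x"
    using Hop_wt[OF wt_Fpow[OF Suc.prems, of k], of i 0] by (simp add: mult.commute)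
  have 1: "(qn (int k) * qn (h i - int k + 1)) *s F ((F ^^ (k - 1)) x) = (qn (int k) * qn (h i - int k + 1)) *s (F ^^ k) x"
    by (cases k) simp_all
  have "E i ((F ^^ Suc k) x) = (F ^^ Suc k) (E i x) + (qn (int k) * qn (h i - int k + 1) + qn (h i - 2 * int k)) *s (F ^^ k) x"
    by (simp add: E_F Suc.IH[OF Suc.prems] linF H 1[simplified] scale_left_distrib)
  then show ?case unfolding power_commutator_scalar by (simp add: algebra_simps)
qed simp

lemma E_other_Fpow: "E (\<not> i) ((F ^^ k) x) = (F ^^ k) (E (\<not> i) x)"
  by (induction k) (simp_all add: E_F_other)

lemma wtX_fpow: "wtX p h \<phi> \<Longrightarrow> wtX p (\<lambda>j. h j - int k * cart j i) ((fX i ^^ k) \<phi>)"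
proof (induction k)
  case (Suc k)
  show ?case using wtX_f[OF Suc.IH[OF Suc.prems], of i] by (auto simp: algebra_simps)
qed simp

lemma e_fpow: "wtX p h \<phi> \<Longrightarrow>
  eX p i ((fX i ^^ k) \<phi>) = (fX i ^^ k) (eX p i \<phi>) + (qn (int k) * qn (h i - int k + 1)) *x (fX i ^^ (k - 1)) \<phi>"
proof (induction k)
  case (Suc k)
  have H: "HX p i ((fX i ^^ k) \<phi>) = qn (h i - 2 * int k) *x (fX i ^^ k) \<phi>"
    using HX_wtX[OF wtX_fpow[OF Suc.prems, of k], of i] by (simp add: mult.commute)
  have 1: "(qn (int k) * qn (h i - int k + 1)) *x fX i ((fX i ^^ (k - 1)) \<phi>) = (qn (int k) * qn (h i - int k + 1)) *x (fX i ^^ k) \<phi>"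
    by (cases k) simp_all
  have "eX p i ((fX i ^^ Suc k) \<phi>) = (fX i ^^ Suc k) (eX p i \<phi>) + (qn (int k) * qn (h i - int k + 1) + qn (h i - 2 * int k)) *x (fX i ^^ k) \<phi>"
    by (simp add: e_f Suc.IH[OF Suc.prems] linX H 1[simplified] X.scale_left_distrib)
  then show ?case unfolding power_commutator_scalar by (simp add: algebra_simps)
qed simp

lemma e_other_fpow: "eX p (\<not> i) ((fX i ^^ k) \<phi>) = (fX i ^^ k) (eX p (\<not> i) \<phi>)"
  by (induction k) (simp_all add: e_f)

definition FX :: "'v induced \<Rightarrow> 'v induced" where
  "FX \<phi> = Poly_Mapping.map F \<phi>"

lemma lookup_FX: "Poly_Mapping.lookup (FX \<phi>) k = F (Poly_Mapping.lookup \<phi> k)"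
  by (simp add: FX_def lookup_map linF)

lemma lookup_FXpow: "Poly_Mapping.lookup ((FX ^^ m) \<phi>) k = (F ^^ m) (Poly_Mapping.lookup \<phi> k)"
  by (induction m) (simp_all add: lookup_FX)

lemma FX_single: "FX (sg a b c x) = sg a b c (F x)"
  by (rule poly_mapping_eqI) (simp add: lookup_FX lookup_single_if linF)

lemma linear_FX: "Vector_Spaces.linear sX sX FX"
  by (rule X.linearI; rule poly_mapping_eqI; simp add: lookup_FX lookup_add linF)

lemmas linFX = X.linear_rules[OF linear_FX] X.linear_rules[OF X.linear_funpow[OF linear_FX]]
lemmas linear_introsF = linear_intros3 linear_comp[OF linear_FX]

lemma FX_f: "FX (fX j \<phi>) = fX j (FX \<phi>)"
  by (rule X_linear_eqI[where A = "\<lambda>\<phi>. FX (fX j \<phi>)"]; ((rule linear_all linear_FX | rule linear_introsF)+)?)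
    (cases j; simp add: f_single FX_single linFX linF)

lemma FX_r: "FX (rX j \<phi>) = rX j (FX \<phi>)"
  by (rule X_linear_eqI[where A = "\<lambda>\<phi>. FX (rX j \<phi>)"]; ((rule linear_all linear_FX | rule linear_introsF)+)?)
    (cases j; simp add: r_single FX_single linFX linF)

lemma k_FX: "kX p j (FX \<phi>) = q powi (- cart j i) *x FX (kX p j \<phi>)"
  by (rule X_linear_eqI[where A = "\<lambda>\<phi>. kX p j (FX \<phi>)"]; ((rule linear_all linear_FX | rule linear_introsF)+)?)
    (simp add: k_single FX_single linFX linF K_F lin mult_ac)

lemma k_FXpow: "kX p j ((FX ^^ m) \<phi>) = q powi (- int m * cart j i) *x (FX ^^ m) (kX p j \<phi>)"
  by (induction m) (simp_all add: k_FX linFX linX powi_mult algebra_simps)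

lemma k_rpow: "kX p j ((rX i ^^ m) \<phi>) = q powi (- int m * cart j i) *x (rX i ^^ m) (kX p j \<phi>)"
  by (induction m) (simp_all add: k_r linX powi_mult algebra_simps)

lemmas linrpow = X.linear_rules[OF X.linear_funpow[OF linear_ops(2)]]
lemmas linfpow = X.linear_rules[OF X.linear_funpow[OF linear_ops(1)]]

definition J_coeff :: "nat \<Rightarrow> nat \<Rightarrow> complex" where
  "J_coeff N k = (- 1) ^ k * ifac (int N - int k) * ifac (int k)"

text \<open>The embedding of Verma modules sends the generator to $f_i^N / [N]!$ times the generator. In the realisation of
  the tensor product by PBW monomials with coefficients in the module it becomes this alternating sum, in which \<open>N - k\<close> of the lowering operators
  act on the monomial from the right and \<open>k\<close> on the coefficient.\<close>

definition J :: "nat \<Rightarrow> 'v induced \<Rightarrow> 'v induced" where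
  "J N \<phi> = (\<Sum>k\<le>N. J_coeff N k *x (rX i ^^ (N - k)) ((FX ^^ k) \<phi>))"

lemma linear_J: "Vector_Spaces.linear sX sX (J N)"
  by (rule X.linearI) (simp_all add: J_def linFX linrpow X.scale_right_distrib sum.distrib X.scale_sum_right mult.commute)

lemmas linJ = X.linear_rules[OF linear_J]

lemma f_rpow: "fX j ((rX i ^^ m) \<phi>) = (rX i ^^ m) (fX j \<phi>)"
  by (induction m) (simp_all add: f_r)

lemma f_FXpow: "fX j ((FX ^^ m) \<phi>) = (FX ^^ m) (fX j \<phi>)"
  by (induction m) (simp_all flip: FX_f)

lemma J_f: "fX j (J N \<phi>) = J N (fX j \<phi>)"
  by (simp add: J_def linX f_rpow f_FXpow)

lemma J_fpow: "(fX j ^^ m) (J N \<phi>) = J N ((fX j ^^ m) \<phi>)"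
  by (rule funpow_commute_apply) (rule J_f)

text \<open>The dot action of $s_i$ on \<open>p\<close>, if \<open>N = p i + 1\<close>.\<close>

definition shifted :: "nat \<Rightarrow> (bool \<Rightarrow> int) \<Rightarrow> bool \<Rightarrow> int" where
  "shifted N p j = p j - int N * cart j i"

lemma k_shift: "kX p' j \<phi> = q powi (p' j - p j) *x kX p j \<phi>"
  by (rule X_linear_eqI[where A = "\<lambda>\<phi>. kX p' j \<phi>"]; ((rule linear_all linear_FX | rule linear_introsF)+)?)
    (simp add: k_single powi_mult algebra_simps)

lemma J_k: "kX p j (J N \<phi>) = J N (kX (shifted N p) j \<phi>)"
proof -
  have "kX p j (J_coeff N k *x (rX i ^^ (N - k)) ((FX ^^ k) \<phi>)) =
    q powi (- int N * cart j i) *x J_coeff N k *x (rX i ^^ (N - k)) ((FX ^^ k) (kX p j \<phi>))" if "k \<le> N" for k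
    using that by (simp add: linX k_rpow k_FXpow linrpow powi_mult of_nat_diff algebra_simps)
  then have "kX p j (J N \<phi>) = q powi (- int N * cart j i) *x J N (kX p j \<phi>)"
    by (simp add: J_def linX X.scale_sum_right)
  then show ?thesis unfolding k_shift[of "shifted N p" j \<phi> p] by (simp add: linJ shifted_def)
qed

lemma k_ki: "kX p j (kiX p j \<phi>) = \<phi>"
proof (rule X_linear_eqI[where A = "\<lambda>\<phi>. kX p j (kiX p j \<phi>)"])
  fix a b c h x assume w: "wt h x"
  show "kX p j (kiX p j (sg a b c x)) = sg a b c x"
    by (simp add: k_single K_wt[OF w] Ki_wt[OF w] lin powi_mult)
qed (rule linear_all linear_ident | rule linear_intros3)+

lemma J_ki: "kiX p j (J N \<phi>) = J N (kiX (shifted N p) j \<phi>)"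
proof -
  have "kiX p j (J N \<phi>) = kiX p j (J N (kX (shifted N p) j (kiX (shifted N p) j \<phi>)))" by (simp add: k_ki)
  also have "\<dots> = kiX p j (kX p j (J N (kiX (shifted N p) j \<phi>)))" by (simp only: J_k)
  finally show ?thesis by (simp add: ki_k)
qed

lemma J_HX: "HX p j (J N \<phi>) = J N (HX (shifted N p) j \<phi>)"
  by (simp add: HX_def J_k J_ki linJ)

lemma rpow_gen: "(rX i ^^ m) (sg 0 0 0 x) = (fX i ^^ m) (sg 0 0 0 x)"
proof -
  have "(rX False ^^ m) (sg 0 0 0 x) = sg 0 0 m x" "(fX False ^^ m) (sg 0 0 0 x) = sg 0 0 m x"
    "(rX True ^^ m) (sg 0 0 0 x) = sg m 0 0 x" "(fX True ^^ m) (sg 0 0 0 x) = sg m 0 0 x"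
    by (induction m) (simp_all add: r_single f_single)
  then show ?thesis by (cases i) simp_all
qed

lemma FXpow_gen: "(FX ^^ m) (sg 0 0 0 x) = sg 0 0 0 ((F ^^ m) x)"
  by (induction m) (simp_all add: FX_single)

lemma J_gen: "J N (sg 0 0 0 x) = (\<Sum>k\<le>N. J_coeff N k *x (fX i ^^ (N - k)) (sg 0 0 0 ((F ^^ k) x)))"
  by (simp add: J_def FXpow_gen rpow_gen)

lemma J_coeff_rec: "J_coeff N (Suc k) * qn (int (Suc k)) = - (J_coeff N k * qn (int N - int k))"
proof -
  have "ifac (int k) = qn (int (Suc k)) * ifac (int (Suc k))" using ifac_rec[of "int (Suc k)"] by simp
  moreover have "ifac (int N - int (Suc k)) = qn (int N - int k) * ifac (int N - int k)"
    using ifac_rec[of "int N - int k"] by (simp add: algebra_simps)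
  ultimately show ?thesis by (simp add: J_coeff_def)
qed

text \<open>The two neighbouring summands contribute multiples of the same vector, whose coefficients cancel precisely when
  \<open>N = p i + 1\<close>.\<close>

lemma J_e_gen:
  assumes w: "wt h x" and N: "int N = p i + 1"
  shows "eX p i (J N (sg 0 0 0 x)) = J N (sg 0 0 0 (E i x))"
proof -
  define G where "G k = (fX i ^^ (N - Suc k)) (sg 0 0 0 ((F ^^ k) x))" for k
  have t: "eX p i (J_coeff N k *x (fX i ^^ (N - k)) (sg 0 0 0 ((F ^^ k) x))) =
     J_coeff N k *x (fX i ^^ (N - k)) (sg 0 0 0 ((F ^^ k) (E i x))) +
     ((J_coeff N k * qn (int k) * qn (h i - int k + 1)) *x (fX i ^^ (N - k)) (sg 0 0 0 ((F ^^ (k - 1)) x)) +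
      (J_coeff N k * qn (int N - int k) * qn (h i - int k)) *x G k)" if "k \<le> N" for k
  proof -
    have w1: "wtX p (\<lambda>j. h j - int k * cart j i + p j) (sg 0 0 0 ((F ^^ k) x))"
      using wt_Fpow[OF w, of k] by (simp add: wtX_gen)
    have a: "h i - int k * cart i i + p i - (int N - int k) + 1 = h i - int k"
      using N by simp
    have b: "int (N - k) = int N - int k" using that by simp
    have c: "(fX i ^^ (N - k - 1)) (sg 0 0 0 ((F ^^ k) x)) = G k" by (simp add: G_def)
    have "eX p i ((fX i ^^ (N - k)) (sg 0 0 0 ((F ^^ k) x))) =
      (fX i ^^ (N - k)) (sg 0 0 0 (E i ((F ^^ k) x))) + (qn (int N - int k) * qn (h i - int k)) *x G k"
      by (simp only: e_fpow[OF w1] e_gen a b c)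
    then show ?thesis
      by (simp add: linX E_Fpow[OF w] single_add linfpow X.scale_right_distrib mult.assoc flip: sX_single)
  qed
  have "(\<Sum>k\<le>N. (J_coeff N k * qn (int k) * qn (h i - int k + 1)) *x (fX i ^^ (N - k)) (sg 0 0 0 ((F ^^ (k - 1)) x))) +
      (\<Sum>k\<le>N. (J_coeff N k * qn (int N - int k) * qn (h i - int k)) *x G k) = 0"
  proof (cases N)
    case (Suc M)
    have "(\<Sum>k\<le>N. (J_coeff N k * qn (int k) * qn (h i - int k + 1)) *x (fX i ^^ (N - k)) (sg 0 0 0 ((F ^^ (k - 1)) x))) =
      (\<Sum>k\<le>M. (J_coeff N (Suc k) * qn (int (Suc k)) * qn (h i - int k)) *x G k)"
      unfolding Suc by (subst sum.atMost_Suc_shift) (simp add: G_def Suc)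
    also have "\<dots> = - (\<Sum>k\<le>M. (J_coeff N k * qn (int N - int k) * qn (h i - int k)) *x G k)"
      unfolding J_coeff_rec by (simp add: sum_negf)
    also have "(\<Sum>k\<le>M. (J_coeff N k * qn (int N - int k) * qn (h i - int k)) *x G k) =
      (\<Sum>k\<le>N. (J_coeff N k * qn (int N - int k) * qn (h i - int k)) *x G k)"
      by (simp add: Suc)
    finally show ?thesis by simp
  qed (simp add: J_coeff_def)
  then show ?thesis
    unfolding J_gen X.linear_sum[OF linear_ops(3)]
    by (subst sum.cong[OF refl t]) (simp_all add: sum.distrib)
qed

lemma J_e:
  assumes N: "int N = p i + 1"
  shows "eX p j (J N \<phi>) = J N (eX (shifted N p) j \<phi>)"
proof (rule X_linear_f_eqI[where A = "\<lambda>\<phi>. eX p j (J N \<phi>)"])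
  fix h x assume w: "wt h x"
  show "eX p j (J N (sg 0 0 0 x)) = J N (eX (shifted N p) j (sg 0 0 0 x))"
  proof (cases "j = i")
    case True then show ?thesis using J_e_gen[of h x N p] w N by (simp add: e_gen)
  next
    case False
    then have j: "j = (\<not> i)" by auto
    show ?thesis unfolding j by (simp add: J_gen linX e_other_fpow e_gen E_other_Fpow)
  qed
next
  fix l \<phi> assume IH: "eX p j (J N \<phi>) = J N (eX (shifted N p) j \<phi>)"
  show "eX p j (J N (fX l \<phi>)) = J N (eX (shifted N p) j (fX l \<phi>))"
  proof -
    have "eX p j (J N (fX l \<phi>)) = eX p j (fX l (J N \<phi>))" by (simp only: J_f)
    also have "\<dots> = fX l (J N (eX (shifted N p) j \<phi>)) + (if j = l then J N (HX (shifted N p) j \<phi>) else 0)"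
      by (simp only: e_f IH J_HX)
    also have "\<dots> = J N (fX l (eX (shifted N p) j \<phi>) + (if j = l then HX (shifted N p) j \<phi> else 0))"
      by (simp only: J_f linJ(1)) (simp add: linJ(3))
    finally show ?thesis by (simp only: e_f)
  qed
qed (rule linear_all linear_J | rule linear_intros3 linear_comp[OF linear_J])+

subsection \<open>Injectivity of the intertwiner\<close>

definition idx :: "nat \<times> nat \<times> nat \<Rightarrow> nat" where "idx k = (case k of (a, b, c) \<Rightarrow> if i then a else c)"
definition up :: "nat \<times> nat \<times> nat \<Rightarrow> nat \<times> nat \<times> nat" where "up k = (case k of (a, b, c) \<Rightarrow> if i then (Suc a, b, c) else (a, b, Suc c))"

lemma idx_up [simp]: "idx (up k) = Suc (idx k)"
  by (cases k) (simp add: idx_def up_def)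

lemma idx_uppow: "idx ((up ^^ m) k) = idx k + m" by (induction m) simp_all

lemma lookup_r_True: "Poly_Mapping.lookup (rX True \<phi>) (a, b, c) =
   (if a = 0 then 0 else q powi (int c - int b) *s Poly_Mapping.lookup \<phi> (a - 1, b, c)) +
   (if b = 0 then 0 else qn (int c + 1) *s Poly_Mapping.lookup \<phi> (a, b - 1, Suc c))"
proof (induction \<phi> rule: poly_mapping_additive_induct)
  case (single k x)
  obtain a' b' c' where k: "k = (a', b', c')" by (cases k)
  show ?case unfolding k
    by (cases a; cases b; cases c') (auto simp add: r_single lookup_add lookup_single_if add.commute)
next
  case (add \<phi> \<psi>) then show ?case by (auto simp add: linX lookup_add scale_right_distrib)
qed

lemma lookup_r_False: "Poly_Mapping.lookup (rX False \<phi>) (a, b, c) = (if c = 0 then 0 else Poly_Mapping.lookup \<phi> (a, b, c - 1))"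
proof (induction \<phi> rule: poly_mapping_additive_induct)
  case (single k x)
  obtain a' b' c' where k: "k = (a', b', c')" by (cases k)
  show ?case unfolding k by (cases c) (auto simp: r_single lookup_single_if)
next
  case (add \<phi> \<psi>) then show ?case by (auto simp: linX lookup_add)
qed

text \<open>The exponent of $f_i$ in the monomials is bounded by \<open>A\<close>. Right multiplication by $f_i$ raises this exponent by one and
  acts on the leading entries by nonzero scalars, whereas \<open>F\<close> on the coefficients does not change it.\<close>

definition below :: "nat \<Rightarrow> 'v induced \<Rightarrow> bool" where
  "below A \<phi> \<longleftrightarrow> (\<forall>k. idx k > A \<longrightarrow> Poly_Mapping.lookup \<phi> k = 0)"

lemma below_r:
  assumes "below A \<phi>"
  shows "below (Suc A) (rX i \<phi>)" "idx k = A \<Longrightarrow> \<exists>z. z \<noteq> 0 \<and> Poly_Mapping.lookup (rX i \<phi>) (up k) = z *s Poly_Mapping.lookup \<phi> k"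
proof -
  show "below (Suc A) (rX i \<phi>)" unfolding below_def
  proof (intro allI impI)
    fix k assume k: "Suc A < idx k"
    obtain a b c where abc: "k = (a, b, c)" by (cases k)
    show "Poly_Mapping.lookup (rX i \<phi>) k = 0"
      using assms k unfolding below_def abc idx_def
      by (cases i) (auto simp: lookup_r_True lookup_r_False)
  qed
  assume k: "idx k = A"
  obtain a b c where abc: "k = (a, b, c)" by (cases k)
  show "\<exists>z. z \<noteq> 0 \<and> Poly_Mapping.lookup (rX i \<phi>) (up k) = z *s Poly_Mapping.lookup \<phi> k"
  proof (cases i)
    case True
    then show ?thesis using assms k unfolding below_def abc idx_def up_def
      by (intro exI[of _ "q powi (int c - int b)"]) (auto simp: lookup_r_True)
  next
    case False
    then show ?thesis unfolding abc up_def by (intro exI[of _ 1]) (simp add: lookup_r_False)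
  qed
qed

lemma below_rpow:
  assumes "below A \<phi>"
  shows "below (A + m) ((rX i ^^ m) \<phi>)" "idx k = A \<Longrightarrow> \<exists>z. z \<noteq> 0 \<and> Poly_Mapping.lookup ((rX i ^^ m) \<phi>) ((up ^^ m) k) = z *s Poly_Mapping.lookup \<phi> k"
proof -
  show 1: "below (A + m) ((rX i ^^ m) \<phi>)" for m
    by (induction m) (simp_all add: assms below_r)
  assume k: "idx k = A"
  show "\<exists>z. z \<noteq> 0 \<and> Poly_Mapping.lookup ((rX i ^^ m) \<phi>) ((up ^^ m) k) = z *s Poly_Mapping.lookup \<phi> k"
  proof (induction m)
    case 0 show ?case by (intro exI[of _ 1]) simp
  next
    case (Suc m)
    then obtain z where z: "z \<noteq> 0" "Poly_Mapping.lookup ((rX i ^^ m) \<phi>) ((up ^^ m) k) = z *s Poly_Mapping.lookup \<phi> k" by blast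
    obtain z' where "z' \<noteq> 0" "Poly_Mapping.lookup (rX i ((rX i ^^ m) \<phi>)) (up ((up ^^ m) k)) = z' *s Poly_Mapping.lookup ((rX i ^^ m) \<phi>) ((up ^^ m) k)"
      using below_r(2)[OF 1, of "(up ^^ m) k" m] k by (auto simp: idx_uppow)
    then show ?case using z by (intro exI[of _ "z' * z"]) simp
  qed
qed

text \<open>The summand \<open>k = 0\<close> of \<open>J\<close> alone determines the entries of the largest exponent of $f_i$.\<close>

lemma J_eq_0:
  assumes "J N \<phi> = 0" shows "\<phi> = 0"
proof (rule ccontr)
  assume "\<phi> \<noteq> 0"
  then have ne: "Poly_Mapping.keys \<phi> \<noteq> {}" by (metis keys_eq_empty)
  define A where "A = Max (idx ` Poly_Mapping.keys \<phi>)"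
  have "A \<in> idx ` Poly_Mapping.keys \<phi>" unfolding A_def using ne by (intro Max_in) auto
  then obtain k where k: "k \<in> Poly_Mapping.keys \<phi>" "idx k = A" by blast
  have b: "below A \<phi>" unfolding below_def
  proof (intro allI impI)
    fix l assume l: "A < idx l"
    show "Poly_Mapping.lookup \<phi> l = 0"
    proof (rule ccontr)
      assume "Poly_Mapping.lookup \<phi> l \<noteq> 0"
      then have "idx l \<le> A" unfolding A_def by (intro Max_ge) (auto simp: in_keys_iff)
      then show False using l by simp
    qed
  qed
  have bF: "below A ((FX ^^ m) \<phi>)" for m using b unfolding below_def by (simp add: lookup_FXpow linF)
  have z0: "Poly_Mapping.lookup ((rX i ^^ (N - m)) ((FX ^^ m) \<phi>)) ((up ^^ N) k) = 0" if "0 < m" "m \<le> N" for m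
  proof -
    have "A + (N - m) < idx ((up ^^ N) k)" using k that by (simp add: idx_uppow)
    then show ?thesis using below_rpow(1)[OF bF, of "N - m" m] unfolding below_def by blast
  qed
  obtain z where z: "z \<noteq> 0" "Poly_Mapping.lookup ((rX i ^^ N) \<phi>) ((up ^^ N) k) = z *s Poly_Mapping.lookup \<phi> k"
    using below_rpow(2)[OF b k(2)] by blast
  have "Poly_Mapping.lookup (J N \<phi>) ((up ^^ N) k) =
     (\<Sum>m\<le>N. J_coeff N m *s Poly_Mapping.lookup ((rX i ^^ (N - m)) ((FX ^^ m) \<phi>)) ((up ^^ N) k))"
    by (simp add: J_def lookup_sum)
  also have "\<dots> = (\<Sum>m\<le>N. if m = 0 then (J_coeff N 0 * z) *s Poly_Mapping.lookup \<phi> k else 0)"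
    by (intro sum.cong refl) (auto simp: z0 z)
  also have "\<dots> = (J_coeff N 0 * z) *s Poly_Mapping.lookup \<phi> k" by simp
  finally have "(J_coeff N 0 * z) *s Poly_Mapping.lookup \<phi> k = 0" using assms by simp
  then show False using z k by (simp add: J_coeff_def in_keys_iff)
qed

lemma J_inj: "J N \<phi> = J N \<psi> \<Longrightarrow> \<phi> = \<psi>"
  using J_eq_0[of N "\<phi> - \<psi>"] by (simp add: linJ)

subsection \<open>Coefficients along the powers of one lowering operator\<close>

text \<open>The coefficient at $f_i^t$, for an integer \<open>t\<close> so that shifts need no side condition.\<close>

definition string_coeff :: "int \<Rightarrow> 'v induced \<Rightarrow> 'v" where
  "string_coeff t \<phi> = (if t < 0 then 0 else Poly_Mapping.lookup \<phi> (if i then (nat t, 0, 0) else (0, 0, nat t)))"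

lemma string_coeff_add: "string_coeff t (\<phi> + \<psi>) = string_coeff t \<phi> + string_coeff t \<psi>" and string_coeff_scale: "string_coeff t (c *x \<phi>) = c *s string_coeff t \<phi>"
  and string_coeff_0: "string_coeff t 0 = 0" and string_coeff_diff: "string_coeff t (\<phi> - \<psi>) = string_coeff t \<phi> - string_coeff t \<psi>"
  by (simp_all add: string_coeff_def lookup_add lookup_minus)

lemma string_coeff_sum: "string_coeff t (sum g A) = (\<Sum>a\<in>A. string_coeff t (g a))"
  by (induction A rule: infinite_finite_induct) (simp_all add: string_coeff_0 string_coeff_add)

lemma string_coeff_FXpow: "string_coeff t ((FX ^^ m) \<phi>) = (F ^^ m) (string_coeff t \<phi>)"
  by (simp add: string_coeff_def lookup_FXpow linF)

lemma string_coeff_r: "string_coeff t (rX i \<phi>) = string_coeff (t - 1) \<phi>"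
  unfolding string_coeff_def by (cases i) (auto simp: lookup_r_True lookup_r_False nat_diff_distrib)

lemma string_coeff_f: "string_coeff t (fX i \<phi>) = string_coeff (t - 1) \<phi>" "string_coeff t (fX (\<not> i) \<phi>) = 0"
proof -
  show "string_coeff t (fX i \<phi>) = string_coeff (t - 1) \<phi>"
  proof (induction \<phi> rule: poly_mapping_additive_induct)
    case (single k x)
    obtain a b c where k: "k = (a, b, c)" by (cases k)
    show ?case unfolding k string_coeff_def by (cases i) (auto simp: f_single lookup_add lookup_single_if nat_diff_distrib)
  next
    case (add \<phi> \<psi>) then show ?case by (simp add: linX string_coeff_add)
  qed
  show "string_coeff t (fX (\<not> i) \<phi>) = 0"
  proof (induction \<phi> rule: poly_mapping_additive_induct)
    case (single k x)
    obtain a b c where k: "k = (a, b, c)" by (cases k)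
    show ?case unfolding k string_coeff_def by (cases i) (auto simp: f_single lookup_add lookup_single_if)
  next
    case (add \<phi> \<psi>) then show ?case by (simp add: linX string_coeff_add)
  qed
qed

lemma string_coeff_rpow: "string_coeff t ((rX i ^^ m) \<phi>) = string_coeff (t - int m) \<phi>"
  by (induction m arbitrary: t) (simp_all add: string_coeff_r algebra_simps)

lemma string_coeff_fpow: "string_coeff t ((fX i ^^ m) \<phi>) = string_coeff (t - int m) \<phi>"
  by (induction m arbitrary: t) (simp_all add: string_coeff_f algebra_simps)

lemma lookup_e_False: "Poly_Mapping.lookup (eX p False \<phi>) (0, 0, t) =
    E False (Poly_Mapping.lookup \<phi> (0, 0, t)) + qn (int t + 1) *s Hop False (p False - int t) (Poly_Mapping.lookup \<phi> (0, 0, Suc t))"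
proof (induction \<phi> rule: poly_mapping_additive_induct)
  case (single k x)
  obtain a b c where k: "k = (a, b, c)" by (cases k)
  show ?case unfolding k
  proof (cases "a = 0 \<and> b = 0")
    case True
    then show "Poly_Mapping.lookup (eX p False (sg a b c x)) (0, 0, t) = E False (Poly_Mapping.lookup (sg a b c x) (0, 0, t))
      + qn (int t + 1) *s Hop False (p False - int t) (Poly_Mapping.lookup (sg a b c x) (0, 0, Suc t))"
      by (cases c) (auto simp: e_single lookup_add lookup_single_if lin Hop_lin add.commute)
  next
    case False
    then show "Poly_Mapping.lookup (eX p False (sg a b c x)) (0, 0, t) = E False (Poly_Mapping.lookup (sg a b c x) (0, 0, t))
      + qn (int t + 1) *s Hop False (p False - int t) (Poly_Mapping.lookup (sg a b c x) (0, 0, Suc t))"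
      by (auto simp: e_single lookup_add lookup_single_if lin Hop_lin)
  qed
next
  case (add \<phi> \<psi>) then show ?case by (simp add: linX lookup_add lin Hop_lin scale_right_distrib)
qed

lemma lookup_e_True: "Poly_Mapping.lookup (eX p True \<phi>) (t, 0, 0) =
    E True (Poly_Mapping.lookup \<phi> (t, 0, 0)) + qn (int t + 1) *s Hop True (p True - int t) (Poly_Mapping.lookup \<phi> (Suc t, 0, 0))"
proof (induction \<phi> rule: poly_mapping_additive_induct)
  case (single k x)
  obtain a b c where k: "k = (a, b, c)" by (cases k)
  show ?case unfolding k
  proof (cases "b = 0 \<and> c = 0")
    case True
    then show "Poly_Mapping.lookup (eX p True (sg a b c x)) (t, 0, 0) = E True (Poly_Mapping.lookup (sg a b c x) (t, 0, 0))
      + qn (int t + 1) *s Hop True (p True - int t) (Poly_Mapping.lookup (sg a b c x) (Suc t, 0, 0))"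
      by (cases a) (auto simp: e_single lookup_add lookup_minus lookup_single_if lin Hop_lin add.commute)
  next
    case False
    then show "Poly_Mapping.lookup (eX p True (sg a b c x)) (t, 0, 0) = E True (Poly_Mapping.lookup (sg a b c x) (t, 0, 0))
      + qn (int t + 1) *s Hop True (p True - int t) (Poly_Mapping.lookup (sg a b c x) (Suc t, 0, 0))"
      by (auto simp: e_single lookup_add lookup_minus lookup_single_if lin Hop_lin)
  qed
next
  case (add \<phi> \<psi>) then show ?case by (simp add: linX lookup_add lin Hop_lin scale_right_distrib)
qed

lemma string_coeff_e:
  assumes "t \<ge> 0"
  shows "string_coeff t (eX p i \<phi>) = E i (string_coeff t \<phi>) + qn (t + 1) *s Hop i (p i - t) (string_coeff (t + 1) \<phi>)"
proof -
  obtain m where t: "t = int m" using assms zero_le_imp_eq_int by blast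
  have "nat (int m + 1) = Suc m" by simp
  then show ?thesis unfolding t string_coeff_def using lookup_e_True[of p \<phi> m] lookup_e_False[of p \<phi> m]
    by (cases i) auto
qed

lemma string_coeff_J: "string_coeff (int N + t) (J N \<phi>) = (\<Sum>k\<le>N. J_coeff N k *s (F ^^ k) (string_coeff (t + int k) \<phi>))"
  unfolding J_def string_coeff_sum by (intro sum.cong refl) (simp add: string_coeff_scale string_coeff_rpow string_coeff_FXpow of_nat_diff algebra_simps)

lemma wt_string_coeff:
  assumes "wtX p h \<phi>"
  shows "wt (\<lambda>j. h j - p j + t * cart j i) (string_coeff t \<phi>)"
proof (cases "t < 0")
  case True then show ?thesis by (simp add: string_coeff_def wt_def lin)
next
  case False
  then show ?thesis using assms[unfolded wtX_lookup, rule_format, of "nat t" 0 0] assms[unfolded wtX_lookup, rule_format, of 0 0 "nat t"]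
    unfolding string_coeff_def by (cases i) (auto simp: mult.commute)
qed

end

context quantum_parameter
begin

definition extraction_coeff :: "nat \<Rightarrow> nat \<Rightarrow> complex" where
  "extraction_coeff N a = qn (int N) * qf (N + a - 1) * ifac (int a)"

text \<open>Up to a common factor the sum in \<open>extraction_scalar\<close> below has this form, with both boundary terms 0.\<close>

lemma telescope: "(\<Sum>a\<le>j. (- 1) ^ a * (X (Suc a) + X a)) = X 0 + (- 1) ^ j * (X (Suc j) :: complex)"
  by (induction j) (simp_all add: algebra_simps)

end

context step_module
begin

lemma extraction_scalar:
  assumes "N \<ge> 1"
  shows "(\<Sum>a\<le>j. extraction_coeff N a * J_coeff N (j - a)) = (if j = 0 then 1 else 0)"
proof (cases "j = 0")
  case True
  obtain M where "N = Suc M" using assms by (cases N) auto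
  then show ?thesis using True ifac_rec'[of "int M"] by (simp add: extraction_coeff_def J_coeff_def field_simps)
next
  case False
  define X where "X a = qf (N + a - 1) * ifac (int a - 1) * ifac (int j - int a) * ifac (int N - int j + int a - 1)" for a
  define Y where "Y a = qf (N + a - 1) * ifac (int a) * ifac (int j - int a) * ifac (int N - int j + int a)" for a
  have XY: "X (Suc a) + X a = qn (int N) * qn (int j) * Y a" for a
  proof -
    have "qf (N + a) = qn (int N + int a) * qf (N + a - 1)"
      using assms qfact_Suc[of "N + a - 1"] by simp
    moreover have "ifac (int j - int (Suc a)) = qn (int j - int a) * ifac (int j - int a)"
      using ifac_rec[of "int j - int a"] by (simp add: algebra_simps)
    ultimately have 1: "X (Suc a) = qn (int N + int a) * qn (int j - int a) * Y a"
      by (simp add: X_def Y_def algebra_simps)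
    have 2: "X a = qn (int a) * qn (int N - int j + int a) * Y a"
      using ifac_rec[of "int a"] ifac_rec[of "int N - int j + int a"] by (simp add: X_def Y_def algebra_simps)
    have "qn (int N + int a) * qn (int j - int a) + qn (int a) * qn (int N - int j + int a) = qn (int N) * qn (int j)"
      by (simp add: qsimps)
    then show ?thesis unfolding 1 2 by (simp flip: distrib_right)
  qed
  have "X 0 = 0" "X (Suc j) = 0" by (simp_all add: X_def)
  then have "(\<Sum>a\<le>j. (- 1) ^ a * (qn (int N) * qn (int j) * Y a)) = 0"
    using telescope[of X j] unfolding XY by simp
  then have "qn (int N) * qn (int j) * (\<Sum>a\<le>j. (- 1) ^ a * Y a) = 0"
    by (simp add: sum_distrib_left mult_ac)
  then have s: "(\<Sum>a\<le>j. (- 1) ^ a * Y a) = 0" using False assms by simp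
  have "extraction_coeff N a * J_coeff N (j - a) = qn (int N) * (- 1) ^ j * ((- 1) ^ a * Y a)" if "a \<le> j" for a
  proof -
    have "(- 1) ^ (j - a) = (- 1) ^ j * ((- 1) ^ a :: complex)"
      using that by (metis (no_types, lifting) le_add_diff_inverse2 minus_one_power_iff mult.commute mult.right_neutral power_add mult_minus1 mult_minus_right minus_minus even_add)
    then show ?thesis using that by (simp add: extraction_coeff_def J_coeff_def Y_def of_nat_diff algebra_simps)
  qed
  then have "(\<Sum>a\<le>j. extraction_coeff N a * J_coeff N (j - a)) = (\<Sum>a\<le>j. qn (int N) * (- 1) ^ j * ((- 1) ^ a * Y a))"
    by (intro sum.cong) auto
  also have "\<dots> = 0" using s by (simp flip: sum_distrib_left)
  finally show ?thesis using False by simp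
qed

text \<open>The coefficient at 1 of a preimage under \<open>J\<close> is a combination of coefficients of the image: the
  coefficients of the preimage at the other powers of $f_i$ cancel by \<open>extraction_scalar\<close>.\<close>

lemma extraction:
  assumes "N \<ge> 1" "L \<ge> D"
  shows "string_coeff 0 \<xi> = (\<Sum>a\<le>L. extraction_coeff N a *s (F ^^ a) (string_coeff (int N + int a) (J N \<xi>)))"
proof -
  define G where "G j = (F ^^ j) (string_coeff (int j) \<xi>)" for j
  have G0: "G j = 0" if "j > L" for j using Fpow_zero that assms(2) by (simp add: G_def)
  have inner: "(\<Sum>k\<le>N. J_coeff N k *s G (a + k)) = (\<Sum>k\<le>L - a. J_coeff N k *s G (a + k))" if "a \<le> L" for a
  proof -
    have "(\<Sum>k\<le>N. J_coeff N k *s G (a + k)) = (\<Sum>k\<le>N + L. J_coeff N k *s G (a + k))"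
      by (rule sum.mono_neutral_left) (auto simp: J_coeff_def)
    also have "\<dots> = (\<Sum>k\<le>L - a. J_coeff N k *s G (a + k))"
      by (rule sum.mono_neutral_right) (auto simp: G0)
    finally show ?thesis .
  qed
  have "(\<Sum>a\<le>L. extraction_coeff N a *s (F ^^ a) (string_coeff (int N + int a) (J N \<xi>))) =
    (\<Sum>a\<le>L. \<Sum>k\<le>N. (extraction_coeff N a * J_coeff N k) *s G (a + k))"
  proof (rule sum.cong[OF refl])
    fix a
    show "extraction_coeff N a *s (F ^^ a) (string_coeff (int N + int a) (J N \<xi>)) = (\<Sum>k\<le>N. (extraction_coeff N a * J_coeff N k) *s G (a + k))"
      unfolding string_coeff_J by (simp add: linF scale_sum_right G_def funpow_add)
  qed
  also have "\<dots> = (\<Sum>a\<le>L. \<Sum>k\<le>L - a. (extraction_coeff N a * J_coeff N k) *s G (a + k))"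
  proof (rule sum.cong[OF refl])
    fix a assume "a \<in> {..L}"
    then show "(\<Sum>k\<le>N. (extraction_coeff N a * J_coeff N k) *s G (a + k)) = (\<Sum>k\<le>L - a. (extraction_coeff N a * J_coeff N k) *s G (a + k))"
      using inner[of a] by (simp flip: scale_scale scale_sum_right)
  qed
  also have "\<dots> = (\<Sum>(a, k)\<in>{(a, k). a + k \<le> L}. (extraction_coeff N a * J_coeff N k) *s G (a + k))"
  proof -
    have "{(a, k). a + k \<le> L} = Sigma {..L} (\<lambda>a. {..L - a})" by auto
    then show ?thesis by (simp add: sum.Sigma)
  qed
  also have "\<dots> = (\<Sum>j\<le>L. \<Sum>a\<le>j. (extraction_coeff N a * J_coeff N (j - a)) *s G (a + (j - a)))"
    by (rule sum.triangle_reindex_eq)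
  also have "\<dots> = (\<Sum>j\<le>L. (if j = 0 then 1 else 0) *s G j)"
    by (intro sum.cong refl) (simp add: extraction_scalar[OF assms(1), symmetric] scale_sum_left)
  also have "\<dots> = (\<Sum>j\<le>L. if j = 0 then G 0 else 0)" by (intro sum.cong refl) simp
  also have "\<dots> = G 0" by (simp)
  finally show ?thesis by (simp add: G_def)
qed

subsection \<open>Membership in the image\<close>

lemma f_pow_other: "(fX i ^^ Suc m) (fX (\<not> i) \<phi>) =
   qn (int m + 1) *x fX i (fX (\<not> i) ((fX i ^^ m) \<phi>)) - qn (int m) *x fX (\<not> i) ((fX i ^^ Suc m) \<phi>)"
proof (induction m)
  case (Suc m)
  have "(fX i ^^ Suc (Suc m)) (fX (\<not> i) \<phi>) =
     (qn (int m + 1) * qn 2 - qn (int m)) *x fX i (fX (\<not> i) ((fX i ^^ Suc m) \<phi>)) - qn (int m + 1) *x fX (\<not> i) ((fX i ^^ Suc (Suc m)) \<phi>)"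
    by (subst funpow.simps(2)) (simp only: comp_apply Suc.IH, simp add: linX f_serre X.scale_right_diff_distrib X.scale_left_diff_distrib)
  also have "qn (int m + 1) * qn 2 - qn (int m) = qn (int (Suc m) + 1)"
  proof -
    have "qn (int m + 1) * qn 2 - qn 1 * qn (int m) = qn 1 * qn (int (Suc m) + 1)"
      by (simp add: qsimps int_norm del: qnum_simps)
    then show ?thesis by simp
  qed
  finally show ?case by (simp add: add.commute)
qed simp

definition imJ :: "nat \<Rightarrow> 'v induced \<Rightarrow> bool" where
  "imJ N \<phi> \<longleftrightarrow> (\<exists>\<xi>. \<phi> = J N \<xi>)"

lemma imJ_closed: "imJ N \<phi> \<Longrightarrow> imJ N \<psi> \<Longrightarrow> imJ N (\<phi> + \<psi>)" "imJ N \<phi> \<Longrightarrow> imJ N (c *x \<phi>)" "imJ N \<phi> \<Longrightarrow> imJ N (fX j \<phi>)" "imJ N 0"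
  "imJ N \<phi> \<Longrightarrow> imJ N \<psi> \<Longrightarrow> imJ N (\<phi> - \<psi>)"
  unfolding imJ_def using linJ(1-4)[of N] J_f by metis+

lemma imJ_sum: "(\<And>a. a \<in> A \<Longrightarrow> imJ N (g a)) \<Longrightarrow> imJ N (sum g A)"
  by (induction A rule: infinite_finite_induct) (auto intro: imJ_closed)

lemma imJ_fpow: "imJ N \<phi> \<Longrightarrow> imJ N ((fX j ^^ m) \<phi>)"
  by (induction m) (simp_all add: imJ_closed)

text \<open>Modulo the image of \<open>J\<close> the vector $f_i^N (1 \otimes x)$ is a combination of vectors with \<open>F\<close>-powers of \<open>x\<close> inside, and \<open>F\<close> is
  nilpotent.\<close>

lemma imJ_gen: "(F ^^ M) x = 0 \<Longrightarrow> M \<le> R \<Longrightarrow> imJ N ((fX i ^^ (N + R)) (sg 0 0 0 x))"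
proof (induction M arbitrary: x R rule: less_induct)
  case (less M)
  show ?case
  proof (cases "M = 0")
    case True then show ?thesis using less.prems by (simp add: linfpow imJ_closed(4))
  next
    case False
    have "(fX i ^^ R) (J N (sg 0 0 0 x)) = (\<Sum>k\<le>N. J_coeff N k *x (fX i ^^ (R + (N - k))) (sg 0 0 0 ((F ^^ k) x)))"
      by (simp only: J_gen linfpow funpow_add o_apply)
    also have "\<dots> = J_coeff N 0 *x (fX i ^^ (N + R)) (sg 0 0 0 x) + (\<Sum>k\<in>{1..N}. J_coeff N k *x (fX i ^^ (R + (N - k))) (sg 0 0 0 ((F ^^ k) x)))"
    proof -
      have "{..N} = insert 0 {1..N}" by auto
      then show ?thesis by (simp add: add.commute)
    qed
    finally have eq: "J_coeff N 0 *x (fX i ^^ (N + R)) (sg 0 0 0 x) = (fX i ^^ R) (J N (sg 0 0 0 x)) -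
      (\<Sum>k\<in>{1..N}. J_coeff N k *x (fX i ^^ (R + (N - k))) (sg 0 0 0 ((F ^^ k) x)))" by simp
    have "imJ N (J_coeff N 0 *x (fX i ^^ (N + R)) (sg 0 0 0 x))" unfolding eq
    proof (rule imJ_closed(5))
      show "imJ N ((fX i ^^ R) (J N (sg 0 0 0 x)))" by (rule imJ_fpow) (auto simp: imJ_def)
      show "imJ N (\<Sum>k\<in>{1..N}. J_coeff N k *x (fX i ^^ (R + (N - k))) (sg 0 0 0 ((F ^^ k) x)))"
      proof (rule imJ_sum, rule imJ_closed(2))
      fix k assume k: "k \<in> {1..N}"
      show "imJ N ((fX i ^^ (R + (N - k))) (sg 0 0 0 ((F ^^ k) x)))"
      proof (cases "k < M")
        case True
        have "(F ^^ (M - k)) ((F ^^ k) x) = 0" using less.prems(1) True by (simp flip: funpow_add[THEN fun_cong, unfolded comp_def])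
        moreover have "R + (N - k) = N + (R - k)" using k True less.prems by simp
        ultimately show ?thesis using less.IH[of "M - k" "(F ^^ k) x" "R - k"] True k less.prems by simp
      next
        case False
        then have "(F ^^ k) x = (F ^^ (k - M)) ((F ^^ M) x)" by (simp flip: funpow_add[THEN fun_cong, unfolded comp_def])
        then show ?thesis using less.prems by (simp add: linF linfpow imJ_closed(4))
      qed
      qed
    qed
    then have "imJ N (inverse (J_coeff N 0) *x J_coeff N 0 *x (fX i ^^ (N + R)) (sg 0 0 0 x))" by (rule imJ_closed)
    moreover have "J_coeff N 0 \<noteq> 0" by (simp add: J_coeff_def)
    ultimately show ?thesis by simp
  qed
qed

lemma imJ_eventually: "\<exists>R. imJ N ((fX i ^^ R) \<phi>)"
proof (induction \<phi> rule: X_induct)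
  case (gen h x)
  show ?case using imJ_gen[of "Suc D" x "Suc D" N] Fpow_zero[of "Suc D" x] by blast
next
  case (add \<phi> \<psi>)
  then obtain R S where "imJ N ((fX i ^^ R) \<phi>)" "imJ N ((fX i ^^ S) \<psi>)" by blast
  then have "imJ N ((fX i ^^ S) ((fX i ^^ R) \<phi>))" "imJ N ((fX i ^^ R) ((fX i ^^ S) \<psi>))" by (simp_all add: imJ_fpow)
  then have "imJ N ((fX i ^^ (R + S)) (\<phi> + \<psi>))"
    by (simp add: linfpow imJ_closed add.commute[of R S] flip: funpow_add[THEN fun_cong, unfolded comp_def])
  then show ?case by blast
next
  case (scale c \<phi>)
  then show ?case by (auto simp: linfpow intro: imJ_closed)
next
  case (f j \<phi>)
  then obtain R where R: "imJ N ((fX i ^^ R) \<phi>)" by blast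
  show ?case
  proof (cases "j = i")
    case True
    show ?thesis using imJ_closed(3)[OF R, of i] True by (auto simp: funpow_swap1)
  next
    case False
    then have j: "j = (\<not> i)" by auto
    have "imJ N ((fX i ^^ Suc R) (fX (\<not> i) \<phi>))"
      unfolding f_pow_other using R by (auto intro!: imJ_closed)
    then show ?thesis unfolding j by blast
  qed
qed

definition singular :: "(bool \<Rightarrow> int) \<Rightarrow> (bool \<Rightarrow> int) \<Rightarrow> 'v induced \<Rightarrow> bool" where
  "singular p h w \<longleftrightarrow> wtX p h w \<and> (\<forall>j. eX p j w = 0)"

text \<open>By \<open>imJ_eventually\<close> a large power of $f_i$ sends \<open>w\<close> into the image of \<open>J\<close>. The exponent can be lowered to \<open>n\<close>, because $e_i$
  preserves the image and $e_i f_i^{R+1} w = [R+1][n-R-1] f_i^R w$ with a nonzero factor for \<open>R \<ge> n\<close>.\<close>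

lemma imJ_singular:
  assumes "singular p h w" "int N = p i + 1" "int n = h i + 1"
  shows "imJ N ((fX i ^^ n) w)"
proof -
  obtain R where R: "imJ N ((fX i ^^ R) w)" using imJ_eventually by blast
  have down: "imJ N ((fX i ^^ R) w)" if a1: "imJ N ((fX i ^^ Suc R) w)" and a2: "n \<le> R" for R
  proof -
    obtain \<xi> where \<xi>: "(fX i ^^ Suc R) w = J N \<xi>" using a1 unfolding imJ_def by blast
    have "J N (eX (shifted N p) i \<xi>) = eX p i ((fX i ^^ Suc R) w)"
      by (simp only: J_e[of N p, OF assms(2)] \<xi>)
    also have "\<dots> = (qn (int (Suc R)) * qn (h i - int (Suc R) + 1)) *x (fX i ^^ R) w"
      using e_fpow[of p h w "Suc R"] assms(1) by (simp add: singular_def linfpow linX)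
    finally have im: "imJ N ((qn (int (Suc R)) * qn (h i - int (Suc R) + 1)) *x (fX i ^^ R) w)" by (metis imJ_def)
    define X where "X = qn (int (Suc R)) * qn (h i - int (Suc R) + 1)"
    have "X \<noteq> 0" using a2 assms(3) by (simp add: X_def)
    moreover have "imJ N (inverse X *x X *x (fX i ^^ R) w)" using imJ_closed(2)[OF im[folded X_def]] .
    ultimately show ?thesis by simp
  qed
  have "imJ N ((fX i ^^ (n + m)) w) \<Longrightarrow> imJ N ((fX i ^^ n) w)" for m
    by (induction m) (use down in auto)
  moreover have "imJ N ((fX i ^^ (n + R)) w)" using imJ_fpow[OF R, where j = i and m = n] by (simp add: funpow_add)
  ultimately show ?thesis by blast
qed

text \<open>The condition $e_i w = 0$ is a recursion for the coefficients at the powers of $f_i$.\<close>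

lemma string_coeff_singular:
  assumes "singular p h w" "int n = h i + 1"
  shows "string_coeff (int k) w = ((- 1) ^ k * qf n * ifac (int k) * ifac (int n + int k)) *s (E i ^^ k) (string_coeff 0 w)"
proof (induction k)
  case (Suc k)
  define c where "c k = (- 1) ^ k * qf n * ifac (int k) * ifac (int n + int k)" for k
  have "wt (\<lambda>j. h j - p j + (int k + 1) * cart j i) (string_coeff (int k + 1) w)"
    using wt_string_coeff assms(1) by (auto simp: singular_def)
  from Hop_wt[OF this, of i "p i - int k"] have H: "Hop i (p i - int k) (string_coeff (int k + 1) w) = qn (int n + int k + 1) *s string_coeff (int k + 1) w"
    using assms(2) by (simp add: algebra_simps)
  have "0 = E i (string_coeff (int k) w) + (qn (int k + 1) * qn (int n + int k + 1)) *s string_coeff (int k + 1) w"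
    using string_coeff_e[of "int k" p w] assms(1) by (simp add: singular_def string_coeff_0 H)
  then have "(qn (int k + 1) * qn (int n + int k + 1)) *s string_coeff (int k + 1) w = - (c k *s (E i ^^ Suc k) (string_coeff 0 w))"
    unfolding Suc.IH by (simp add: lin c_def eq_neg_iff_add_eq_0 add.commute)
  moreover have nz: "qn (int k + 1) * qn (int n + int k + 1) \<noteq> 0" by simp
  moreover have "c k = - (qn (int k + 1) * qn (int n + int k + 1) * c (Suc k))"
    using ifac_rec'[of "int k"] ifac_rec'[of "int n + int k"] by (simp add: c_def algebra_simps)
  ultimately have "(qn (int k + 1) * qn (int n + int k + 1)) *s string_coeff (int k + 1) w =
     (qn (int k + 1) * qn (int n + int k + 1)) *s c (Suc k) *s (E i ^^ Suc k) (string_coeff 0 w)" by simp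
  then have "string_coeff (int k + 1) w = c (Suc k) *s (E i ^^ Suc k) (string_coeff 0 w)" using nz unfolding scale_cancel_left by blast
  then show ?case by (simp add: c_def add.commute)
qed simp

text \<open>The operator that a step induces on the coefficient at 1; for \<open>R \<ge> D\<close> the omitted terms vanish.\<close>

definition step_op :: "nat \<Rightarrow> nat \<Rightarrow> nat \<Rightarrow> 'v \<Rightarrow> 'v" where
  "step_op N n R u = (let a = nat (int n - int N); b = nat (int N - int n) in
     \<Sum>j\<le>R. ((- 1) ^ (j + b) * (qn (int N) / qn (int (n + j + b))) * ifac (int (j + a)) * ifac (int (j + b)))
       *s (F ^^ (j + a)) ((E i ^^ (j + b)) u))"

text \<open>Membership in the image is \<open>imJ_singular\<close>. The preimage is singular because \<open>J\<close> is an injective intertwiner, and \<open>extraction\<close>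
  together with \<open>string_coeff_singular\<close> gives its coefficient at 1.\<close>

theorem step:
  assumes w: "singular p h w" and N: "int N = p i + 1" "N \<ge> 1" and n: "int n = h i + 1" "n \<ge> 1" and R: "D \<le> R"
  shows "\<exists>w'. J N w' = ifac (int n) *x (fX i ^^ n) w \<and> singular (shifted N p) (\<lambda>j. h j - int n * cart j i) w' \<and>
    string_coeff 0 w' = step_op N n R (string_coeff 0 w)"
proof -
  obtain \<xi> where \<xi>: "(fX i ^^ n) w = J N \<xi>" using imJ_singular[OF w N(1) n(1)] by (auto simp: imJ_def)
  define w' where "w' = ifac (int n) *x \<xi>"
  have Jw: "J N w' = ifac (int n) *x (fX i ^^ n) w" by (simp add: w'_def linJ \<xi>)
  have wt: "wtX p h w" and e: "\<And>j. eX p j w = 0" using w by (auto simp: singular_def)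
  have e0: "eX (shifted N p) j w' = 0" for j
  proof (rule J_eq_0)
    have "J N (eX (shifted N p) j w') = ifac (int n) *x eX p j ((fX i ^^ n) w)"
      by (simp only: J_e[of N p, OF N(1), symmetric] Jw linX)
    also have "eX p j ((fX i ^^ n) w) = 0"
    proof (cases "j = i")
      case True then show ?thesis using e_fpow[OF wt, of n] n by (simp add: e linfpow)
    next
      case False
      then have "j = (\<not> i)" by auto
      then show ?thesis by (simp add: e_other_fpow e linfpow)
    qed
    finally show "J N (eX (shifted N p) j w') = 0" by simp
  qed
  have wt': "wtX (shifted N p) (\<lambda>j. h j - int n * cart j i) w'"
    unfolding wtX_def
  proof (rule allI, rule J_inj[where N = N])
    fix j
    have "J N (kX (shifted N p) j w') = kX p j (J N w')" by (simp only: J_k)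
    also have "\<dots> = q powi (h j - int n * cart j i) *x J N w'"
      using wtX_fpow[OF wt, of n] by (simp add: Jw linX wtX_def mult.commute)
    finally show "J N (kX (shifted N p) j w') = J N (q powi (h j - int n * cart j i) *x w')" by (simp add: linJ)
  qed
  define a where "a = nat (int n - int N)"
  define b where "b = nat (int N - int n)"
  have ab: "int a - int b = int n - int N" by (simp add: a_def b_def)
  have summand: "extraction_coeff N t *s (F ^^ t) (string_coeff (int N + int t) (J N w')) =
      (if t < a then 0 else ((- 1) ^ (t - a + b) * (qn (int N) / qn (int (n + (t - a) + b))) * ifac (int t) * ifac (int (t - a + b)))
       *s (F ^^ t) ((E i ^^ (t - a + b)) (string_coeff 0 w)))" for t
  proof -
    have y: "string_coeff (int N + int t) (J N w') = ifac (int n) *s string_coeff (int t - int a + int b) w"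
    proof -
      have shift: "int N + int t - int n = int t - int a + int b" using ab by linarith
      show ?thesis unfolding Jw string_coeff_scale string_coeff_fpow shift ..
    qed
    show ?thesis
    proof (cases "t < a")
      case True
      then have "int t - int a + int b < 0" by (auto simp: a_def b_def)
      then show ?thesis using True unfolding y by (simp add: string_coeff_def linF)
    next
      case False
      define k where "k = t - a + b"
      have k: "int t - int a + int b = int k" using False by (simp add: k_def)
      have nk: "n + k = N + t" using ab k by linarith
      obtain M where M: "N + t = Suc M" using N(2) by (cases "N + t") auto
      have E0: "extraction_coeff N t * (ifac (int n) * ((- 1) ^ k * qf n * ifac (int k) * ifac (int n + int k))) =
        (- 1) ^ k * (qn (int N) / qn (int (n + k))) * ifac (int t) * ifac (int k)"
      proof -
        have "int n + int k = int (Suc M)" using nk M by (simp flip: of_nat_add)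
        then have "ifac (int n + int k) = 1 / (qn (int (Suc M)) * qf M)" by (simp add: qfact_Suc del: of_nat_Suc)
        moreover have "N + t - 1 = M" using M by simp
        moreover have "n + k = Suc M" using nk M by simp
        ultimately show ?thesis by (simp add: extraction_coeff_def mult_ac del: of_nat_Suc)
      qed
      have nk': "n + (t - a) + b = n + k" by (simp add: k_def)
      show ?thesis using False unfolding y k string_coeff_singular[OF w n(1)] nk' unfolding k_def[symmetric]
        by (simp only: if_False linF scale_scale E0)
    qed
  qed
  have "string_coeff 0 w' = (\<Sum>t\<le>R + a. extraction_coeff N t *s (F ^^ t) (string_coeff (int N + int t) (J N w')))"
    by (rule extraction) (use N(2) R in auto)
  also have "\<dots> = (\<Sum>t\<in>{a..R + a}. extraction_coeff N t *s (F ^^ t) (string_coeff (int N + int t) (J N w')))"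
    by (rule sum.mono_neutral_right) (auto simp: summand)
  also have "\<dots> = (\<Sum>j\<in>{0..R}. extraction_coeff N (j + a) *s (F ^^ (j + a)) (string_coeff (int N + int (j + a)) (J N w')))"
    using sum.shift_bounds_cl_nat_ivl[of "\<lambda>t. extraction_coeff N t *s (F ^^ t) (string_coeff (int N + int t) (J N w'))" 0 a R] by simp
  also have "\<dots> = step_op N n R (string_coeff 0 w)"
    unfolding step_op_def Let_def atMost_atLeast0 by (intro sum.cong refl) (simp only: summand, simp add: a_def[symmetric] b_def[symmetric])
  finally show ?thesis using Jw e0 wt' by (auto simp: singular_def)
qed

definition step_op_inv :: "nat \<Rightarrow> nat \<Rightarrow> nat \<Rightarrow> 'v \<Rightarrow> 'v" where
  "step_op_inv N n R u = (let a = nat (int n - int N); b = nat (int N - int n) in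
     \<Sum>j\<le>R. ((- 1) ^ (j + b) * (qn (int n) / qn (int N - int (j + b))) * ifac (int (j + b)) * ifac (int (j + a)))
       *s (F ^^ (j + b)) ((E i ^^ (j + a)) u))"

text \<open>The coefficient at 1 of \<open>w\<close> is, up to $[n]!$, the coefficient of $f_i^n w$ at $f_i^n$. By the definition of \<open>J\<close> it is expressed
  through the coefficients of \<open>w'\<close> at the powers of $f_i$, which satisfy a recursion again. That recursion breaks down at the
  power \<open>n\<close>; for large \<open>n\<close> boundedness of the weights makes the coefficients vanish from there on.\<close>

theorem step_inverse:
  assumes Jw: "J N w' = ifac (int n) *x (fX i ^^ n) w" and w': "singular (shifted N p) (\<lambda>j. h j - int n * cart j i) w'"
    and N: "int N = p i + 1" and n: "int n = h i + 1" and large: "D < N" "D < n" "\<bar>int n - int N\<bar> \<le> int D" and R: "D \<le> R"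
  shows "string_coeff 0 w = step_op_inv N n R (string_coeff 0 w')"
proof -
  define u where "u = string_coeff 0 w'"
  have wt: "wtX (shifted N p) (\<lambda>j. h j - int n * cart j i) w'" and e: "\<And>j. eX (shifted N p) j w' = 0"
    using w' by (auto simp: singular_def)
  define c where "c j = qf (n - 1 - j) * ifac (int j) / qf (n - 1)" for j
  have wj: "wt (\<lambda>l. h l - int n * cart l i - shifted N p l + int j * cart l i) (string_coeff (int j) w')" for j
    using wt_string_coeff[OF wt, of "int j"] by simp
  have ywt: "h i - int n * cart i i - shifted N p i + int j * cart i i = int N - int n + 2 * int j" for j
    using N n by (simp add: shifted_def)
  have y0: "string_coeff (int j) w' = 0" if "n \<le> j" for j
  proof (rule wt_bounded[OF wj])
    show "int D < \<bar>h i - int n * cart i i - shifted N p i + int j * cart i i\<bar>"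
      unfolding ywt using large that by linarith
  qed
  have y: "string_coeff (int j) w' = c j *s (E i ^^ j) u" for j
  proof (induction j)
    case 0 then show ?case by (simp add: c_def u_def)
  next
    case (Suc j)
    show ?case
    proof (cases "n \<le> Suc j")
      case True
      then show ?thesis using y0[OF True] Epow_zero[of "Suc j" u] large by simp
    next
      case False
      have H: "Hop i (shifted N p i - int j) (string_coeff (int j + 1) w') = - qn (int n - 1 - int j) *s string_coeff (int j + 1) w'"
      proof -
        have "Hop i (shifted N p i - int j) (string_coeff (int (Suc j)) w') =
          qn (h i - int n * cart i i - shifted N p i + int (Suc j) * cart i i + (shifted N p i - int j)) *s string_coeff (int (Suc j)) w'"
          by (rule Hop_wt[OF wj])
        also have "h i - int n * cart i i - shifted N p i + int (Suc j) * cart i i + (shifted N p i - int j) = - (int n - 1 - int j)"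
          unfolding ywt using N by (simp add: shifted_def)
        finally show ?thesis by (simp add: add.commute del: minus_diff_eq)
      qed
      have "0 = E i (string_coeff (int j) w') + qn (int j + 1) *s Hop i (shifted N p i - int j) (string_coeff (int j + 1) w')"
        using string_coeff_e[of "int j" "shifted N p" w'] e by (simp add: string_coeff_0)
      then have eq: "(qn (int j + 1) * qn (int n - 1 - int j)) *s string_coeff (int j + 1) w' = c j *s (E i ^^ Suc j) u"
        unfolding H Suc.IH by (simp add: lin)
      obtain M where M: "n - 1 - j = Suc M" using False by (metis Suc_diff_Suc diff_Suc_eq_diff_pred not_le)
      have "c j = qn (int j + 1) * qn (int n - 1 - int j) * c (Suc j)"
      proof -
        have 1: "int n - 1 - int j = int (Suc M)" using M False by linarith
        have 2: "n - 1 - Suc j = M" using M by simp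
        have 3: "int (Suc j) = int j + 1" by simp
        show ?thesis unfolding c_def 1 2 3 M qfact_Suc ifac_rec'[of "int j"] by (simp only: mult_ac times_divide_eq_right)
      qed
      moreover have "qn (int j + 1) * qn (int n - 1 - int j) \<noteq> 0" using False by simp
      ultimately show ?thesis using eq by (simp add: scale_cancel_left add.commute flip: scale_scale)
    qed
  qed
  define a where "a = nat (int n - int N)"
  define b where "b = nat (int N - int n)"
  have ab: "int a - int b = int n - int N" by (simp add: a_def b_def)
  define T where "T k = (qf n * J_coeff N k) *s (F ^^ k) (string_coeff (int n - int N + int k) w')" for k
  have T0: "T k = 0" if small: "k < b \<or> D < k \<or> N < k" for k
  proof -
    consider "k < b" | "D < k" | "N < k" using small by blast
    then show ?thesis
    proof cases
      case 1
      then have "int n - int N + int k < 0" by (auto simp: b_def)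
      then show ?thesis by (simp add: T_def string_coeff_def linF)
    qed (simp_all add: T_def Fpow_zero J_coeff_def)
  qed
  have "string_coeff (int n) (J N w') = ifac (int n) *s string_coeff 0 w" unfolding Jw by (simp add: string_coeff_scale string_coeff_fpow)
  then have "string_coeff 0 w = qf n *s string_coeff (int n) (J N w')" by simp
  also have "\<dots> = (\<Sum>k\<le>N. T k)"
    using string_coeff_J[of N "int n - int N" w'] by (simp add: T_def scale_sum_right)
  also have "\<dots> = (\<Sum>k\<le>N + (R + b). T k)" by (rule sum.mono_neutral_left) (auto simp: T0)
  also have "\<dots> = (\<Sum>k\<in>{b..R + b}. T k)" by (rule sum.mono_neutral_right) (use R in \<open>auto simp: T0\<close>)
  also have "\<dots> = (\<Sum>j\<in>{0..R}. T (j + b))"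
    using sum.shift_bounds_cl_nat_ivl[of T 0 b R] by simp
  also have "\<dots> = step_op_inv N n R u"
    unfolding step_op_inv_def Let_def atMost_atLeast0 a_def[symmetric] b_def[symmetric]
  proof (rule sum.cong[OF refl])
    fix j
    show "T (j + b) = ((- 1) ^ (j + b) * (qn (int n) / qn (int N - int (j + b))) * ifac (int (j + b)) * ifac (int (j + a)))
       *s (F ^^ (j + b)) ((E i ^^ (j + a)) u)"
    proof (cases "D < j + b")
      case True then show ?thesis by (simp add: T0 Fpow_zero)
    next
      case False
      then have k: "j + b < N" using large by simp
      then obtain M where M: "N - (j + b) = Suc M" by (metis Suc_diff_Suc)
      have 1: "int n - int N + int (j + b) = int (j + a)" using ab by simp
      have 2: "n - 1 - (j + a) = M" using M ab k by linarith
      have 3: "int N - int (j + b) = int (Suc M)" using M k by linarith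
      obtain n' where n': "n = Suc n'" using large by (cases n) auto
      have "qf n * J_coeff N (j + b) * c (j + a) =
        (- 1) ^ (j + b) * (qn (int n) / qn (int N - int (j + b))) * ifac (int (j + b)) * ifac (int (j + a))"
        unfolding c_def 2 J_coeff_def 3 unfolding n' by (simp add: qfact_Suc mult_ac del: of_nat_Suc)
      then show ?thesis unfolding T_def 1 y by (simp add: linF)
    qed
  qed
  finally show ?thesis by (simp add: u_def)
qed

section \<open>The intertwiners satisfy the Verma identity\<close>

lemma ki_commutation:
  assumes "Vector_Spaces.linear sX sX A" "\<And>\<phi>. kX p j (A \<phi>) = q powi c *x A (kX p j \<phi>)"
  shows "kiX p j (A \<phi>) = q powi (- c) *x A (kiX p j \<phi>)"
proof -
  have "A \<phi> = q powi (- c) *x kX p j (A (kiX p j \<phi>))"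
    by (simp add: assms(2) k_ki powi_mult)
  then have "kiX p j (A \<phi>) = q powi (- c) *x kiX p j (kX p j (A (kiX p j \<phi>)))"
    by (simp add: linX)
  then show ?thesis by (simp add: ki_k)
qed

lemma ki_r: "kiX p j (rX l \<phi>) = q powi (cart j l) *x rX l (kiX p j \<phi>)"
  using ki_commutation[OF linear_ops(2)[of l] k_r] by simp

lemma ki_FX: "kiX p j (FX \<phi>) = q powi (cart j i) *x FX (kiX p j \<phi>)"
  using ki_commutation[OF linear_FX k_FX] by simp

lemma ki_ki: "kiX p j (kiX p l \<phi>) = kiX p l (kiX p j \<phi>)"
proof (rule X_linear_eqI[where A = "\<lambda>\<phi>. kiX p j (kiX p l \<phi>)"])
  fix a b c h x assume w: "wt h x"
  show "kiX p j (kiX p l (sg a b c x)) = kiX p l (kiX p j (sg a b c x))"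
    by (simp add: k_single Ki_wt[OF w] lin mult_ac)
qed (rule linear_all | rule linear_intros3)+

text \<open>The difference of right multiplication by $f_i$ and a twist of \<open>F\<close> on the coefficients. On a vector of known weight the
  twist is a scalar, and for one choice of \<open>\<beta>\<close> the \<open>N\<close>-th power of \<open>delta\<close> is $[N]!$ times \<open>J N\<close>.\<close>

definition delta :: "(bool \<Rightarrow> int) \<Rightarrow> complex \<Rightarrow> 'v induced \<Rightarrow> 'v induced" where
  "delta p \<beta> \<phi> = rX i \<phi> - \<beta> *x FX (kiX p i \<phi>)"

lemma linear_delta: "Vector_Spaces.linear sX sX (delta p \<beta>)"
  unfolding delta_def by (rule linear_all linear_FX | rule linear_introsF)+

lemma wtX_r: "wtX p h \<phi> \<Longrightarrow> wtX p (\<lambda>j. h j - cart j l) (rX l \<phi>)"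
  by (simp add: wtX_def k_r linX powi_mult)

lemma wtX_FX: "wtX p h \<phi> \<Longrightarrow> wtX p (\<lambda>j. h j - cart j i) (FX \<phi>)"
  by (simp add: wtX_def k_FX linFX powi_mult)

lemma wtX_rpow: "wtX p h \<phi> \<Longrightarrow> wtX p (\<lambda>j. h j - int m * cart j i) ((rX i ^^ m) \<phi>)"
proof (induction m)
  case (Suc m) show ?case using wtX_r[OF Suc.IH[OF Suc.prems], of i] by (auto simp: algebra_simps)
qed simp

lemma wtX_FXpow: "wtX p h \<phi> \<Longrightarrow> wtX p (\<lambda>j. h j - int m * cart j i) ((FX ^^ m) \<phi>)"
proof (induction m)
  case (Suc m) show ?case using wtX_FX[OF Suc.IH[OF Suc.prems]] by (auto simp: algebra_simps)
qed simp

lemma wtX_delta: "wtX p h \<phi> \<Longrightarrow> wtX p (\<lambda>j. h j - cart j i) (delta p \<beta> \<phi>)"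
  unfolding delta_def
  by (intro wtX_diff wtX_r wtX_scale wtX_FX) (auto simp: ki_wtX wtX_scale)

lemma wtX_deltapow: "wtX p h \<phi> \<Longrightarrow> wtX p (\<lambda>j. h j - int m * cart j i) ((delta p \<beta> ^^ m) \<phi>)"
proof (induction m)
  case (Suc m) show ?case using wtX_delta[OF Suc.IH[OF Suc.prems], of \<beta>] by (auto simp: algebra_simps)
qed simp

definition delta_coeff :: "complex \<Rightarrow> nat \<Rightarrow> nat \<Rightarrow> complex" where
  "delta_coeff b n k = (- 1) ^ k * qf n * ifac (int n - int k) * ifac (int k) * (b * q powi (int n - 1)) ^ k"

lemma delta_coeff_rec: "delta_coeff b (Suc n) k = delta_coeff b n k - (if k = 0 then 0 else b * q powi (2 * int n) * delta_coeff b n (k - 1))"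
proof -
  define Z where "Z = (- 1) ^ k * qf n * ifac (int n + 1 - int k) * ifac (int k) * b ^ k * q powi ((int n - 1) * int k)"
  have pw: "(b * q powi x) ^ l = b ^ l * q powi (x * int l)" for x l
    by (simp add: power_mult_distrib power_int_power')
  have L: "delta_coeff b (Suc n) k = Z * (q powi (int k) * qn (int n + 1))"
  proof -
    have "q powi ((int (Suc n) - 1) * int k) = q powi ((int n - 1) * int k) * q powi (int k)"
      by (simp add: powi_mult algebra_simps)
    then show ?thesis unfolding delta_coeff_def pw Z_def by (simp add: qfact_Suc add_ac mult_ac)
  qed
  have R1: "delta_coeff b n k = Z * qn (int n + 1 - int k)"
  proof -
    have "ifac (int n - int k) = qn (int n + 1 - int k) * ifac (int n + 1 - int k)"
      using ifac_rec[of "int n + 1 - int k"] by simp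
    then show ?thesis unfolding delta_coeff_def pw Z_def by simp
  qed
  have R2: "(if k = 0 then 0 else b * q powi (2 * int n) * delta_coeff b n (k - 1)) = - (Z * (q powi (int n + 1) * qn (int k)))"
  proof (cases k)
    case (Suc l)
    have 1: "q powi (2 * int n) * q powi ((int n - 1) * int l) = q powi ((int n - 1) * int k) * q powi (int n + 1)"
      by (simp add: powi_mult Suc algebra_simps)
    have 2: "ifac (int l) = qn (int k) * ifac (int k)" using ifac_rec[of "int k"] Suc by simp
    have 3: "int n - int l = int n + 1 - int k" using Suc by simp
    have "b * q powi (2 * int n) * delta_coeff b n l = b * b ^ l * (- 1) ^ l * qf n * ifac (int n - int l) * ifac (int l) * (q powi (2 * int n) * q powi ((int n - 1) * int l))"
      unfolding delta_coeff_def pw by (simp only: mult_ac)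
    also have "\<dots> = b ^ Suc l * (- 1) ^ l * qf n * ifac (int n + 1 - int k) * (qn (int k) * ifac (int k)) * (q powi ((int n - 1) * int k) * q powi (int n + 1))"
      unfolding 1 2 3 power_Suc ..
    finally have "b * q powi (2 * int n) * delta_coeff b n l = \<dots>" .
    then show ?thesis using Suc by (simp add: Z_def mult_ac)
  qed simp
  have "q powi (int k) * qn (int n + 1) = qn (int n + 1 - int k) + q powi (int n + 1) * qn (int k)"
    using arg_cong[OF qnum_split[of "int k" "int n"], of "\<lambda>z. q powi int k * z"]
    by (simp add: distrib_left powi_mult powi_mult_left)
  then show ?thesis unfolding L R1 R2 by (simp add: distrib_left)
qed

text \<open>A \<open>q\<close>-binomial expansion: right multiplication by $f_i$ and the twisted \<open>F\<close> commute up to a power of \<open>q\<close>.\<close>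

lemma delta_pow:
  assumes w: "wtX p h \<phi>"
  shows "(delta p \<beta> ^^ n) \<phi> = (\<Sum>k\<le>n. delta_coeff (\<beta> * q powi (- h i)) n k *x (rX i ^^ (n - k)) ((FX ^^ k) \<phi>))"
proof (induction n)
  case 0 show ?case by (simp add: delta_coeff_def)
next
  case (Suc n)
  define b where "b = \<beta> * q powi (- h i)"
  define T where "T m k = (rX i ^^ m) ((FX ^^ k) \<phi>)" for m k
  have d: "delta p \<beta> (T (n - k) k) = T (Suc n - k) k - (b * q powi (2 * int n)) *x T (n - k) (Suc k)" if "k \<le> n" for k
  proof -
    have "wtX p (\<lambda>j. h j - int k * cart j i - int (n - k) * cart j i) (T (n - k) k)"
      unfolding T_def by (rule wtX_rpow[OF wtX_FXpow[OF w]])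
    from ki_wtX[OF this, of i] have "kiX p i (T (n - k) k) = q powi (2 * int n - h i) *x T (n - k) k"
      using that by (simp add: of_nat_diff algebra_simps)
    moreover have "FX (T m k) = T m (Suc k)" for m
      unfolding T_def by (induction m) (simp_all add: FX_r)
    moreover have "rX i (T (n - k) k) = T (Suc n - k) k" using that by (simp add: T_def Suc_diff_le)
    moreover have "\<beta> * q powi (2 * int n - h i) = b * q powi (2 * int n)" by (simp add: b_def powi_mult mult.assoc)
    ultimately show ?thesis by (simp add: delta_def linFX)
  qed
  have "(delta p \<beta> ^^ Suc n) \<phi> = (\<Sum>k\<le>n. delta_coeff b n k *x (T (Suc n - k) k - (b * q powi (2 * int n)) *x T (n - k) (Suc k)))"
    unfolding funpow.simps comp_apply Suc.IH by (simp add: X.linear_rules[OF linear_delta] d flip: T_def b_def)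
  also have "\<dots> = (\<Sum>k\<le>n. delta_coeff b n k *x T (Suc n - k) k) - (\<Sum>k\<le>n. (b * q powi (2 * int n) * delta_coeff b n k) *x T (n - k) (Suc k))"
    by (simp add: X.scale_right_diff_distrib sum_subtractf mult_ac)
  also have "(\<Sum>k\<le>n. delta_coeff b n k *x T (Suc n - k) k) = (\<Sum>k\<le>Suc n. delta_coeff b n k *x T (Suc n - k) k)"
    by (simp add: delta_coeff_def)
  also have "(\<Sum>k\<le>n. (b * q powi (2 * int n) * delta_coeff b n k) *x T (n - k) (Suc k)) =
    (\<Sum>k\<le>Suc n. (if k = 0 then 0 else b * q powi (2 * int n) * delta_coeff b n (k - 1)) *x T (Suc n - k) k)"
    by (simp add: sum.atMost_Suc_shift del: sum.atMost_Suc)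
  finally show ?case
    unfolding delta_coeff_rec b_def[symmetric] T_def[symmetric] by (simp only: X.scale_left_diff_distrib sum_subtractf)
qed

lemma delta_pow_J:
  assumes "wtX p h \<phi>" "\<beta> = q powi (h i + 1 - int n)"
  shows "(delta p \<beta> ^^ n) \<phi> = qf n *x J n \<phi>"
proof -
  have 1: "\<beta> * q powi (- h i) * q powi (int n - 1) = 1" unfolding assms(2) by (simp add: powi_mult)
  have "delta_coeff (\<beta> * q powi (- h i)) n k = qf n * J_coeff n k" for k
    unfolding delta_coeff_def 1 J_coeff_def by simp
  then show ?thesis unfolding delta_pow[OF assms(1)] J_def by (simp add: X.scale_sum_right)
qed

end

locale sl3_module = bounded_borel_module q s E K Ki D
  for q :: complex and s :: "complex \<Rightarrow> 'v::ab_group_add \<Rightarrow> 'v" (infixr \<open>*s\<close> 75) and E K Ki D +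
  fixes F :: "bool \<Rightarrow> 'v \<Rightarrow> 'v"
  assumes step_module_F: "step_module q s E K Ki D i (F i)"
    and F_serre: "F i (F i (F (\<not> i) x)) = qnum q 2 *s F i (F (\<not> i) (F i x)) - F (\<not> i) (F i (F i x))"
begin

sublocale S: step_module q s E K Ki D i "F i" for i
  by (rule step_module_F)

context
  fixes p :: "bool \<Rightarrow> int" and \<beta> :: "bool \<Rightarrow> complex"
begin

definition G :: "bool \<Rightarrow> 'v induced \<Rightarrow> 'v induced" where
  "G i \<phi> = \<beta> i *x S.FX i (kiX p i \<phi>)"

lemma linear_G: "Vector_Spaces.linear sX sX (G i)"
  by (rule X.linearI) (simp_all add: G_def linX S.linFX X.scale_right_distrib mult_ac)

lemmas linG = X.linear_rules[OF linear_G]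

lemma G_r: "G i (rX j \<phi>) = q powi (cart i j) *x rX j (G i \<phi>)"
  by (simp add: G_def S.ki_r S.FX_r linX S.linFX mult_ac)

lemma ki_FX': "kiX p j (S.FX i \<phi>) = q powi (cart j i) *x S.FX i (kiX p j \<phi>)"
  by (rule S.ki_FX)

lemma FX_serre: "S.FX i (S.FX i (S.FX (\<not> i) \<phi>)) = qn 2 *x S.FX i (S.FX (\<not> i) (S.FX i \<phi>)) - S.FX (\<not> i) (S.FX i (S.FX i \<phi>))"
  by (rule poly_mapping_eqI) (simp add: S.lookup_FX F_serre lookup_minus)

lemma G_triple: "G i (G j (G l \<phi>)) = (\<beta> i * \<beta> j * \<beta> l * q powi (cart i j + cart i l + cart j l)) *x
    S.FX i (S.FX j (S.FX l (kiX p i (kiX p j (kiX p l \<phi>)))))"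
  by (simp add: G_def linX S.linFX ki_FX' powi_mult mult_ac add_ac)

lemma G_serre: "G i (G i (G (\<not> i) \<phi>)) = qn 2 *x G i (G (\<not> i) (G i \<phi>)) - G (\<not> i) (G i (G i \<phi>))"
proof -
  define \<psi> where "\<psi> = kiX p i (kiX p i (kiX p (\<not> i) \<phi>))"
  have k: "kiX p i (kiX p (\<not> i) (kiX p i \<phi>)) = \<psi>" "kiX p (\<not> i) (kiX p i (kiX p i \<phi>)) = \<psi>"
    using S.ki_ki[of p i "\<not> i"] by (simp_all add: \<psi>_def)
  show ?thesis
    unfolding G_triple k \<psi>_def[symmetric] FX_serre[of i \<psi>]
    by (simp add: X.scale_right_diff_distrib mult_ac)
qed

definition dl :: "bool \<Rightarrow> 'v induced \<Rightarrow> 'v induced" where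
  "dl i \<phi> = rX i \<phi> - G i \<phi>"

lemma dl_delta: "dl i = S.delta i p (\<beta> i)"
  by (rule ext) (simp add: dl_def G_def S.delta_def)

text \<open>The twisted operators \<open>G\<close> \<open>q\<close>-commute with the right multiplications and satisfy the \<open>q\<close>-Serre relations themselves, so the
  difference of the two families satisfies them as well.\<close>

lemma dl_serre: "dl i (dl i (dl (\<not> i) \<phi>)) = qn 2 *x dl i (dl (\<not> i) (dl i \<phi>)) - dl (\<not> i) (dl i (dl i \<phi>))"
proof -
  define o' where "o' = (\<not> i)"
  have c: "cart i i = 2" "cart i o' = -1" "cart o' i = -1" by (simp_all add: o'_def)
  define A where "A = rX i (rX i (G o' \<phi>))"
  define B where "B = rX i (rX o' (G i \<phi>))"
  define C where "C = rX o' (rX i (G i \<phi>))"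
  define P where "P = rX i (G i (G o' \<phi>))"
  define Q where "Q = rX i (G o' (G i \<phi>))"
  define R where "R = rX o' (G i (G i \<phi>))"
  have 1: "dl i (dl i (dl o' \<phi>)) = rX i (rX i (rX o' \<phi>)) - A - (q powi (- 1) + q powi 1) *x B
      + (1 + q powi 2) *x P + q powi (- 2) *x R - G i (G i (G o' \<phi>))"
    by (simp add: dl_def linX linG G_r c A_def B_def P_def R_def X.scale_left_distrib X.scale_right_distrib X.scale_right_diff_distrib powi_mult algebra_simps)
  have 2: "dl i (dl o' (dl i \<phi>)) = rX i (rX o' (rX i \<phi>)) - B - q powi (- 1) *x A - q powi 1 *x C + Q + q powi 1 *x P + q powi (- 1) *x R - G i (G o' (G i \<phi>))"
    by (simp add: dl_def linX linG G_r c A_def B_def C_def P_def Q_def R_def X.scale_left_distrib X.scale_right_distrib X.scale_right_diff_distrib powi_mult algebra_simps)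
  have 3: "dl o' (dl i (dl i \<phi>)) = rX o' (rX i (rX i \<phi>)) - (1 + q powi 2) *x C - q powi (- 2) *x A + R + (q powi (- 1) + q powi 1) *x Q - G o' (G i (G i \<phi>))"
    by (simp add: dl_def linX linG G_r c A_def B_def C_def P_def Q_def R_def X.scale_left_distrib X.scale_right_distrib X.scale_right_diff_distrib powi_mult algebra_simps)
  show ?thesis
    unfolding o'_def[symmetric] 1 2 3 r_serre[of i \<phi>, folded o'_def] G_serre[of i \<phi>, folded o'_def] qnum_two
    by (simp add: X.scale_left_distrib X.scale_right_distrib X.scale_right_diff_distrib powi_mult algebra_simps)
qed

lemma dl_verma: "(dl False ^^ b) ((dl True ^^ (a + b)) ((dl False ^^ a) \<phi>)) = (dl True ^^ a) ((dl False ^^ (a + b)) ((dl True ^^ b) \<phi>))"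
proof -
  interpret V: serre_pair q sX "dl False" "dl True"
  proof (intro serre_pair.intro serre_pair_axioms.intro)
    show "quantum_parameter q" "complex_vector_space sX" by unfold_locales
    show "Vector_Spaces.linear sX sX (dl False)" "Vector_Spaces.linear sX sX (dl True)"
      unfolding dl_delta by (rule S.linear_delta)+
    show "dl False (dl False (dl True x)) = qn 2 *x dl False (dl True (dl False x)) - dl True (dl False (dl False x))" for x
      using dl_serre[of False] by simp
    show "dl True (dl True (dl False x)) = qn 2 *x dl True (dl False (dl True x)) - dl False (dl True (dl True x))" for x
      using dl_serre[of True] by simp
  qed
  show ?thesis by (rule V.verma_identity)
qed

end

text \<open>Along both words the weights change in the same way as the parameters of \<open>delta\<close> require: with \<open>\<beta>\<close> fixed for each node once and for
  all, every intertwiner in the two composites is a divided power of the same two operators.\<close>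

lemma J_braid:
  assumes w: "wtX p h \<phi>"
  shows "S.J False b (S.J True (a + b) (S.J False a \<phi>)) = S.J True a (S.J False (a + b) (S.J True b \<phi>))"
proof -
  define \<beta> where "\<beta> i = q powi (h i + 1 - int (if i then b else a))" for i
  note dp = S.delta_pow_J[where p = p]
  have wt1: "wtX p (\<lambda>j. h j - int m * cart j i) (S.J i m \<phi>)" if "wtX p h \<phi>" for h i m \<phi>
  proof -
    have "S.J i m \<phi> = inverse (qf m) *x (S.delta i p (q powi (h i + 1 - int m)) ^^ m) \<phi>"
      by (simp add: dp[OF that refl])
    then show ?thesis using wtX_scale[OF S.wtX_deltapow[OF that]] by simp
  qed
  have s: "(dl p \<beta> i ^^ m) \<phi> = qf m *x S.J i m \<phi>" if "wtX p h' \<phi>" "\<beta> i = q powi (h' i + 1 - int m)" for i m h' \<phi>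
    unfolding dl_delta by (rule dp[OF that])
  have l: "(dl p \<beta> i ^^ m) (c *x \<phi>) = c *x (dl p \<beta> i ^^ m) \<phi>" for i m c \<phi>
    unfolding dl_delta by (rule X.linear_scale[OF X.linear_funpow[OF S.linear_delta]])
  have L: "(dl p \<beta> False ^^ b) ((dl p \<beta> True ^^ (a + b)) ((dl p \<beta> False ^^ a) \<phi>)) =
    (qf a * (qf (a + b) * qf b)) *x S.J False b (S.J True (a + b) (S.J False a \<phi>))"
    using s[OF w, of False a] s[OF wt1[where i = False and m = a, OF w], of True "a + b"]
      s[OF wt1[where i = True and m = "a + b", OF wt1[where i = False and m = a, OF w]], of False b]
    by (simp add: \<beta>_def l algebra_simps)
  have R: "(dl p \<beta> True ^^ a) ((dl p \<beta> False ^^ (a + b)) ((dl p \<beta> True ^^ b) \<phi>)) =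
    (qf b * (qf (a + b) * qf a)) *x S.J True a (S.J False (a + b) (S.J True b \<phi>))"
    using s[OF w, of True b] s[OF wt1[where i = True and m = b, OF w], of False "a + b"]
      s[OF wt1[where i = False and m = "a + b", OF wt1[where i = True and m = b, OF w]], of True a]
    by (simp add: \<beta>_def l algebra_simps)
  have "(qf a * (qf (a + b) * qf b)) *x S.J False b (S.J True (a + b) (S.J False a \<phi>)) =
    (qf a * (qf (a + b) * qf b)) *x S.J True a (S.J False (a + b) (S.J True b \<phi>))"
    using dl_verma[where p = p and \<beta> = \<beta> and a = a and b = b and \<phi> = \<phi>] unfolding L R by (simp add: mult_ac)
  then show ?thesis by (simp add: X.scale_cancel_left)
qed

lemma f_verma: "(fX False ^^ b) ((fX True ^^ (a + b)) ((fX False ^^ a) \<phi>)) = (fX True ^^ a) ((fX False ^^ (a + b)) ((fX True ^^ b) \<phi>))"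
proof -
  interpret V: serre_pair q sX "fX False" "fX True"
  proof (intro serre_pair.intro serre_pair_axioms.intro)
    show "quantum_parameter q" "complex_vector_space sX" by unfold_locales
    show "Vector_Spaces.linear sX sX (fX False)" "Vector_Spaces.linear sX sX (fX True)" by (rule linear_ops)+
  qed (use f_serre[of False] f_serre[of True] in simp_all)
  show ?thesis by (rule V.verma_identity)
qed

end

context quantum_parameter
begin

lemma powi_diff_eq_0: "q powi x - q powi y = 0 \<longleftrightarrow> x = y"
  by (simp add: powi_eq_iff)

end

context borel_module
begin

section \<open>Relations at integral points\<close>

text \<open>The genericity condition of \<open>singular_vector_exists\<close> for the weight \<open>(h1 + h2, h2, 0)\<close>, whose simple coroots
  take the values \<open>h1\<close> and \<open>h2\<close>.\<close>

definition generic :: "nat \<Rightarrow> nat \<Rightarrow> nat \<Rightarrow> bool" where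
  "generic L h1 h2 \<longleftrightarrow> (\<forall>b c. 0 < b + c \<longrightarrow> b + c \<le> L \<longrightarrow>
     casimir_value (int (h1 + h2) + int b) (int h2 - int b + int c) (- int c) \<noteq> casimir_value (int (h1 + h2)) (int h2) 0)"

text \<open>For fixed \<open>(b, c)\<close> the condition is linear in $q^{2 h_1}$ if \<open>b > 0\<close>. If \<open>b = 0\<close> it does not involve \<open>h1\<close> and holds because
  the two factors of the difference are nonzero for \<open>h2 \<ge> 0\<close>.\<close>

lemma finite_nongeneric: "finite {h1. \<not> generic L h1 h2}"
proof -
  define bad where "bad b c = {h1::nat. casimir_value (int (h1 + h2) + int b) (int h2 - int b + int c) (- int c) = casimir_value (int (h1 + h2)) (int h2) 0}" for b c
  have fin: "finite (bad b c)" if "0 < b + c" for b c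
  proof (cases "b = 0")
    case True
    then have c: "c > 0" using that by simp
    have "casimir_value (int (h1 + h2)) (int h2 + int c) (- int c) - casimir_value (int (h1 + h2)) (int h2) 0 =
      (q powi (2 * int c) - q powi 0) * (q powi (2 * int h2) - q powi (- 2 - 2 * int c))" for h1
      by (simp add: casimir_value_def powi_mult algebra_simps int_norm)
    moreover have "(q powi (2 * int c) - q powi 0) * (q powi (2 * int h2) - q powi (- 2 - 2 * int c)) \<noteq> 0"
      unfolding mult_eq_0_iff powi_diff_eq_0 using c by simp
    ultimately have "casimir_value (int (h1 + h2)) (int h2 + int c) (- int c) - casimir_value (int (h1 + h2)) (int h2) 0 \<noteq> 0" for h1 by metis
    then have "bad b c = {}" unfolding bad_def True by simp
    then show ?thesis by simp
  next
    case False
    have "x = y" if "x \<in> bad b c" "y \<in> bad b c" for x y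
    proof -
      define C where "C = q powi (2 * (int h2 - int b + int c)) + q powi (2 * (- int c) - 2) - q powi (2 * int h2) - q powi (2 * 0 - 2)"
      have *: "q powi (2 * int (z + h2) + 2) * (q powi (2 * int b) - q powi 0) + C = 0" if "z \<in> bad b c" for z
        using that by (simp add: bad_def casimir_value_def C_def powi_mult algebra_simps)
      have "q powi (2 * int (x + h2) + 2) * (q powi (2 * int b) - q powi 0) = q powi (2 * int (y + h2) + 2) * (q powi (2 * int b) - q powi 0)"
        using *[OF \<open>x \<in> bad b c\<close>] *[OF \<open>y \<in> bad b c\<close>] by (metis add_right_cancel)
      moreover have "q powi (2 * int b) - q powi 0 \<noteq> 0" unfolding powi_diff_eq_0 using False by simp
      ultimately have "q powi (2 * int (x + h2) + 2) = q powi (2 * int (y + h2) + 2)"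
        using mult_right_cancel by blast
      then have "2 * int (x + h2) + 2 = 2 * int (y + h2) + 2" by (rule powi_eq_iff[THEN iffD1])
      then show ?thesis by simp
    qed
    note unique = this
    show ?thesis
    proof (cases "bad b c = {}")
      case True then show ?thesis by simp
    next
      case False
      then obtain x where "x \<in> bad b c" by (meson ex_in_conv)
      then have "bad b c \<subseteq> {x}" using unique[of _ x] by (intro subsetI) simp
      then show ?thesis by (rule finite_subset) simp
    qed
  qed
  have "{h1. \<not> generic L h1 h2} \<subseteq> (\<Union>b\<in>{..L}. \<Union>c\<in>{c. c \<le> L \<and> 0 < b + c}. bad b c)"
  proof
    fix h1 assume "h1 \<in> {h1. \<not> generic L h1 h2}"
    then have "\<exists>b c. 0 < b + c \<and> b + c \<le> L \<and> h1 \<in> bad b c"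
      by (simp only: mem_Collect_eq generic_def bad_def not_all not_imp not_not)
    then obtain b c where bc: "0 < b + c" "b + c \<le> L" "h1 \<in> bad b c" by (elim exE conjE)
    then have "b \<in> {..L}" "c \<in> {c. c \<le> L \<and> 0 < b + c}" by simp_all
    then show "h1 \<in> (\<Union>b\<in>{..L}. \<Union>c\<in>{c. c \<le> L \<and> 0 < b + c}. bad b c)" using bc(3) by (intro UN_I)
  qed
  moreover have "finite (\<Union>b\<in>{..L}. \<Union>c\<in>{c. c \<le> L \<and> 0 < b + c}. bad b c)"
    by (intro finite_UN_I fin) (simp_all add: finite_subset[OF _ finite_atMost[of L]] subset_eq)
  ultimately show ?thesis by (rule finite_subset)
qed

end

context step_module
begin

lemma string_coeff_0_lookup: "string_coeff 0 w = Poly_Mapping.lookup w (0, 0, 0)"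
  by (simp add: string_coeff_def)

end

context bounded_borel_module
begin

lemma generic_singular_vector:
  assumes u: "wt (\<lambda>j. int (n j) - int (N j)) u" and n: "\<And>j. n j \<ge> 1"
    and "generic (4 * D + 2) (n False - 1) (n True - 1)"
  shows "\<exists>w. wtX (\<lambda>j. int (N j) - 1) (\<lambda>j. int (n j) - 1) w \<and> (\<forall>j. eX (\<lambda>j. int (N j) - 1) j w = 0) \<and>
    Poly_Mapping.lookup w (0, 0, 0) = u"
proof -
  define l1 where "l1 = int (n False - 1 + (n True - 1))"
  define l2 where "l2 = int (n True - 1)"
  have g: "gl3_weight l1 l2 0 = (\<lambda>j. int (n j) - 1)"
  proof (rule ext)
    fix j show "gl3_weight l1 l2 0 j = int (n j) - 1" using n[of j] n[of False] n[of True] by (cases j) (simp_all add: gl3_weight_def l1_def l2_def)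
  qed
  have "wt (\<lambda>j. gl3_weight l1 l2 0 j - (int (N j) - 1)) u" unfolding g using u by simp
  moreover have "casimir_value (l1 + int b) (l2 - int b + int c) (0 - int c) \<noteq> casimir_value l1 l2 0" if "0 < b + c" "b + c \<le> 4 * D + 2" for b c
    unfolding l1_def l2_def diff_0 by (rule assms(3)[unfolded generic_def, rule_format, OF that])
  ultimately have "\<exists>w. wtX (\<lambda>j. int (N j) - 1) (gl3_weight l1 l2 0) w \<and> (\<forall>i. eX (\<lambda>j. int (N j) - 1) i w = 0) \<and> Poly_Mapping.lookup w (0, 0, 0) = u"
    by (rule singular_vector_exists)
  then show ?thesis unfolding g .
qed

end

context step_module
begin

text \<open>At the other node the weight of the singular vector is set to \<open>n0\<close>, and \<open>p\<close> is adjusted to the weight of \<open>u\<close>.\<close>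

theorem unitarity_integral:
  assumes u: "wt h u" and hi: "h i = int n - int N" and large: "D < N" "D < n" "\<bar>int n - int N\<bar> \<le> int D" and R: "D \<le> R"
    and gen: "generic (4 * D + 2) (if i then n0 else n - 1) (if i then n - 1 else n0)" and n0: "int n0 \<ge> h (\<not> i)"
  shows "step_op_inv N n R (step_op N n R u) = u"
proof -
  define N' where "N' j = (if j = i then N else nat (int n0 + 1 - h (\<not> i)))" for j
  define n' where "n' j = (if j = i then n else n0 + 1)" for j
  have "wt (\<lambda>j. int (n' j) - int (N' j)) u"
  proof (rule wt_eq[OF u])
    fix j show "h j = int (n' j) - int (N' j)" using hi n0 by (cases "j = i") (auto simp: n'_def N'_def)
  qed
  moreover have "n' j \<ge> 1" for j using large by (auto simp: n'_def)
  moreover have "generic (4 * D + 2) (n' False - 1) (n' True - 1)" using gen by (cases i) (auto simp: n'_def)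
  ultimately have "\<exists>w. wtX (\<lambda>j. int (N' j) - 1) (\<lambda>j. int (n' j) - 1) w \<and> (\<forall>j. eX (\<lambda>j. int (N' j) - 1) j w = 0) \<and>
    Poly_Mapping.lookup w (0, 0, 0) = u" by (rule generic_singular_vector)
  then obtain w where w: "wtX (\<lambda>j. int (N' j) - 1) (\<lambda>j. int (n' j) - 1) w" "\<And>j. eX (\<lambda>j. int (N' j) - 1) j w = 0"
    "Poly_Mapping.lookup w (0, 0, 0) = u" by blast
  then have sw: "singular (\<lambda>j. int (N' j) - 1) (\<lambda>j. int (n' j) - 1) w" by (simp add: singular_def)
  have e: "int N = (int (N' i) - 1) + 1" "int n = (int (n' i) - 1) + 1" "N \<ge> 1" "n \<ge> 1" using large by (auto simp: N'_def n'_def)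
  from step[OF sw e(1) e(3) e(2) e(4) R] obtain w' where w': "J N w' = ifac (int n) *x (fX i ^^ n) w"
    "singular (shifted N (\<lambda>j. int (N' j) - 1)) (\<lambda>j. int (n' j) - 1 - int n * cart j i) w'" "string_coeff 0 w' = step_op N n R (string_coeff 0 w)" by blast
  have "string_coeff 0 w = step_op_inv N n R (step_op N n R (string_coeff 0 w))" using step_inverse[OF w'(1,2) e(1,2) large R] unfolding w'(3) .
  then show ?thesis unfolding string_coeff_0_lookup w(3) by (rule sym)
qed

end

context sl3_module
begin

text \<open>Each word of lowering operators, applied to the singular vector over \<open>u\<close>, equals a composite of intertwiners applied to the singular
  vector reached after three steps.\<close>

theorem braid_integral:
  assumes u: "wt (\<lambda>j. int (n j) - int (N j)) u" and n: "\<And>j. n j \<ge> 1" and N: "\<And>j. N j \<ge> 1" and R: "D \<le> R"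
    and gen: "generic (4 * D + 2) (n False - 1) (n True - 1)"
  shows "S.step_op False (N True) (n True) R (S.step_op True (N False + N True) (n False + n True) R (S.step_op False (N False) (n False) R u)) =
    S.step_op True (N False) (n False) R (S.step_op False (N False + N True) (n False + n True) R (S.step_op True (N True) (n True) R u))"
proof -
  define p where "p j = int (N j) - 1" for j
  define h where "h j = int (n j) - 1" for j
  obtain w where w: "wtX p h w" "\<And>j. eX p j w = 0" "Poly_Mapping.lookup w (0, 0, 0) = u"
    using generic_singular_vector[OF u n gen] unfolding p_def[abs_def] h_def[abs_def] by blast
  \<comment> \<open>Three steps along the word starting at the node \<open>i\<close>; used for both values of \<open>i\<close>.\<close>
  have chain: "\<exists>w1 w2 w3 p3 h3. wtX p3 h3 w3 \<and>
      S.J i (N i) (S.J o' (N i + N o') (S.J i (N o') w3)) =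
        (ifac (int (n i)) * ifac (int (n i + n o')) * ifac (int (n o'))) *x (fX i ^^ n o') ((fX o' ^^ (n i + n o')) ((fX i ^^ n i) w)) \<and>
      Poly_Mapping.lookup w3 (0, 0, 0) = S.step_op i (N o') (n o') R (S.step_op o' (N i + N o') (n i + n o') R (S.step_op i (N i) (n i) R u))"
    if o': "o' = (\<not> i)" for i o'
  proof -
    have c: "cart i i = 2" "cart o' o' = 2" "cart i o' = -1" "cart o' i = -1" by (simp_all add: o')
    have "S.singular p h w" using w by (simp add: S.singular_def)
    from S.step[where i = i, OF this, of "N i" "n i", OF _ N _ n R]
    obtain w1 where 1: "S.J i (N i) w1 = ifac (int (n i)) *x (fX i ^^ n i) w"
      "S.singular (S.shifted i (N i) p) (\<lambda>j. h j - int (n i) * cart j i) w1" "S.string_coeff i 0 w1 = S.step_op i (N i) (n i) R (S.string_coeff i 0 w)"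
      by (auto simp: p_def h_def)
    have "int (N i + N o') = S.shifted i (N i) p o' + 1" "int (n i + n o') = (h o' - int (n i) * cart o' i) + 1"
      "N i + N o' \<ge> 1" "n i + n o' \<ge> 1"
      using N[of i] n[of i] by (simp_all add: S.shifted_def c p_def h_def)
    from S.step[where i = o', OF 1(2) this(1,3,2,4) R]
    obtain w2 where 2: "S.J o' (N i + N o') w2 = ifac (int (n i + n o')) *x (fX o' ^^ (n i + n o')) w1"
      "S.singular (S.shifted o' (N i + N o') (S.shifted i (N i) p)) (\<lambda>j. h j - int (n i) * cart j i - int (n i + n o') * cart j o') w2"
      "S.string_coeff o' 0 w2 = S.step_op o' (N i + N o') (n i + n o') R (S.string_coeff o' 0 w1)" by blast
    have "int (N o') = S.shifted o' (N i + N o') (S.shifted i (N i) p) i + 1"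
      "int (n o') = (h i - int (n i) * cart i i - int (n i + n o') * cart i o') + 1"
      by (simp_all add: S.shifted_def c p_def h_def)
    from S.step[where i = i, OF 2(2) this(1) N this(2) n R]
    obtain w3 p3 h3 where 3: "S.J i (N o') w3 = ifac (int (n o')) *x (fX i ^^ n o') w2"
      "S.singular p3 h3 w3" "S.string_coeff i 0 w3 = S.step_op i (N o') (n o') R (S.string_coeff i 0 w2)" by blast
    have "S.J i (N i) (S.J o' (N i + N o') (S.J i (N o') w3)) =
        (ifac (int (n i)) * ifac (int (n i + n o')) * ifac (int (n o'))) *x (fX i ^^ n o') ((fX o' ^^ (n i + n o')) ((fX i ^^ n i) w))"
      by (simp add: 3(1) 2(1) 1(1) S.linJ S.linfpow S.J_fpow[symmetric] mult_ac)
    moreover have "wtX p3 h3 w3" using 3(2) by (simp add: S.singular_def)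
    moreover have "Poly_Mapping.lookup w3 (0, 0, 0) = S.step_op i (N o') (n o') R (S.step_op o' (N i + N o') (n i + n o') R (S.step_op i (N i) (n i) R u))"
      using 1(3) 2(3) 3(3) w(3) by (simp add: S.string_coeff_0_lookup)
    ultimately show ?thesis by blast
  qed
  from chain[of True False] obtain w3 p3 h3 where 1: "wtX p3 h3 w3"
    "S.J False (N False) (S.J True (N False + N True) (S.J False (N True) w3)) =
        (ifac (int (n False)) * ifac (int (n False + n True)) * ifac (int (n True))) *x (fX False ^^ n True) ((fX True ^^ (n False + n True)) ((fX False ^^ n False) w))"
    "Poly_Mapping.lookup w3 (0, 0, 0) = S.step_op False (N True) (n True) R (S.step_op True (N False + N True) (n False + n True) R (S.step_op False (N False) (n False) R u))"
    by auto
  from chain[of False True] obtain v3 where 2: 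
    "S.J True (N True) (S.J False (N False + N True) (S.J True (N False) v3)) =
        (ifac (int (n False)) * ifac (int (n False + n True)) * ifac (int (n True))) *x (fX True ^^ n False) ((fX False ^^ (n False + n True)) ((fX True ^^ n True) w))"
    "Poly_Mapping.lookup v3 (0, 0, 0) = S.step_op True (N False) (n False) R (S.step_op False (N False + N True) (n False + n True) R (S.step_op True (N True) (n True) R u))"
    by (auto simp: add.commute mult_ac)
  have "S.J False (N False) (S.J True (N False + N True) (S.J False (N True) w3)) = S.J True (N True) (S.J False (N False + N True) (S.J True (N False) v3))"
    unfolding 1(2) 2(1) f_verma ..
  moreover have "S.J False (N False) (S.J True (N False + N True) (S.J False (N True) w3)) = S.J True (N True) (S.J False (N False + N True) (S.J True (N False) w3))"
    using J_braid[OF 1(1), of "N False" "N True"] by (simp add: add.commute)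
  ultimately have "w3 = v3" by (metis S.J_inj)
  then show ?thesis using 1(3) 2(2) by simp
qed

end

section \<open>Vector-valued polynomial functions\<close>

inductive_set polyfun :: "(complex \<Rightarrow> 'v::ab_group_add \<Rightarrow> 'v) \<Rightarrow> ((nat \<Rightarrow> complex) \<Rightarrow> 'v) set" for s where
  const: "(\<lambda>z. c) \<in> polyfun s"
| add: "f \<in> polyfun s \<Longrightarrow> g \<in> polyfun s \<Longrightarrow> (\<lambda>z. f z + g z) \<in> polyfun s"
| var: "f \<in> polyfun s \<Longrightarrow> (\<lambda>z. s (z k) (f z)) \<in> polyfun s"

context complex_vector_space
begin

lemma coordinate_separates:
  assumes "\<And>\<phi>. (\<And>x y. \<phi> (x + y) = \<phi> x + \<phi> y) \<Longrightarrow> (\<And>c x. \<phi> (s c x) = c * \<phi> x) \<Longrightarrow> \<phi> v = 0"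
  shows "v = 0"
proof -
  define B where "B = extend_basis {}"
  have B: "independent B" "v \<in> span B" for v unfolding B_def
    using independent_extend_basis[OF independent_empty] span_extend_basis[OF independent_empty] by simp_all
  have "representation B v b = 0" for b
    by (rule assms) (simp_all add: representation_add representation_scale B)
  then show ?thesis using sum_nonzero_representation_eq[OF B(1) B(2)[of v]] by simp
qed

lemma polyfun_linear:
  assumes "f \<in> polyfun s" "Vector_Spaces.linear s s L"
  shows "(\<lambda>z. L (f z)) \<in> polyfun s"
  using assms(1)
  by induction (auto simp: linear_add[OF assms(2)] linear_scale[OF assms(2)] intro: polyfun.intros)

lemma polyfun_sum: "(\<And>j. j \<in> A \<Longrightarrow> f j \<in> polyfun s) \<Longrightarrow> (\<lambda>z. \<Sum>j\<in>A. f j z) \<in> polyfun s"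
  by (induction A rule: infinite_finite_induct) (auto intro: polyfun.intros)

lemma polyfun_refl:
  assumes "f \<in> polyfun s" shows "(\<lambda>z. f (refl_act i z)) \<in> polyfun s"
  using assms by induction (auto simp: refl_act_def intro: polyfun.intros)

lemma polyfun_const_scale: "f \<in> polyfun s \<Longrightarrow> (\<lambda>z. s c (f z)) \<in> polyfun s"
  by (rule polyfun_linear) (auto intro!: linearI simp: scale_right_distrib mult.commute)

definition multiplier :: "((nat \<Rightarrow> complex) \<Rightarrow> complex) \<Rightarrow> bool" where
  "multiplier g \<longleftrightarrow> (\<forall>f\<in>polyfun s. (\<lambda>z. s (g z) (f z)) \<in> polyfun s)"

lemma multiplierD: "multiplier g \<Longrightarrow> f \<in> polyfun s \<Longrightarrow> (\<lambda>z. s (g z) (f z)) \<in> polyfun s"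
  by (simp add: multiplier_def)

lemma multiplier_const: "multiplier (\<lambda>z. c)"
  by (simp add: multiplier_def polyfun_const_scale)

lemma multiplier_linear: "multiplier (\<lambda>z. z k - c * z l)"
proof -
  have "(\<lambda>z. s (z k) (f z) + s (- c) (s (z l) (f z))) \<in> polyfun s" if "f \<in> polyfun s" for f
    using that by (intro polyfun.add polyfun.var polyfun_const_scale)
  then show ?thesis by (simp add: multiplier_def scale_left_diff_distrib)
qed

lemma multiplier_mult: "multiplier g \<Longrightarrow> multiplier h \<Longrightarrow> multiplier (\<lambda>z. g z * h z)"
  unfolding multiplier_def by (simp flip: scale_scale)

lemma multiplier_prod: "(\<And>j. j \<in> A \<Longrightarrow> multiplier (g j)) \<Longrightarrow> multiplier (\<lambda>z. \<Prod>j\<in>A. g j z)"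
  by (induction A rule: infinite_finite_induct) (simp_all add: multiplier_const multiplier_mult)

lemma multiplier_refl: "multiplier g \<Longrightarrow> multiplier (\<lambda>z. g (refl_act i z))"
proof -
  assume g: "multiplier g"
  have rr: "refl_act i (refl_act i z) = z" for z :: "nat \<Rightarrow> complex" by (simp add: refl_act_def comp_assoc)
  have "(\<lambda>z. s (g (refl_act i z)) (f z)) \<in> polyfun s" if f: "f \<in> polyfun s" for f
  proof -
    have "(\<lambda>z. s (g z) (f (refl_act i z))) \<in> polyfun s"
      using g polyfun_refl[OF f] by (simp add: multiplier_def)
    from polyfun_refl[OF this, of i] show ?thesis by (simp add: rr)
  qed
  then show ?thesis by (simp add: multiplier_def)
qed

lemma polyfun_restrict:
  assumes f: "f \<in> polyfun s" and \<phi>: "\<And>x y. \<phi> (x + y) = \<phi> x + \<phi> y" "\<And>c x. \<phi> (s c x) = c * \<phi> x"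
  shows "\<exists>p. \<forall>x. \<phi> (f (z(k := x))) = poly p x"
  using f
proof induction
  case (const c) show ?case by (rule exI[of _ "[:\<phi> c:]"]) simp
next
  case (add f g)
  then obtain p p' where "\<forall>x. \<phi> (f (z(k := x))) = poly p x" "\<forall>x. \<phi> (g (z(k := x))) = poly p' x" by blast
  then show ?case by (intro exI[of _ "p + p'"]) (simp add: \<phi> del: fun_upd_apply)
next
  case (var f l)
  then obtain p where "\<forall>x. \<phi> (f (z(k := x))) = poly p x" by blast
  then have "\<phi> (s ((z(k := x)) l) (f (z(k := x)))) = poly (if l = k then [:0, 1:] * p else smult (z l) p) x" for x
    by (cases "l = k") (simp_all add: \<phi>(2) del: fun_upd_apply, simp_all)
  then show ?case by blast
qed

text \<open>Restricted to a line and composed with a linear functional, \<open>f\<close> is a polynomial in one variable with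
  infinitely many zeros.\<close>

lemma polyfun_vanish:
  assumes f: "f \<in> polyfun s" and S: "infinite S" "\<And>x. x \<in> S \<Longrightarrow> f (z(k := x)) = 0"
  shows "f z = 0"
proof (rule coordinate_separates)
  fix \<phi> :: "'x \<Rightarrow> complex"
  assume \<phi>: "\<And>x y. \<phi> (x + y) = \<phi> x + \<phi> y" "\<And>c x. \<phi> (s c x) = c * \<phi> x"
  obtain p where p: "\<forall>x. \<phi> (f (z(k := x))) = poly p x" using polyfun_restrict[OF f \<phi>] by blast
  have "\<phi> 0 = 0" using \<phi>(2)[of 0 0] by simp
  then have "S \<subseteq> {x. poly p x = 0}" using S(2) p by (metis (mono_tags) mem_Collect_eq subsetI)
  then have "p = 0" using S(1) poly_roots_finite finite_subset by blast
  then show "\<phi> (f z) = 0" using p[rule_format, of "z k"] by simp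
qed

lemma polyfun_vanish_ratio:
  assumes f: "f \<in> polyfun s" and S: "infinite S" "\<And>\<zeta>. \<zeta> \<in> S \<Longrightarrow> f (z(i := \<zeta> * c)) = 0" and "c \<noteq> 0"
  shows "f z = 0"
proof (rule polyfun_vanish[OF f])
  show "infinite ((\<lambda>\<zeta>. \<zeta> * c) ` S)" using S(1) \<open>c \<noteq> 0\<close> by (simp add: finite_image_iff inj_on_def)
qed (use S(2) in auto)

lemma polyfun_vanish_nonzero:
  assumes f: "f \<in> polyfun s" and z: "\<And>z. z k \<noteq> 0 \<Longrightarrow> f z = 0"
  shows "f z = 0"
proof (rule polyfun_vanish[OF f, of "- {0}" z k])
  show "infinite (- {0 :: complex})" by (simp add: infinite_UNIV_char_0)
qed (use z in auto)

end

section \<open>Step operators as values of the rational operators\<close>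

text \<open>The sum defining $A_{i,\mu}(z)$ for \<open>x = z\<^sub>i\<close> and \<open>y = z\<^sub>i\<^sub>+\<^sub>1\<close>, truncated after the index \<open>R\<close>.\<close>

definition A_sum :: "complex \<Rightarrow> (complex \<Rightarrow> 'v \<Rightarrow> 'v) \<Rightarrow> ('v \<Rightarrow> 'v) \<Rightarrow> ('v \<Rightarrow> 'v::ab_group_add) \<Rightarrow> nat \<Rightarrow> nat \<Rightarrow> nat \<Rightarrow> complex \<Rightarrow> complex \<Rightarrow> 'v \<Rightarrow> 'v" where
  "A_sum q s X Y a b R x y u = (\<Sum>j\<le>R. s ((- q) ^ j * ((y - q ^ (a + b) * x) / (y - q ^ (2 * j + (a + b)) * x)) * (1 / qfact q (j + a)) * (1 / qfact q (j + b)))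
    ((X ^^ (j + a)) ((Y ^^ (j + b)) u)))"

context quantum_parameter
begin

lemma qnum_ratio: "qn x / qn (x + y) = q powi y * ((1 - q powi (2 * x)) / (1 - q powi (2 * (x + y))))"
proof -
  have 1: "qn z = - qscale * q powi (- z) * (1 - q powi (2 * z))" for z
    by (simp add: qnum_alt powi_mult algebra_simps)
  have 2: "q powi (- x) = q powi y * q powi (- (x + y))" by (simp add: powi_mult)
  show ?thesis unfolding 1[of x] 1[of "x + y"] 2 by simp
qed

text \<open>The rational coefficient becomes a quotient of \<open>q\<close>-numbers when the ratio of the variables is the power \<open>e\<close> of \<open>q\<close>.\<close>

lemma A_ratio:
  assumes "z \<noteq> 0" "int d + e = 2 * x"
  shows "(- 1) ^ j * (qn x / qn (x + int j)) = (- q) ^ j * ((z - q ^ d * (q powi e * z)) / (z - q ^ (2 * j + d) * (q powi e * z)))"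
proof -
  have 1: "z - q ^ d * (q powi e * z) = z * (1 - q powi (2 * x))"
    using assms(2) by (simp add: pow_powi powi_mult_left powi_mult algebra_simps flip: assms(2))
  have "q ^ (2 * j + d) * q powi e = q powi (2 * (x + int j))"
  proof -
    have "2 * (x + int j) = int (2 * j + d) + e" using assms(2) by simp
    then show ?thesis by (simp add: pow_powi powi_mult add_ac)
  qed
  then have 2: "z - q ^ (2 * j + d) * (q powi e * z) = z * (1 - q powi (2 * (x + int j)))"
    by (simp add: algebra_simps)
  show ?thesis unfolding 1 2 qnum_ratio using assms(1) by (simp add: pow_powi power_minus[of q])
qed

text \<open>The factor between the step operator and the value of the rational operator.\<close>

definition step_scalar :: "nat \<Rightarrow> nat \<Rightarrow> complex" where
  "step_scalar N n = (if N \<le> n then qn (int N) / qn (int n) else (- 1) ^ (N - n))"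

lemma step_scalar_nonzero: "N \<ge> 1 \<Longrightarrow> n \<ge> 1 \<Longrightarrow> step_scalar N n \<noteq> 0"
  by (simp add: step_scalar_def)

end

context step_module
begin

lemma step_op_A_sum:
  assumes N: "N \<ge> 1" "n \<ge> 1" and "y \<noteq> 0" and x: "x = q powi (int n + int N) * y"
  shows "step_op N n R u = step_scalar N n *s A_sum q s F (E i) (nat (int n - int N)) (nat (int N - int n)) R x y u"
proof -
  define a b where "a = nat (int n - int N)" and "b = nat (int N - int n)"
  have c: "(- 1) ^ (j + b) * (qn (int N) / qn (int (n + j + b))) =
    step_scalar N n * ((- q) ^ j * ((y - q ^ (a + b) * x) / (y - q ^ (2 * j + (a + b)) * x)))" for j
  proof (cases "N \<le> n")
    case True
    then have b: "b = 0" and a: "int a = int n - int N" by (simp_all add: a_def b_def)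
    have "(- 1) ^ j * (qn (int n) / qn (int n + int j)) = (- q) ^ j * ((y - q ^ a * x) / (y - q ^ (2 * j + a) * x))"
      unfolding x by (rule A_ratio[OF \<open>y \<noteq> 0\<close>]) (simp add: a)
    moreover have "(- 1) ^ j * (qn (int N) / qn (int n + int j)) = qn (int N) / qn (int n) * ((- 1) ^ j * (qn (int n) / qn (int n + int j)))"
      using N by simp
    ultimately have "(- 1) ^ j * (qn (int N) / qn (int n + int j)) = qn (int N) / qn (int n) * ((- q) ^ j * ((y - q ^ a * x) / (y - q ^ (2 * j + a) * x)))"
      by simp
    then show ?thesis using True unfolding b by (simp add: step_scalar_def)
  next
    case False
    then have a: "a = 0" and b: "int b = int N - int n" and b': "b = N - n" by (simp_all add: a_def b_def)
    have "(- 1) ^ j * (qn (int N) / qn (int N + int j)) = (- q) ^ j * ((y - q ^ b * x) / (y - q ^ (2 * j + b) * x))"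
      unfolding x by (rule A_ratio[OF \<open>y \<noteq> 0\<close>]) (simp add: b)
    moreover have e: "int (n + j + b) = int N + int j" using b by simp
    have "(- 1) ^ (j + b) * (qn (int N) / qn (int (n + j + b))) = (- 1) ^ b * ((- 1) ^ j * (qn (int N) / qn (int N + int j)))"
      unfolding e power_add by (simp only: mult_ac)
    moreover have "step_scalar N n = (- 1) ^ b" using False by (simp add: step_scalar_def b')
    ultimately show ?thesis unfolding a add_0 by simp
  qed
  show ?thesis
    unfolding step_op_def Let_def A_sum_def a_def[symmetric] b_def[symmetric] c scale_sum_right scale_scale ifac_of_nat
    by (simp only: mult.assoc)
qed

lemma step_op_inv_A_sum:
  assumes N: "N \<ge> 1" "n \<ge> 1" and "y \<noteq> 0" and x: "x = q powi (int n + int N) * y"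
  shows "step_op_inv N n R u = inverse (step_scalar N n) *s A_sum q s F (E i) (nat (int N - int n)) (nat (int n - int N)) R y x u"
proof -
  define a b where "a = nat (int n - int N)" and "b = nat (int N - int n)"
  have x0: "x \<noteq> 0" and y: "y = q powi (- (int n + int N)) * x" using \<open>y \<noteq> 0\<close> by (simp_all add: x powi_mult_left)
  have c: "(- 1) ^ (j + b) * (qn (int n) / qn (int N - int (j + b))) =
    inverse (step_scalar N n) * ((- q) ^ j * ((x - q ^ (b + a) * y) / (x - q ^ (2 * j + (b + a)) * y)))" for j
  proof (cases "N \<le> n")
    case True
    then have b: "b = 0" and a: "int a = int n - int N" by (simp_all add: a_def b_def)
    have "(- 1) ^ j * (qn (- int N) / qn (- int N + int j)) = (- q) ^ j * ((x - q ^ a * y) / (x - q ^ (2 * j + a) * y))"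
      unfolding y by (rule A_ratio[OF \<open>x \<noteq> 0\<close>]) (simp add: a)
    moreover have "qn (- int N + int j) = - qn (int N - int j)" using qnum_simps(3)[of "int N - int j"] by simp
    then have "(- 1) ^ j * (qn (int n) / qn (int N - int j)) = qn (int n) / qn (int N) * ((- 1) ^ j * (qn (- int N) / qn (- int N + int j)))"
      using N by simp
    ultimately have "(- 1) ^ j * (qn (int n) / qn (int N - int j)) = qn (int n) / qn (int N) * ((- q) ^ j * ((x - q ^ a * y) / (x - q ^ (2 * j + a) * y)))"
      by simp
    then show ?thesis using True unfolding b by (simp add: step_scalar_def)
  next
    case False
    then have a: "a = 0" and b: "int b = int N - int n" and b': "b = N - n" by (simp_all add: a_def b_def)
    have "(- 1) ^ j * (qn (- int n) / qn (- int n + int j)) = (- q) ^ j * ((x - q ^ b * y) / (x - q ^ (2 * j + b) * y))"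
      unfolding y by (rule A_ratio[OF \<open>x \<noteq> 0\<close>]) (simp add: b)
    moreover have e: "qn (- int n + int j) = - qn (int N - int (j + b))" using qnum_simps(3)[of "int N - int (j + b)"] b by simp
    have "(- 1) ^ (j + b) * (qn (int n) / qn (int N - int (j + b))) = (- 1) ^ b * ((- 1) ^ j * (qn (- int n) / qn (- int n + int j)))"
      unfolding e power_add by simp
    moreover have "inverse (step_scalar N n) = (- 1) ^ b" using False by (simp add: step_scalar_def b' flip: power_inverse)
    ultimately show ?thesis unfolding a add_0_right by simp
  qed
  show ?thesis
    unfolding step_op_inv_def Let_def A_sum_def a_def[symmetric] b_def[symmetric] c scale_sum_right scale_scale ifac_of_nat
    by (simp only: mult.assoc)
qed

lemma step_op_inv_scale: "step_op_inv N n R (c *s u) = c *s step_op_inv N n R u"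
  unfolding step_op_inv_def Let_def by (simp add: linF linEpow scale_sum_right mult_ac)

end

section \<open>Weights of a finite dimensional module\<close>

locale gl_module = uq_gl_module M q U + quantum_parameter q + complex_vector_space "smul U"
  for M :: nat and q :: complex and U :: "'v::ab_group_add uq_rep" +
  assumes finite_dimensional: "\<exists>B. finite_dimensional_vector_space (smul U) B"
    and type_I: "type_I M q U"
begin

abbreviation W :: "(nat \<Rightarrow> int) \<Rightarrow> 'v set" where "W mu \<equiv> weight_space M q U mu"

lemma root_lattice: "i \<in> {1..<M} \<Longrightarrow> simple_root i \<in> lattice M"
  by (auto simp: lattice_def simple_root_def)

lemma lattice_minus: "lam \<in> lattice M \<Longrightarrow> (\<lambda>k. - lam k) \<in> lattice M"
  by (auto simp: lattice_def)

lemma lattice_refl: "i \<in> {1..<M} \<Longrightarrow> mu \<in> lattice M \<Longrightarrow> refl_act i mu \<in> lattice M"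
  by (auto simp: lattice_def refl_act_def transpose_def)

lemma pairing_commute: "pairing M lam mu = pairing M mu lam"
  by (simp add: pairing_def mult.commute)

lemma pairing_root:
  assumes "i \<in> {1..<M}" shows "pairing M lam (simple_root i) = lam i - lam (Suc i)"
proof -
  have "pairing M lam (simple_root i) = (\<Sum>k\<in>{1..M}. (if k = i then lam k else 0)) - (\<Sum>k\<in>{1..M}. if k = Suc i then lam k else 0)"
    unfolding pairing_def sum_subtractf[symmetric] by (rule sum.cong[OF refl]) (auto simp: simple_root_def)
  then show ?thesis using assms by simp
qed

lemma pairing_add: "pairing M (\<lambda>k. lam k + c * mu k) nu = pairing M lam nu + c * pairing M mu nu"
  by (simp add: pairing_def sum.distrib sum_distrib_left algebra_simps)

lemma pairing_minus: "pairing M (\<lambda>k. - lam k) nu = - pairing M lam nu"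
  by (simp add: pairing_def sum_negf)

lemma t_minus:
  assumes "lam \<in> lattice M"
  shows "opt U (\<lambda>k. - lam k) (opt U lam v) = v" "opt U lam (opt U (\<lambda>k. - lam k) v) = v"
  using t_add[OF lattice_minus[OF assms] assms, of v] t_add[OF assms lattice_minus[OF assms], of v] t_zero[of v] by simp_all

lemma t_E': "lam \<in> lattice M \<Longrightarrow> i \<in> {1..<M} \<Longrightarrow> opt U lam (opE U i v) = smul U (q powi (lam i - lam (Suc i))) (opE U i (opt U lam v))"
  using t_E[of lam i "opt U lam v"] by (simp add: t_minus pairing_root)

lemma t_F': "lam \<in> lattice M \<Longrightarrow> i \<in> {1..<M} \<Longrightarrow> opt U lam (opF U i v) = smul U (q powi (lam (Suc i) - lam i)) (opF U i (opt U lam v))"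
  using t_F[of lam i "opt U lam v"] by (simp add: t_minus pairing_root)

lemma W_closed: "0 \<in> W mu" "x \<in> W mu \<Longrightarrow> y \<in> W mu \<Longrightarrow> x + y \<in> W mu" "x \<in> W mu \<Longrightarrow> smul U c x \<in> W mu"
  unfolding weight_space_def using linear_t
  by (auto simp: linear_zero linear_add linear_scale scale_right_distrib mult.commute)

lemma W_sum: "(\<And>a. a \<in> A \<Longrightarrow> f a \<in> W mu) \<Longrightarrow> sum f A \<in> W mu"
  by (induction A rule: infinite_finite_induct) (auto intro: W_closed)

lemma W_E: "i \<in> {1..<M} \<Longrightarrow> v \<in> W mu \<Longrightarrow> opE U i v \<in> W (\<lambda>k. mu k + 1 * simple_root i k)"
  unfolding weight_space_def mem_Collect_eq pairing_add
  by (auto simp: t_E' linear_scale[OF linear_E] powi_mult pairing_commute[of "simple_root i"] pairing_root add_ac)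

lemma W_F: "i \<in> {1..<M} \<Longrightarrow> v \<in> W mu \<Longrightarrow> opF U i v \<in> W (\<lambda>k. mu k + (-1) * simple_root i k)"
  unfolding weight_space_def mem_Collect_eq pairing_add
  by (auto simp: t_F' linear_scale[OF linear_F] powi_mult pairing_commute[of "simple_root i"] pairing_root algebra_simps)

lemma W_Epow: "i \<in> {1..<M} \<Longrightarrow> v \<in> W mu \<Longrightarrow> (opE U i ^^ l) v \<in> W (\<lambda>k. mu k + int l * simple_root i k)"
proof (induction l)
  case (Suc l) then show ?case using W_E[of i "(opE U i ^^ l) v"] by (fastforce simp: algebra_simps)
qed simp

lemma W_Fpow: "i \<in> {1..<M} \<Longrightarrow> v \<in> W mu \<Longrightarrow> (opF U i ^^ l) v \<in> W (\<lambda>k. mu k - int l * simple_root i k)"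
proof (induction l)
  case (Suc l) then show ?case using W_F[of i "(opF U i ^^ l) v"] by (fastforce simp: algebra_simps)
qed simp

lemma A_term_weight:
  assumes i: "i \<in> {1..<M}" and v: "v \<in> W mu"
  shows "A_term q U i mu j v \<in> W (refl_act i mu)"
proof -
  define a b where "a = j + nat (mu (Suc i) - mu i)" and "b = j + nat (mu i - mu (Suc i))"
  have "(\<lambda>k. mu k - int b * simple_root i k + int a * simple_root i k) = refl_act i mu"
    by (rule ext) (auto simp: simple_root_def refl_act_def transpose_def a_def b_def)
  moreover have "divE q U i a (divF q U i b v) \<in> W (\<lambda>k. mu k - int b * simple_root i k + int a * simple_root i k)"
    unfolding divE_def divF_def by (intro W_closed(3) W_Epow[OF i] W_Fpow[OF i] v)
  ultimately show ?thesis by (simp add: A_term_def a_def b_def)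
qed

lemma decomposition_ex1: "\<exists>!f. (\<forall>mu \<in> lattice M. f mu \<in> W mu) \<and> (\<forall>mu. mu \<notin> lattice M \<longrightarrow> f mu = 0) \<and> finite {mu. f mu \<noteq> 0} \<and> v = Sum_any f"
  using type_I unfolding type_I_def by blast

lemma decomposition_unique:
  assumes P: "finite P" "P \<subseteq> lattice M" and f: "\<And>mu. mu \<in> P \<Longrightarrow> f mu \<in> W mu" and g: "\<And>mu. mu \<in> P \<Longrightarrow> g mu \<in> W mu"
    and eq: "sum f P = sum g P" and mu: "mu \<in> P"
  shows "f mu = g mu"
proof -
  define ex where "ex f = (\<lambda>mu. if mu \<in> P then f mu else 0)" for f :: "(nat \<Rightarrow> int) \<Rightarrow> 'v"
  have fin: "finite {mu. ex f mu \<noteq> 0}" for f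
    by (rule finite_subset[OF _ P(1)]) (auto simp: ex_def)
  have S: "Sum_any (ex f) = sum f P" for f
  proof -
    have "Sum_any (ex f) = sum (ex f) P" by (rule Sum_any.expand_superset[OF P(1)]) (auto simp: ex_def)
    then show ?thesis by (simp add: ex_def)
  qed
  define decomposes where "decomposes f \<longleftrightarrow> (\<forall>mu \<in> lattice M. f mu \<in> W mu) \<and> (\<forall>mu. mu \<notin> lattice M \<longrightarrow> f mu = 0) \<and>
    finite {mu. f mu \<noteq> 0} \<and> sum g P = Sum_any f" for f
  have dec: "decomposes (ex e)" if "\<And>mu. mu \<in> P \<Longrightarrow> e mu \<in> W mu" "sum e P = sum g P" for e
    unfolding decomposes_def
  proof (intro conjI ballI allI impI)
    fix mu show "ex e mu \<in> W mu" using that(1)[of mu] by (simp add: ex_def W_closed)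
  next
    fix mu assume "mu \<notin> lattice M" then show "ex e mu = 0" using P(2) by (auto simp: ex_def)
  qed (simp_all add: fin S that(2))
  have "ex f = ex g"
    using decomposition_ex1[of "sum g P"] dec[OF f eq] dec[OF g refl] unfolding decomposes_def by blast
  then show ?thesis using mu unfolding ex_def by metis
qed

text \<open>The weights that occur in the decompositions of the members of a finite basis suffice for all vectors.\<close>

lemma finite_weights: "\<exists>P. finite P \<and> P \<subseteq> lattice M \<and> (\<forall>v. \<exists>f. (\<forall>mu\<in>P. f mu \<in> W mu) \<and> v = sum f P)"
proof -
  obtain B where "finite_dimensional_vector_space (smul U) B" using finite_dimensional by blast
  then interpret fd: finite_dimensional_vector_space "smul U" B .
  have "\<forall>v. \<exists>f. (\<forall>mu \<in> lattice M. f mu \<in> W mu) \<and> (\<forall>mu. mu \<notin> lattice M \<longrightarrow> f mu = 0) \<and> finite {mu. f mu \<noteq> 0} \<and> v = Sum_any f"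
    using decomposition_ex1 by blast
  then obtain d where d: "\<And>v mu. mu \<in> lattice M \<Longrightarrow> d v mu \<in> W mu" "\<And>v mu. mu \<notin> lattice M \<Longrightarrow> d v mu = 0"
    "\<And>v. finite {mu. d v mu \<noteq> 0}" "\<And>v. v = Sum_any (d v)" by metis
  define P where "P = (\<Union>b\<in>B. {mu. d b mu \<noteq> 0})"
  have P: "finite P" "P \<subseteq> lattice M" using fd.finite_Basis d(2,3) by (auto simp: P_def)
  have "\<exists>f. (\<forall>mu\<in>P. f mu \<in> W mu) \<and> v = sum f P" for v
  proof (rule span_induct[where S = B and P = "\<lambda>v. \<exists>f. (\<forall>mu\<in>P. f mu \<in> W mu) \<and> v = sum f P"])
    show "v \<in> span B" by (simp add: fd.span_Basis)
    show "subspace {v. \<exists>f. (\<forall>mu\<in>P. f mu \<in> W mu) \<and> v = sum f P}"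
    proof (rule subspaceI)
      show "0 \<in> {v. \<exists>f. (\<forall>mu\<in>P. f mu \<in> W mu) \<and> v = sum f P}" by (auto intro!: exI[of _ "\<lambda>_. 0"] W_closed)
    next
      fix x y assume "x \<in> {v. \<exists>f. (\<forall>mu\<in>P. f mu \<in> W mu) \<and> v = sum f P}" "y \<in> {v. \<exists>f. (\<forall>mu\<in>P. f mu \<in> W mu) \<and> v = sum f P}"
      then obtain f g where "\<forall>mu\<in>P. f mu \<in> W mu" "x = sum f P" "\<forall>mu\<in>P. g mu \<in> W mu" "y = sum g P" by blast
      then show "x + y \<in> {v. \<exists>f. (\<forall>mu\<in>P. f mu \<in> W mu) \<and> v = sum f P}"
        by (auto intro!: exI[of _ "\<lambda>mu. f mu + g mu"] W_closed simp: sum.distrib)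
    next
      fix c x assume "x \<in> {v. \<exists>f. (\<forall>mu\<in>P. f mu \<in> W mu) \<and> v = sum f P}"
      then obtain f where "\<forall>mu\<in>P. f mu \<in> W mu" "x = sum f P" by blast
      then show "smul U c x \<in> {v. \<exists>f. (\<forall>mu\<in>P. f mu \<in> W mu) \<and> v = sum f P}"
        by (auto intro!: exI[of _ "\<lambda>mu. smul U c (f mu)"] W_closed simp: scale_sum_right)
    qed
  next
    fix b assume b: "b \<in> B"
    have "b = sum (d b) P" using d(4)[of b] Sum_any.expand_superset[OF P(1), of "d b"] b by (auto simp: P_def)
    then show "\<exists>f. (\<forall>mu\<in>P. f mu \<in> W mu) \<and> b = sum f P" using d(1) P(2) by (intro exI[of _ "d b"]) auto
  qed
  then show ?thesis using P by blast
qed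

lemma weights_generate:
  assumes W: "\<And>mu x. mu \<in> lattice M \<Longrightarrow> x \<in> W mu \<Longrightarrow> Q x" and add: "\<And>x y. Q x \<Longrightarrow> Q y \<Longrightarrow> Q (x + y)"
  shows "Q v"
proof -
  obtain P f where P: "finite P" "P \<subseteq> lattice M" "\<forall>mu\<in>P. f mu \<in> W mu" "v = sum f P" using finite_weights by metis
  have "Q 0" by (rule W[of "\<lambda>_. 0"]) (simp_all add: lattice_def W_closed)
  have "Q (sum f P)" using P(1-3)
  proof (induction P)
    case empty then show ?case using \<open>Q 0\<close> by simp
  next
    case (insert mu P) then show ?case using W[of mu "f mu"] add by simp
  qed
  then show ?thesis using P(4) by simp
qed

text \<open>An eigenvector is a sum of weight vectors, and by uniqueness of the decomposition each of these has the same eigenvalue.\<close>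

lemma eigenvalues_bounded:
  assumes L: "finite L" "L \<subseteq> lattice M"
  shows "\<exists>D. \<forall>lam\<in>L. \<forall>h x. opt U lam x = smul U (q powi h) x \<longrightarrow> x \<noteq> 0 \<longrightarrow> \<bar>h\<bar> \<le> int D"
proof -
  obtain P where P: "finite P" "P \<subseteq> lattice M" "\<And>v. \<exists>f. (\<forall>mu\<in>P. f mu \<in> W mu) \<and> v = sum f P" using finite_weights by blast
  define D where "D = (\<Sum>lam\<in>L. \<Sum>mu\<in>P. nat \<bar>pairing M mu lam\<bar>)"
  have "\<bar>h\<bar> \<le> int D" if lam: "lam \<in> L" and x: "opt U lam x = smul U (q powi h) x" "x \<noteq> 0" for lam h x
  proof -
    have ll: "lam \<in> lattice M" using lam L by blast
    obtain f where f: "\<And>mu. mu \<in> P \<Longrightarrow> f mu \<in> W mu" "x = sum f P" using P(3) by metis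
    have "opt U lam x = (\<Sum>mu\<in>P. smul U (q powi pairing M mu lam) (f mu))"
      using f ll unfolding f(2) linear_sum[OF linear_t[OF ll]] by (intro sum.cong refl) (auto simp: weight_space_def)
    moreover have "smul U (q powi h) x = (\<Sum>mu\<in>P. smul U (q powi h) (f mu))" unfolding f(2) by (simp add: scale_sum_right)
    ultimately have eq: "(\<Sum>mu\<in>P. smul U (q powi pairing M mu lam) (f mu)) = (\<Sum>mu\<in>P. smul U (q powi h) (f mu))" using x(1) by simp
    obtain mu where mu: "mu \<in> P" "f mu \<noteq> 0" using x(2) f(2) by (metis sum.neutral)
    have "smul U (q powi pairing M mu lam) (f mu) = smul U (q powi h) (f mu)"
      by (rule decomposition_unique[OF P(1,2) _ _ eq mu(1)]) (auto intro: W_closed f)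
    then have "pairing M mu lam = h" using mu(2) by (simp add: powi_eq_iff)
    then have "nat \<bar>h\<bar> \<le> (\<Sum>mu\<in>P. nat \<bar>pairing M mu lam\<bar>)" using member_le_sum[OF mu(1), of "\<lambda>mu. nat \<bar>pairing M mu lam\<bar>"] P(1) by auto
    also have "\<dots> \<le> D" unfolding D_def by (rule member_le_sum[OF lam]) (use L in auto)
    finally show ?thesis by simp
  qed
  then show ?thesis by blast
qed

section \<open>Restriction to one or two nodes\<close>

lemma two_eq: "qnum q 2 = q + inverse q"
  unfolding qnum_two by (simp add: power_int_1_right power_int_minus1_right)

lemma t_neg_commute: "lam \<in> lattice M \<Longrightarrow> i \<in> {1..<M} \<Longrightarrow>
    opt U (\<lambda>k. - lam k) (opF U i x) = smul U (q powi (lam i - lam (Suc i))) (opF U i (opt U (\<lambda>k. - lam k) x))"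
  "lam \<in> lattice M \<Longrightarrow> i \<in> {1..<M} \<Longrightarrow>
    opt U (\<lambda>k. - lam k) (opE U i x) = smul U (q powi (lam (Suc i) - lam i)) (opE U i (opt U (\<lambda>k. - lam k) x))"
  using t_F'[OF lattice_minus, of lam i x] t_E'[OF lattice_minus, of lam i x] by (simp_all add: algebra_simps)

text \<open>Interchanging raising and lowering operators reverses the sign of the commutator; so the inverse of $K_i$ takes the place of $K_i$.\<close>

lemma Hop_root:
  assumes "borel_module q (smul U) E (\<lambda>b. opt U (\<lambda>k. - lam b k)) (\<lambda>b. opt U (lam b))" "i \<in> {1..<M}" "lam b = simple_root i"
  shows "opF U i (opE U i x) = opE U i (opF U i x) + borel_module.Hop q (smul U) (\<lambda>b. opt U (\<lambda>k. - lam b k)) (\<lambda>b. opt U (lam b)) b 0 x"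
proof -
  have "opE U i (opF U i x) - opF U i (opE U i x) = smul U qscale (opt U (simple_root i) x - opt U (\<lambda>k. - simple_root i k) x)"
    using E_F[OF assms(2,2), of x] by (simp add: qscale_def)
  then show ?thesis
    unfolding borel_module.Hop_def[OF assms(1)] assms(3) by (simp add: scale_right_diff_distrib algebra_simps)
qed

lemma rank_two:
  assumes i: "i \<in> {1..<M}" "Suc i \<in> {1..<M}"
  defines "node \<equiv> \<lambda>b. if b then Suc i else i"
  shows "\<exists>D. sl3_module q (smul U) (\<lambda>b. opF U (node b)) (\<lambda>b. opt U (\<lambda>k. - simple_root (node b) k)) (\<lambda>b. opt U (simple_root (node b))) D (\<lambda>b. opE U (node b))"
proof -
  let ?E = "\<lambda>b. opF U (node b)" and ?K = "\<lambda>b. opt U (\<lambda>k. - simple_root (node b) k)" and ?Ki = "\<lambda>b. opt U (simple_root (node b))"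
  have node: "node b \<in> {1..<M}" for b using i by (simp add: node_def)
  have root: "simple_root (node b) \<in> lattice M" for b by (rule root_lattice[OF node])
  have cartan: "simple_root (node a) (node b) - simple_root (node a) (Suc (node b)) = cart a b" for a b
    by (cases a; cases b) (simp_all add: node_def simple_root_def cart_def)
  obtain D where D: "\<And>b h x. opt U (\<lambda>k. - simple_root (node b) k) x = smul U (q powi h) x \<Longrightarrow> x \<noteq> 0 \<Longrightarrow> \<bar>h\<bar> \<le> int D"
    using eigenvalues_bounded[of "range (\<lambda>b k. - simple_root (node b) k)"] root lattice_minus by (auto simp: image_subset_iff) 
  have bm: "borel_module q (smul U) ?E ?K ?Ki"
  proof (intro borel_module.intro borel_module_axioms.intro)
    show "quantum_parameter q" "complex_vector_space (smul U)" by unfold_locales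
    show "Vector_Spaces.linear (smul U) (smul U) (?E b)" "Vector_Spaces.linear (smul U) (smul U) (?K b)"
      "Vector_Spaces.linear (smul U) (smul U) (?Ki b)" for b
      by (intro linear_F linear_t node root lattice_minus)+
    show "?Ki b (?K b x) = x" for b x by (rule t_minus(2)[OF root])
    show "?K a (?E b x) = smul U (q powi cart a b) (?E b (?K a x))" for a b x
      by (simp only: t_neg_commute(1)[OF root node] cartan)
    show "?E b (?E b (?E (\<not> b) x)) = smul U (qnum q 2) (?E b (?E (\<not> b) (?E b x))) - ?E (\<not> b) (?E b (?E b x))" for b x
      using F_Serre[OF node node, of b "\<not> b" x] by (cases b) (simp_all add: node_def two_eq algebra_simps)
    show "Q x" if 1: "\<And>h x. (\<And>b. ?K b x = smul U (q powi h b) x) \<Longrightarrow> Q x" and 2: "\<And>x y. Q x \<Longrightarrow> Q y \<Longrightarrow> Q (x + y)" for Q x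
    proof (rule weights_generate[of Q])
      fix mu x assume "mu \<in> lattice M" "x \<in> W mu"
      then have "?K b x = smul U (q powi (\<lambda>b. pairing M mu (\<lambda>k. - simple_root (node b) k)) b) x" for b
        using lattice_minus[OF root] by (simp add: weight_space_def)
      then show "Q x" by (rule 1)
    qed (rule 2)
  qed
  have bbm: "bounded_borel_module q (smul U) ?E ?K ?Ki D"
    by (rule bounded_borel_module.intro[OF bm bounded_borel_module_axioms.intro]) (rule D, auto)
  have sm: "step_module q (smul U) ?E ?K ?Ki D b (opE U (node b))" for b
  proof (rule step_module.intro[OF bbm step_module_axioms.intro])
    show "Vector_Spaces.linear (smul U) (smul U) (opE U (node b))" by (rule linear_E[OF node])
    show "?K a (opE U (node b) x) = smul U (q powi - cart a b) (opE U (node b) (?K a x))" for a x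
      unfolding t_neg_commute(2)[OF root node] cartan[symmetric] by (simp add: algebra_simps)
    show "?E b (opE U (node b) x) = opE U (node b) (?E b x) + borel_module.Hop q (smul U) ?K ?Ki b 0 x" for x
      by (rule Hop_root[OF bm node refl])
    show "?E (\<not> b) (opE U (node b) x) = opE U (node b) (?E (\<not> b) x)" for x
      using E_F[OF node[of b] node[of "\<not> b"], of x] by (cases b) (simp_all add: node_def)
  qed
  have "sl3_module q (smul U) ?E ?K ?Ki D (\<lambda>b. opE U (node b))"
  proof (rule sl3_module.intro[OF bbm sl3_module_axioms.intro])
    show "opE U (node b) (opE U (node b) (opE U (node (\<not> b)) x)) = smul U (qnum q 2) (opE U (node b) (opE U (node (\<not> b)) (opE U (node b) x)))
      - opE U (node (\<not> b)) (opE U (node b) (opE U (node b) x))" for b x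
      using E_Serre[OF node node, of b "\<not> b" x] by (cases b) (simp_all add: node_def two_eq algebra_simps)
  qed (rule sm)
  then show ?thesis by blast
qed

text \<open>A single node is embedded into rank two by a second raising operator that is 0. The missing Cartan generator is the inverse of
  $t_{\epsilon_{i+1}}$, whose commutation with the first raising operator is that of $K_2$.\<close>

lemma rank_one:
  assumes i: "i \<in> {1..<M}"
  defines "lam \<equiv> \<lambda>b. if b then (\<lambda>k. if k = Suc i then 1 else 0) else simple_root i"
  shows "\<exists>D. step_module q (smul U) (\<lambda>b. if b then (\<lambda>_. 0) else opF U i) (\<lambda>b. opt U (\<lambda>k. - lam b k)) (\<lambda>b. opt U (lam b)) D False (opE U i)"
proof -
  let ?E = "\<lambda>b. if b then (\<lambda>_. 0) else opF U i" and ?K = "\<lambda>b. opt U (\<lambda>k. - lam b k)" and ?Ki = "\<lambda>b. opt U (lam b)"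
  have lam: "lam b \<in> lattice M" for b using root_lattice[OF i] i by (auto simp: lam_def lattice_def)
  have cartan: "lam a i - lam a (Suc i) = cart a False" for a
    by (cases a) (simp_all add: lam_def simple_root_def cart_def)
  obtain D where D: "\<And>b h x. opt U (\<lambda>k. - lam b k) x = smul U (q powi h) x \<Longrightarrow> x \<noteq> 0 \<Longrightarrow> \<bar>h\<bar> \<le> int D"
    using eigenvalues_bounded[of "range (\<lambda>b k. - lam b k)"] lam lattice_minus by (auto simp: image_subset_iff) 
  have lin0: "Vector_Spaces.linear (smul U) (smul U) (\<lambda>_. 0)" by (rule linearI) simp_all
  have bm: "borel_module q (smul U) ?E ?K ?Ki"
  proof (intro borel_module.intro borel_module_axioms.intro)
    show "quantum_parameter q" "complex_vector_space (smul U)" by unfold_locales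
    show "Vector_Spaces.linear (smul U) (smul U) (?E b)" for b using linear_F[OF i] lin0 by simp
    show "Vector_Spaces.linear (smul U) (smul U) (?K b)" "Vector_Spaces.linear (smul U) (smul U) (?Ki b)" for b
      by (intro linear_t lam lattice_minus)+
    show "?Ki b (?K b x) = x" for b x by (rule t_minus(2)[OF lam])
    show "?K a (?E b x) = smul U (q powi cart a b) (?E b (?K a x))" for a b x
      using t_neg_commute(1)[OF lam i] linear_zero[OF linear_t[OF lattice_minus[OF lam]]] by (simp add: cartan)
    show "?E b (?E b (?E (\<not> b) x)) = smul U (qnum q 2) (?E b (?E (\<not> b) (?E b x))) - ?E (\<not> b) (?E b (?E b x))" for b x
      by (cases b) (simp_all add: linear_zero[OF linear_F[OF i]])
    show "Q x" if 1: "\<And>h x. (\<And>b. ?K b x = smul U (q powi h b) x) \<Longrightarrow> Q x" and 2: "\<And>x y. Q x \<Longrightarrow> Q y \<Longrightarrow> Q (x + y)" for Q x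
    proof (rule weights_generate[of Q])
      fix mu x assume "mu \<in> lattice M" "x \<in> W mu"
      then have "?K b x = smul U (q powi (\<lambda>b. pairing M mu (\<lambda>k. - lam b k)) b) x" for b
        using lattice_minus[OF lam] by (simp add: weight_space_def)
      then show "Q x" by (rule 1)
    qed (rule 2)
  qed
  have bbm: "bounded_borel_module q (smul U) ?E ?K ?Ki D"
    by (rule bounded_borel_module.intro[OF bm bounded_borel_module_axioms.intro]) (rule D, auto)
  have "step_module q (smul U) ?E ?K ?Ki D False (opE U i)"
  proof (rule step_module.intro[OF bbm step_module_axioms.intro])
    show "Vector_Spaces.linear (smul U) (smul U) (opE U i)" by (rule linear_E[OF i])
    show "?K a (opE U i x) = smul U (q powi - cart a False) (opE U i (?K a x))" for a x
      unfolding t_neg_commute(2)[OF lam i] cartan[symmetric] by (simp add: algebra_simps)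
    show "?E False (opE U i x) = opE U i (?E False x) + borel_module.Hop q (smul U) ?K ?Ki False 0 x" for x
      using Hop_root[OF bm i, of False x] by (simp add: lam_def)
    show "?E (\<not> False) (opE U i x) = opE U i (?E (\<not> False) x)" for x
      by (simp add: linear_zero[OF linear_E[OF i]])
  qed
  then show ?thesis by blast
qed

lemma nilpotent:
  assumes i: "i \<in> {1..<M}" shows "\<exists>D. \<forall>k x. k > D \<longrightarrow> (opE U i ^^ k) x = 0"
proof -
  obtain D where "step_module q (smul U) (\<lambda>b. if b then (\<lambda>_. 0) else opF U i) 
    (\<lambda>b. opt U (\<lambda>k. - (if b then (\<lambda>k. if k = Suc i then 1 else 0) else simple_root i) k))
    (\<lambda>b. opt U (if b then (\<lambda>k. if k = Suc i then 1 else 0) else simple_root i)) D False (opE U i)"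
    using rank_one[OF i] by blast
  then interpret S: step_module q "smul U" "\<lambda>b. if b then (\<lambda>_. 0) else opF U i"
    "\<lambda>b. opt U (\<lambda>k. - (if b then (\<lambda>k. if k = Suc i then 1 else 0) else simple_root i) k)"
    "\<lambda>b. opt U (if b then (\<lambda>k. if k = Suc i then 1 else 0) else simple_root i)" D False "opE U i" .
  show ?thesis using S.Fpow_zero by blast
qed

end

section \<open>Composites of the operators and their denominators\<close>

fun A_word :: "complex \<Rightarrow> 'v::ab_group_add uq_rep \<Rightarrow> nat list \<Rightarrow> (nat \<Rightarrow> int) \<Rightarrow> (nat \<Rightarrow> complex) \<Rightarrow> 'v \<Rightarrow> 'v" where
  "A_word q U [] mu z v = v"
| "A_word q U (i # w) mu z v = A_word q U w (refl_act i mu) (refl_act i z) (A_op q U i mu z v)"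

fun word_regular :: "nat \<Rightarrow> complex \<Rightarrow> 'v::ab_group_add uq_rep \<Rightarrow> nat list \<Rightarrow> (nat \<Rightarrow> int) \<Rightarrow> (nat \<Rightarrow> complex) \<Rightarrow> bool" where
  "word_regular M q U [] mu z \<longleftrightarrow> True"
| "word_regular M q U (i # w) mu z \<longleftrightarrow> A_regular M q U i mu z \<and> word_regular M q U w (refl_act i mu) (refl_act i z)"

context gl_module
begin

lemma A_term_zero:
  assumes "i \<in> {1..<M}" "\<forall>k x. k > D \<longrightarrow> (opE U i ^^ k) x = 0" "j > D"
  shows "A_term q U i mu j v = 0"
  using assms(2,3) by (simp add: A_term_def divE_def)

lemma A_op_sum:
  assumes i: "i \<in> {1..<M}" and D: "\<forall>k x. k > D \<longrightarrow> (opE U i ^^ k) x = 0" and R: "D \<le> R"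
  shows "A_op q U i mu z v = (\<Sum>j\<le>R. smul U ((- q) ^ j *
        ((z (Suc i) - q ^ nat \<bar>mu i - mu (Suc i)\<bar> * z i) / A_denom q i mu z j)) (A_term q U i mu j v))"
proof -
  have "A_term q U i mu j v = 0" if "j \<notin> {..R}" for j using A_term_zero[where D = D, OF i D, of j] that R by simp
  then show ?thesis unfolding A_op_def by (intro Sum_any.expand_superset) fastforce+
qed

lemma A_op_A_sum:
  assumes i: "i \<in> {1..<M}" and D: "\<forall>k x. k > D \<longrightarrow> (opE U i ^^ k) x = 0" and R: "D \<le> R"
  shows "A_op q U i mu z v = A_sum q (smul U) (opE U i) (opF U i) (nat (mu (Suc i) - mu i)) (nat (mu i - mu (Suc i))) R (z i) (z (Suc i)) v"
proof -
  have "nat \<bar>mu i - mu (Suc i)\<bar> = nat (mu (Suc i) - mu i) + nat (mu i - mu (Suc i))" by simp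
  then show ?thesis
    unfolding A_op_sum[where D = D and R = R, OF i D R] A_sum_def A_denom_def A_term_def divE_def divF_def
    by (simp add: linear_scale[OF linear_funpow[OF linear_E[OF i]]] mult.assoc)
qed

lemma A_op_weight:
  assumes i: "i \<in> {1..<M}" and v: "v \<in> W mu"
  shows "A_op q U i mu z v \<in> W (refl_act i mu)"
proof -
  obtain D where D: "\<forall>k x. k > D \<longrightarrow> (opE U i ^^ k) x = 0" using nilpotent[OF i] by blast
  show ?thesis unfolding A_op_sum[where D = D, OF i D order_refl]
    by (intro W_sum W_closed(3) A_term_weight i v)
qed

lemma A_sum_commute:
  assumes T: "Vector_Spaces.linear (smul U) (smul U) T" "\<And>x. T (X x) = X (T x)" "\<And>x. T (Y x) = Y (T x)"
  shows "T (A_sum q (smul U) X Y a b R x y u) = A_sum q (smul U) X Y a b R x y (T u)"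
proof -
  have "(X ^^ k) (T x) = T ((X ^^ k) x)" "(Y ^^ k) (T x) = T ((Y ^^ k) x)" for k x
    by (induction k) (simp_all add: T)
  then show ?thesis unfolding A_sum_def by (simp add: linear_sum[OF T(1)] linear_scale[OF T(1)])
qed

lemma linear_A_sum:
  assumes "Vector_Spaces.linear (smul U) (smul U) X" "Vector_Spaces.linear (smul U) (smul U) Y"
  shows "Vector_Spaces.linear (smul U) (smul U) (A_sum q (smul U) X Y a b R x y)"
proof -
  note l = linear_rules[OF linear_funpow[OF assms(1)]] linear_rules[OF linear_funpow[OF assms(2)]]
  show ?thesis by (rule linearI) (simp_all add: A_sum_def l scale_right_distrib sum.distrib scale_sum_right mult_ac)
qed

lemma refl_act_far:
  assumes "\<bar>int i - int j\<bar> \<ge> 2" shows "refl_act j x i = x i" "refl_act j x (Suc i) = x (Suc i)"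
  using assms by (auto simp: refl_act_def transpose_def)

lemma A_op_commute_far:
  assumes i: "i \<in> {1..<M}" and j: "j \<in> {1..<M}" and far: "\<bar>int i - int j\<bar> \<ge> 2"
  shows "A_op q U i (refl_act j mu) (refl_act j z) (A_op q U j mu z v) = A_op q U j (refl_act i mu) (refl_act i z) (A_op q U i mu z v)"
proof -
  obtain Di where Di: "\<forall>k x. k > Di \<longrightarrow> (opE U i ^^ k) x = 0" using nilpotent[OF i] by blast
  obtain Dj where Dj: "\<forall>k x. k > Dj \<longrightarrow> (opE U j ^^ k) x = 0" using nilpotent[OF j] by blast
  have far': "\<bar>int j - int i\<bar> \<ge> 2" using far by simp
  have neq: "i \<noteq> j" using far by auto
  note lin = linear_E[OF i] linear_F[OF i] linear_E[OF j] linear_F[OF j]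
  note comm = E_E_far[OF i j far] F_F_far[OF i j far] E_F[OF i j] E_F[OF j i]
  have c: "opE U i (opE U j x) = opE U j (opE U i x)" "opE U i (opF U j x) = opF U j (opE U i x)"
    "opF U i (opE U j x) = opE U j (opF U i x)" "opF U i (opF U j x) = opF U j (opF U i x)" for x
    using comm[of x] neq by simp_all
  show ?thesis
    unfolding A_op_A_sum[where D = Di and R = Di, OF i Di order_refl] A_op_A_sum[where D = Dj and R = Dj, OF j Dj order_refl]
      refl_act_far[OF far] refl_act_far[OF far']
    by (rule A_sum_commute[symmetric], rule linear_A_sum[OF lin(3,4)])
      (rule A_sum_commute[symmetric, OF lin(1)] A_sum_commute[symmetric, OF lin(2)]; simp add: c)+
qed

text \<open>Only the denominators of terms that act nontrivially are multiplied in: these are the ones known to be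
  nonzero at a regular point. The operator \<open>T\<close> so obtained is polynomial in \<open>z\<close>.\<close>

lemma clear_denominators:
  assumes i: "i \<in> {1..<M}" and mu: "mu \<in> lattice M"
  shows "\<exists>\<Delta> T. multiplier \<Delta> \<and> (\<forall>f\<in>polyfun (smul U). (\<lambda>z. T z (f z)) \<in> polyfun (smul U)) \<and>
    (\<forall>z c v. T z (smul U c v) = smul U c (T z v)) \<and>
    (\<forall>z. A_regular M q U i mu z \<longrightarrow> \<Delta> z \<noteq> 0 \<and> (\<forall>v\<in>W mu. T z v = smul U (\<Delta> z) (A_op q U i mu z v)))"
proof -
  obtain D where D: "\<forall>k x. k > D \<longrightarrow> (opE U i ^^ k) x = 0" using nilpotent[OF i] by blast
  define J where "J = {j. j \<le> D \<and> (\<exists>v\<in>W mu. A_term q U i mu j v \<noteq> 0)}"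
  have fin: "finite J" unfolding J_def by simp
  define num where "num z = z (Suc i) - q ^ nat \<bar>mu i - mu (Suc i)\<bar> * z i" for z :: "nat \<Rightarrow> complex"
  define \<Delta> where "\<Delta> z = (\<Prod>j\<in>J. A_denom q i mu z j)" for z
  define r where "r j z = (- q) ^ j * (num z * (\<Prod>k\<in>J - {j}. A_denom q i mu z k))" for j z
  define T where "T z v = (\<Sum>j\<in>J. smul U (r j z) (A_term q U i mu j v))" for z v
  have lin: "Vector_Spaces.linear (smul U) (smul U) (A_term q U i mu j)" for j
    by (rule linearI) (simp_all add: A_term_def divE_def divF_def scale_right_distrib mult_ac
        linear_rules[OF linear_funpow[OF linear_E[OF i]]] linear_rules[OF linear_funpow[OF linear_F[OF i]]])
  have m_denom: "multiplier (\<lambda>z. A_denom q i mu z j)" for j unfolding A_denom_def by (rule multiplier_linear)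
  have m_r: "multiplier (r j)" for j
    unfolding r_def[abs_def] num_def[abs_def]
    by (intro multiplier_mult multiplier_const multiplier_linear multiplier_prod m_denom)
  have "multiplier \<Delta>" unfolding \<Delta>_def[abs_def] by (intro multiplier_prod m_denom)
  moreover have "(\<lambda>z. T z (f z)) \<in> polyfun (smul U)" if "f \<in> polyfun (smul U)" for f
    unfolding T_def using m_r polyfun_linear[OF that lin] by (intro polyfun_sum) (simp add: multiplier_def)
  moreover have "T z (smul U c v) = smul U c (T z v)" for z c v
    by (simp add: T_def linear_scale[OF lin] scale_sum_right mult.commute)
  moreover have "\<Delta> z \<noteq> 0 \<and> (\<forall>v\<in>W mu. T z v = smul U (\<Delta> z) (A_op q U i mu z v))" if reg: "A_regular M q U i mu z" for z
  proof -
    have nz: "A_denom q i mu z j \<noteq> 0" if "j \<in> J" for j using reg that by (auto simp: A_regular_def J_def)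
    have "T z v = smul U (\<Delta> z) (A_op q U i mu z v)" if v: "v \<in> W mu" for v
    proof -
      have "A_op q U i mu z v = (\<Sum>j\<le>D. smul U ((- q) ^ j * (num z / A_denom q i mu z j)) (A_term q U i mu j v))"
        unfolding num_def by (rule A_op_sum[where D = D, OF i D order_refl])
      also have "\<dots> = (\<Sum>j\<in>J. smul U ((- q) ^ j * (num z / A_denom q i mu z j)) (A_term q U i mu j v))"
        by (rule sum.mono_neutral_right) (use v in \<open>auto simp: J_def\<close>)
      finally have "smul U (\<Delta> z) (A_op q U i mu z v) = (\<Sum>j\<in>J. smul U (\<Delta> z * ((- q) ^ j * (num z / A_denom q i mu z j))) (A_term q U i mu j v))"
        by (simp add: scale_sum_right)
      also have "\<dots> = T z v" unfolding T_def
      proof (rule sum.cong[OF refl])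
        fix j assume j: "j \<in> J"
        have "\<Delta> z = A_denom q i mu z j * (\<Prod>k\<in>J - {j}. A_denom q i mu z k)" unfolding \<Delta>_def by (rule prod.remove[OF fin j])
        then show "smul U (\<Delta> z * ((- q) ^ j * (num z / A_denom q i mu z j))) (A_term q U i mu j v) = smul U (r j z) (A_term q U i mu j v)"
          using nz[OF j] by (simp add: r_def mult_ac)
      qed
      finally show ?thesis by simp
    qed
    then show ?thesis using nz fin by (simp add: \<Delta>_def)
  qed
  ultimately show ?thesis by blast
qed

lemma clear_denominators_word:
  assumes "set w \<subseteq> {1..<M}" "mu \<in> lattice M"
  shows "\<exists>\<Delta> T. multiplier \<Delta> \<and> (\<forall>f\<in>polyfun (smul U). (\<lambda>z. T z (f z)) \<in> polyfun (smul U)) \<and>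
    (\<forall>z c v. T z (smul U c v) = smul U c (T z v)) \<and>
    (\<forall>z. word_regular M q U w mu z \<longrightarrow> \<Delta> z \<noteq> 0 \<and> (\<forall>v\<in>W mu. T z v = smul U (\<Delta> z) (A_word q U w mu z v)))"
  using assms
proof (induction w arbitrary: mu)
  case Nil
  show ?case by (rule exI[of _ "\<lambda>_. 1"], rule exI[of _ "\<lambda>_ v. v"]) (simp add: multiplier_const)
next
  case (Cons i w)
  then have i: "i \<in> {1..<M}" by simp
  obtain \<Delta>1 T1 where 1: "multiplier \<Delta>1" "\<And>f. f \<in> polyfun (smul U) \<Longrightarrow> (\<lambda>z. T1 z (f z)) \<in> polyfun (smul U)"
    "\<And>z c v. T1 z (smul U c v) = smul U c (T1 z v)"
    "\<And>z. A_regular M q U i mu z \<Longrightarrow> \<Delta>1 z \<noteq> 0" "\<And>z v. A_regular M q U i mu z \<Longrightarrow> v \<in> W mu \<Longrightarrow> T1 z v = smul U (\<Delta>1 z) (A_op q U i mu z v)"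
    using clear_denominators[OF i Cons.prems(2)] by blast
  obtain \<Delta>2 T2 where 2: "multiplier \<Delta>2" "\<And>f. f \<in> polyfun (smul U) \<Longrightarrow> (\<lambda>z. T2 z (f z)) \<in> polyfun (smul U)"
    "\<And>z c v. T2 z (smul U c v) = smul U c (T2 z v)"
    "\<And>z. word_regular M q U w (refl_act i mu) z \<Longrightarrow> \<Delta>2 z \<noteq> 0"
    "\<And>z v. word_regular M q U w (refl_act i mu) z \<Longrightarrow> v \<in> W (refl_act i mu) \<Longrightarrow> T2 z v = smul U (\<Delta>2 z) (A_word q U w (refl_act i mu) z v)"
    using Cons.IH[OF _ lattice_refl[OF i Cons.prems(2)]] Cons.prems(1) by simp blast
  have rr: "refl_act i (refl_act i z) = z" for z :: "nat \<Rightarrow> complex" by (simp add: refl_act_def comp_assoc)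
  show ?case
  proof (rule exI[of _ "\<lambda>z. \<Delta>1 z * \<Delta>2 (refl_act i z)"], rule exI[of _ "\<lambda>z v. T2 (refl_act i z) (T1 z v)"], intro conjI ballI allI impI)
    show "multiplier (\<lambda>z. \<Delta>1 z * \<Delta>2 (refl_act i z))" by (intro multiplier_mult multiplier_refl 1 2)
  next
    fix f assume "f \<in> polyfun (smul U)"
    from polyfun_refl[OF 2(2)[OF polyfun_refl[OF 1(2)[OF this], of i]], of i]
    show "(\<lambda>z. T2 (refl_act i z) (T1 z (f z))) \<in> polyfun (smul U)" by (simp add: rr)
  next
    show "T2 (refl_act i z) (T1 z (smul U c v)) = smul U c (T2 (refl_act i z) (T1 z v))" for z c v by (simp add: 1 2)
  next
    fix z assume "word_regular M q U (i # w) mu z"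
    then have reg: "A_regular M q U i mu z" "word_regular M q U w (refl_act i mu) (refl_act i z)" by simp_all
    show "\<Delta>1 z * \<Delta>2 (refl_act i z) \<noteq> 0" using 1(4) 2(4) reg by simp
    show "T2 (refl_act i z) (T1 z v) = smul U (\<Delta>1 z * \<Delta>2 (refl_act i z)) (A_word q U (i # w) mu z v)" if "v \<in> W mu" for v
      using 1(5)[OF reg(1) that] 2(5)[OF reg(2) A_op_weight[OF i that]] by (simp add: 2(3))
  qed
qed

text \<open>The difference of both sides, multiplied by all denominators, is a polynomial function vanishing on \<open>S\<close>, hence everywhere.\<close>

lemma A_words_agree:
  assumes w: "set w \<subseteq> {1..<M}" "set w' \<subseteq> {1..<M}" and mu: "mu \<in> lattice M" and v: "v \<in> W mu"
    and dense: "\<And>f. f \<in> polyfun (smul U) \<Longrightarrow> (\<And>z. z \<in> S \<Longrightarrow> f z = 0) \<Longrightarrow> (\<And>z. f z = 0)"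
    and agree: "\<And>z. z \<in> S \<Longrightarrow> word_regular M q U w mu z \<and> word_regular M q U w' mu z \<and> A_word q U w mu z v = A_word q U w' mu z v"
    and reg: "word_regular M q U w mu z" "word_regular M q U w' mu z"
  shows "A_word q U w mu z v = A_word q U w' mu z v"
proof -
  obtain \<Delta>1 T1 where 1: "multiplier \<Delta>1" "\<And>f. f \<in> polyfun (smul U) \<Longrightarrow> (\<lambda>z. T1 z (f z)) \<in> polyfun (smul U)"
    "\<And>z. word_regular M q U w mu z \<Longrightarrow> \<Delta>1 z \<noteq> 0" "\<And>z. word_regular M q U w mu z \<Longrightarrow> T1 z v = smul U (\<Delta>1 z) (A_word q U w mu z v)"
    using clear_denominators_word[OF w(1) mu] v by blast
  obtain \<Delta>2 T2 where 2: "multiplier \<Delta>2" "\<And>f. f \<in> polyfun (smul U) \<Longrightarrow> (\<lambda>z. T2 z (f z)) \<in> polyfun (smul U)"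
    "\<And>z. word_regular M q U w' mu z \<Longrightarrow> \<Delta>2 z \<noteq> 0" "\<And>z. word_regular M q U w' mu z \<Longrightarrow> T2 z v = smul U (\<Delta>2 z) (A_word q U w' mu z v)"
    using clear_denominators_word[OF w(2) mu] v by blast
  define f where "f z = smul U (\<Delta>2 z) (T1 z v) + smul U (-1) (smul U (\<Delta>1 z) (T2 z v))" for z
  have "f \<in> polyfun (smul U)"
    unfolding f_def[abs_def]
    by (intro polyfun.add polyfun_const_scale multiplierD[OF 1(1)] multiplierD[OF 2(1)] 1(2)[OF polyfun.const] 2(2)[OF polyfun.const])
  moreover have f: "f z = smul U (\<Delta>1 z * \<Delta>2 z) (A_word q U w mu z v - A_word q U w' mu z v)"
    if "word_regular M q U w mu z" "word_regular M q U w' mu z" for z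
    using that by (simp add: f_def 1(4) 2(4) scale_right_diff_distrib mult.commute)
  moreover have "f z = 0" if "z \<in> S" for z using f[of z] agree[OF that] by simp
  ultimately have "f z = 0" using dense by blast
  then show ?thesis using f[OF reg] 1(3)[OF reg(1)] 2(3)[OF reg(2)] by simp
qed

end

section \<open>Density of the integral points\<close>

context borel_module
begin

lemma eventually_generic: "\<exists>B. \<forall>h\<ge>B. generic L h h2"
proof -
  obtain B where "\<And>h. h \<in> {h. \<not> generic L h h2} \<Longrightarrow> h < B"
    using finite_nongeneric[of L h2] unfolding finite_nat_set_iff_bounded by blast
  then show ?thesis by (metis mem_Collect_eq not_le)
qed

end

context quantum_parameter
begin

lemma infinite_powers:
  assumes "\<And>N. N \<ge> B \<Longrightarrow> P N" shows "infinite ((\<lambda>N::nat. q powi (2 * int N + m)) ` {N. P N})"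
proof
  assume "finite ((\<lambda>N::nat. q powi (2 * int N + m)) ` {N. P N})"
  moreover have "inj_on (\<lambda>N::nat. q powi (2 * int N + m)) {N. P N}" by (auto simp: inj_on_def powi_eq_iff)
  ultimately have "finite {N. P N}" by (rule finite_imageD)
  then have "finite {B..}" by (rule rev_finite_subset) (use assms in auto)
  then show False by (simp add: infinite_Ici)
qed

end

context gl_module
begin

lemma A_denom_power:
  assumes "z i = q powi e * z (Suc i)"
  shows "A_denom q i mu z j = (1 - q powi (int (2 * j + nat \<bar>mu i - mu (Suc i)\<bar>) + e)) * z (Suc i)"
  unfolding A_denom_def assms by (simp add: pow_powi powi_mult powi_mult_left algebra_simps del: of_nat_add)

text \<open>All exponents of \<open>q\<close> in the denominators are positive, and \<open>q\<close> is not a root of unity.\<close>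

lemma A_regular_power:
  assumes "z i = q powi e * z (Suc i)" "z (Suc i) \<noteq> 0" "e > 0"
  shows "A_regular M q U i mu z"
  unfolding A_regular_def A_denom_power[OF assms(1)] using assms(2,3) by (auto simp: powi_eq_1_iff)

lemma A_op_scale:
  assumes "i \<in> {1..<M}" shows "A_op q U i mu z (smul U c v) = smul U c (A_op q U i mu z v)"
proof -
  obtain D where D: "\<forall>k x. k > D \<longrightarrow> (opE U i ^^ k) x = 0" using nilpotent[OF assms] by blast
  show ?thesis unfolding A_op_A_sum[where D = D, OF assms D order_refl]
    by (rule linear_scale[OF linear_A_sum[OF linear_E[OF assms] linear_F[OF assms]]])
qed

text \<open>The points of \<open>S\<close> have \<open>z\<^sub>i / z\<^sub>i\<^sub>+\<^sub>1 = q\<^sup>n\<^sup>+\<^sup>N\<close> for infinitely many pairs with the difference prescribed by the weight.\<close>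

lemma A_op_unitarity:
  assumes i: "i \<in> {1..<M}" and mu: "mu \<in> lattice M" and v: "v \<in> W mu"
    and reg: "word_regular M q U [i, i] mu z"
  shows "A_word q U [i, i] mu z v = v"
proof (cases "v = 0")
  case True
  have "A_op q U i mu z 0 = 0" for mu z using A_op_scale[OF i, of mu z 0 0] by simp
  then show ?thesis using True by simp
next
  case False
  define lam where "lam = (\<lambda>b. if b then (\<lambda>k. if k = Suc i then 1 else 0) else simple_root i)"
  obtain D where "step_module q (smul U) (\<lambda>b. if b then (\<lambda>_. 0) else opF U i) (\<lambda>b. opt U (\<lambda>k. - lam b k)) (\<lambda>b. opt U (lam b)) D False (opE U i)"
    using rank_one[OF i] unfolding lam_def by blast
  then interpret R: step_module q "smul U" "\<lambda>b. if b then (\<lambda>_. 0) else opF U i" "\<lambda>b. opt U (\<lambda>k. - lam b k)" "\<lambda>b. opt U (lam b)" D False "opE U i" .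
  have D: "\<forall>k x. k > D \<longrightarrow> (opE U i ^^ k) x = 0" using R.Fpow_zero by blast
  define m where "m = mu (Suc i) - mu i"
  define h where "h b = (if b then - mu (Suc i) else m)" for b
  have lam: "lam b \<in> lattice M" for b using root_lattice[OF i] i by (auto simp: lam_def lattice_def)
  have "- pairing M mu (lam b) = h b" for b
  proof (cases b)
    case True
    have "pairing M mu (lam b) = (\<Sum>k\<in>{1..M}. if k = Suc i then mu k else 0)"
      unfolding pairing_def by (rule sum.cong[OF refl]) (simp add: lam_def True)
    then show ?thesis using i True by (simp add: h_def)
  next
    case False
    then show ?thesis using pairing_root[OF i, of mu] by (simp add: h_def lam_def m_def)
  qed
  then have wt: "R.wt h v"
    unfolding R.wt_def using v lattice_minus[OF lam]
    by (simp add: weight_space_def pairing_commute[of mu "\<lambda>k. - lam _ k"] pairing_minus pairing_commute[of "lam _" mu])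
  have mD: "\<bar>m\<bar> \<le> int D" using R.wt_bounded[OF wt, of False] False by (force simp: h_def)
  define n0 where "n0 = nat (- mu (Suc i))"
  define S where "S = {z :: nat \<Rightarrow> complex. z (Suc i) \<noteq> 0 \<and> (\<exists>N n. D < N \<and> D < n \<and> int n - int N = m \<and>
    R.generic (4 * D + 2) (n - 1) n0 \<and> z i = q powi (int n + int N) * z (Suc i))}"
  have r: "refl_act i x i = x (Suc i)" "refl_act i x (Suc i) = x i" for x :: "nat \<Rightarrow> complex" by (simp_all add: refl_act_def)
  have r': "refl_act i x i = x (Suc i)" "refl_act i x (Suc i) = x i" for x :: "nat \<Rightarrow> int" by (simp_all add: refl_act_def)
  have "A_word q U [i, i] mu z v = A_word q U [] mu z v"
  proof (rule A_words_agree[OF _ _ mu v, where S = S])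
    show "set [i, i] \<subseteq> {1..<M}" "set [] \<subseteq> {1..<M}" using i by auto
    show "word_regular M q U [i, i] mu z" "word_regular M q U [] mu z" using reg by simp_all
  next
    fix f z assume f: "f \<in> polyfun (smul U)" and f0: "\<And>z. z \<in> S \<Longrightarrow> f z = 0"
    show "f z = 0"
    proof (rule polyfun_vanish_nonzero[OF f, of "Suc i"])
      fix z :: "nat \<Rightarrow> complex" assume z: "z (Suc i) \<noteq> 0"
      obtain B where B: "\<And>h. h \<ge> B \<Longrightarrow> R.generic (4 * D + 2) h n0" using R.eventually_generic by blast
      define P where "P N \<longleftrightarrow> D < N \<and> D < nat (int N + m) \<and> R.generic (4 * D + 2) (nat (int N + m) - 1) n0" for N :: nat
      show "f z = 0"
      proof (rule polyfun_vanish_ratio[OF f _ _ z])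
        show "infinite ((\<lambda>N::nat. q powi (2 * int N + m)) ` {N. P N})"
        proof (rule infinite_powers)
          fix N assume N: "N \<ge> B + nat \<bar>m\<bar> + D + 2"
          then have "B \<le> nat (int N + m) - 1" "D < nat (int N + m)" "D < N" by linarith+
          then show "P N" using B unfolding P_def by blast
        qed
      next
        fix \<zeta> assume "\<zeta> \<in> (\<lambda>N::nat. q powi (2 * int N + m)) ` {N. P N}"
        then obtain N where N: "P N" "\<zeta> = q powi (2 * int N + m)" by blast
        define n where "n = nat (int N + m)"
        have n: "int n = int N + m" using N(1) by (auto simp: P_def n_def)
        have e: "2 * int N + m = int n + int N" using n by simp
        show "f (z(i := \<zeta> * z (Suc i))) = 0"
          using N(1) n z unfolding P_def n_def[symmetric] N(2) e
          by (intro f0, unfold S_def mem_Collect_eq, intro conjI exI[of _ N] exI[of _ n]) simp_all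
      qed
    qed
  next
    fix z assume "z \<in> S"
    then obtain N n where z: "z (Suc i) \<noteq> 0" and N: "D < N" "D < n" "int n - int N = m" and gen: "R.generic (4 * D + 2) (n - 1) n0"
      and zi: "z i = q powi (int n + int N) * z (Suc i)" unfolding S_def by blast
    have N1: "N \<ge> 1" "n \<ge> 1" using N by simp_all
    have 1: "A_regular M q U i mu z" by (rule A_regular_power[OF zi z]) (use N in simp)
    \<comment> \<open>For the second factor the exponents of \<open>q\<close> in the denominators are negative; only the indices up to \<open>D\<close> matter.\<close>
    have 2: "A_regular M q U i (refl_act i mu) (refl_act i z)"
      unfolding A_regular_def
    proof (intro allI impI)
      fix j assume "\<exists>v\<in>W (refl_act i mu). A_term q U i (refl_act i mu) j v \<noteq> 0"
      then have j: "j \<le> D" using A_term_zero[OF i D] not_less by blast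
      have zs: "refl_act i z i = q powi (- (int n + int N)) * refl_act i z (Suc i)" unfolding r zi by (simp add: powi_mult_left)
      have "int (2 * j + nat \<bar>refl_act i mu i - refl_act i mu (Suc i)\<bar>) + - (int n + int N) \<noteq> 0"
        unfolding r' using N j by (simp add: m_def)
      moreover have "refl_act i z (Suc i) \<noteq> 0" unfolding r zi using z by simp
      ultimately show "A_denom q i (refl_act i mu) (refl_act i z) j \<noteq> 0"
        unfolding A_denom_power[where z = "refl_act i z", OF zs] mult_eq_0_iff using powi_eq_1_iff by auto
    qed
    define A1 where "A1 = A_op q U i mu z v"
    have Nm: "int n - int N = mu (Suc i) - mu i" "int N - int n = mu i - mu (Suc i)" using N(3) by (simp_all add: m_def)
    have step_op: "R.step_op N n D v = smul U (step_scalar N n) A1"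
      using R.step_op_A_sum[OF N1 z zi, of D v] unfolding A1_def A_op_A_sum[where D = D, OF i D order_refl] Nm if_False .
    have step_op_inv: "R.step_op_inv N n D A1 = smul U (inverse (step_scalar N n)) (A_op q U i (refl_act i mu) (refl_act i z) A1)"
      using R.step_op_inv_A_sum[OF N1 z zi, of D A1] unfolding A_op_A_sum[where D = D, OF i D order_refl] r r' Nm if_False .
    have "R.step_op_inv N n D (R.step_op N n D v) = v"
    proof (rule R.unitarity_integral[OF wt _ N(1,2) _ order_refl])
      show "h False = int n - int N" using N(3) by (simp add: h_def)
      show "\<bar>int n - int N\<bar> \<le> int D" using mD N(3) by simp
      show "R.generic (4 * D + 2) (if False then n0 else n - 1) (if False then n - 1 else n0)" using gen by simp
      show "h (\<not> False) \<le> int n0" by (simp add: h_def n0_def)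
    qed
    then have "A_op q U i (refl_act i mu) (refl_act i z) A1 = v"
      unfolding step_op R.step_op_inv_scale step_op_inv using step_scalar_nonzero[OF N1] by simp
    then show "word_regular M q U [i, i] mu z \<and> word_regular M q U [] mu z \<and> A_word q U [i, i] mu z v = A_word q U [] mu z v"
      using 1 2 by (simp add: A1_def)
  qed
  then show ?thesis by simp
qed

text \<open>The three factors of either word belong to the ratios \<open>z\<^sub>i / z\<^sub>i\<^sub>+\<^sub>1\<close>, \<open>z\<^sub>i / z\<^sub>i\<^sub>+\<^sub>2\<close> and \<open>z\<^sub>i\<^sub>+\<^sub>1 / z\<^sub>i\<^sub>+\<^sub>2\<close>, that is, to the positive
  roots, in opposite orders. The scalars of the steps depend on these data only.\<close>

lemma A_op_braid:
  assumes i: "i \<in> {1..<M}" "Suc i \<in> {1..<M}" and mu: "mu \<in> lattice M" and v: "v \<in> W mu"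
    and reg: "word_regular M q U [i, Suc i, i] mu z" "word_regular M q U [Suc i, i, Suc i] mu z"
  shows "A_word q U [i, Suc i, i] mu z v = A_word q U [Suc i, i, Suc i] mu z v"
proof -
  define node where "node = (\<lambda>b. if b then Suc i else i)"
  obtain D where "sl3_module q (smul U) (\<lambda>b. opF U (node b)) (\<lambda>b. opt U (\<lambda>k. - simple_root (node b) k)) (\<lambda>b. opt U (simple_root (node b))) D (\<lambda>b. opE U (node b))"
    using rank_two[OF i] unfolding node_def by blast
  then interpret R: sl3_module q "smul U" "\<lambda>b. opF U (node b)" "\<lambda>b. opt U (\<lambda>k. - simple_root (node b) k)" "\<lambda>b. opt U (simple_root (node b))" D "\<lambda>b. opE U (node b)" .
  have node: "node b \<in> {1..<M}" for b using i by (simp add: node_def)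
  have D: "\<forall>k x. k > D \<longrightarrow> (opE U (node b) ^^ k) x = 0" for b using R.S.Fpow_zero by blast
  define m where "m b = mu (Suc (node b)) - mu (node b)" for b
  have wt: "R.wt m v"
    unfolding R.wt_def using v lattice_minus[OF root_lattice[OF node]]
    by (simp add: weight_space_def pairing_commute[of mu "\<lambda>k. - simple_root _ k"] pairing_minus
        pairing_commute[of "simple_root _" mu] pairing_root[OF node] m_def)
  have step_op: "R.S.step_op b N n D u = smul U (step_scalar N n) (A_op q U (node b) nu x u)" and reg1: "A_regular M q U (node b) nu x"
    if "N \<ge> 1" "n \<ge> 1" "nu (Suc (node b)) - nu (node b) = int n - int N" "x (Suc (node b)) \<noteq> 0"
      "x (node b) = q powi (int n + int N) * x (Suc (node b))" for b N n nu x u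
  proof -
    have Nm: "int N - int n = nu (node b) - nu (Suc (node b))" using that(3) by simp
    show "R.S.step_op b N n D u = smul U (step_scalar N n) (A_op q U (node b) nu x u)"
      using R.S.step_op_A_sum[OF that(1,2,4,5), where i = b and R = D and u = u]
      unfolding A_op_A_sum[where D = D, OF node D order_refl] that(3)[symmetric] Nm .
    show "A_regular M q U (node b) nu x" by (rule A_regular_power[OF that(5,4)]) (use that in simp)
  qed
  \<comment> \<open>The points at which \<open>braid_integral\<close> applies.\<close>
  define S where "S = {z :: nat \<Rightarrow> complex. z (Suc (Suc i)) \<noteq> 0 \<and> (\<exists>N n :: bool \<Rightarrow> nat. (\<forall>b. N b \<ge> 1 \<and> n b \<ge> 1 \<and> int (n b) - int (N b) = m b) \<and>
    R.generic (4 * D + 2) (n False - 1) (n True - 1) \<and> z (Suc i) = q powi (int (n True) + int (N True)) * z (Suc (Suc i)) \<and>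
    z i = q powi (int (n False) + int (N False)) * z (Suc i))}"
  show ?thesis
  proof (rule A_words_agree[OF _ _ mu v, where S = S])
    show "set [i, Suc i, i] \<subseteq> {1..<M}" "set [Suc i, i, Suc i] \<subseteq> {1..<M}" using i by auto
    show "word_regular M q U [i, Suc i, i] mu z" "word_regular M q U [Suc i, i, Suc i] mu z" by (fact reg)+
  next
    fix f z assume f: "f \<in> polyfun (smul U)" and f0: "\<And>z. z \<in> S \<Longrightarrow> f z = 0"
    show "f z = 0"
    proof (rule polyfun_vanish_nonzero[OF f, of "Suc (Suc i)"])
      fix z :: "nat \<Rightarrow> complex" assume z: "z (Suc (Suc i)) \<noteq> 0"
      define P2 where "P2 N \<longleftrightarrow> N \<ge> 1 \<and> int N + m True \<ge> 1" for N :: nat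
      show "f z = 0"
      proof (rule polyfun_vanish_ratio[OF f _ _ z])
        show "infinite ((\<lambda>N::nat. q powi (2 * int N + m True)) ` {N. P2 N})"
        proof (rule infinite_powers)
          fix N assume "N \<ge> nat \<bar>m True\<bar> + 2" then show "P2 N" unfolding P2_def by linarith
        qed
      next
        fix \<zeta>2 assume "\<zeta>2 \<in> (\<lambda>N::nat. q powi (2 * int N + m True)) ` {N. P2 N}"
        then obtain N2 where N2: "P2 N2" "\<zeta>2 = q powi (2 * int N2 + m True)" by blast
        define n2 where "n2 = nat (int N2 + m True)"
        have n2: "int n2 = int N2 + m True" "n2 \<ge> 1" using N2(1) by (auto simp: P2_def n2_def)
        define y where "y = z(Suc i := \<zeta>2 * z (Suc (Suc i)))"
        have y1: "y (Suc i) = q powi (int n2 + int N2) * y (Suc (Suc i))" "y (Suc (Suc i)) \<noteq> 0"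
          using z n2 by (simp_all add: y_def N2(2) algebra_simps)
        then have y0: "y (Suc i) \<noteq> 0" by simp
        \<comment> \<open>Genericity excludes finitely many ratios \<open>\<zeta>1\<close>, depending on \<open>\<zeta>2\<close>; hence this order of the two density arguments.\<close>
        obtain B where B: "\<And>h. h \<ge> B \<Longrightarrow> R.generic (4 * D + 2) h (n2 - 1)" using R.eventually_generic by blast
        define P1 where "P1 N \<longleftrightarrow> N \<ge> 1 \<and> int N + m False \<ge> 1 \<and> R.generic (4 * D + 2) (nat (int N + m False) - 1) (n2 - 1)" for N :: nat
        have "f y = 0"
        proof (rule polyfun_vanish_ratio[OF f _ _ y0])
          show "infinite ((\<lambda>N::nat. q powi (2 * int N + m False)) ` {N. P1 N})"
          proof (rule infinite_powers)
            fix N assume N: "N \<ge> B + nat \<bar>m False\<bar> + 2"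
            then have "B \<le> nat (int N + m False) - 1" "int N + m False \<ge> 1" "N \<ge> 1" by linarith+
            then show "P1 N" using B unfolding P1_def by blast
          qed
        next
          fix \<zeta>1 assume "\<zeta>1 \<in> (\<lambda>N::nat. q powi (2 * int N + m False)) ` {N. P1 N}"
          then obtain N1 where N1: "P1 N1" "\<zeta>1 = q powi (2 * int N1 + m False)" by blast
          define n1 where "n1 = nat (int N1 + m False)"
          have n1: "int n1 = int N1 + m False" "n1 \<ge> 1" using N1(1) by (auto simp: P1_def n1_def)
          have e: "2 * int N1 + m False = int n1 + int N1" using n1 by simp
          have "y(i := \<zeta>1 * y (Suc i)) \<in> S"
            using N1(1) N2(1) n1 n2 y1 unfolding S_def P1_def P2_def n1_def[symmetric] N1(2) e mem_Collect_eq
            by (intro conjI exI[of _ "\<lambda>b. if b then N2 else N1"] exI[of _ "\<lambda>b. if b then n2 else n1"] allI) simp_all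
          then show "f (y(i := \<zeta>1 * y (Suc i))) = 0" by (rule f0)
        qed
        then show "f (z(Suc i := \<zeta>2 * z (Suc (Suc i)))) = 0" by (simp add: y_def)
      qed
    qed
  next
    fix z assume "z \<in> S"
    then obtain N n where z: "z (Suc (Suc i)) \<noteq> 0" and N: "\<And>b. N b \<ge> 1" "\<And>b. n b \<ge> 1" "\<And>b. int (n b) - int (N b) = m b"
      and gen: "R.generic (4 * D + 2) (n False - 1) (n True - 1)"
      and z2: "z (Suc i) = q powi (int (n True) + int (N True)) * z (Suc (Suc i))"
      and z1: "z i = q powi (int (n False) + int (N False)) * z (Suc i)" unfolding S_def by blast
    have z': "z (Suc i) \<noteq> 0" using z z2 by simp
    have z3: "z i = q powi (int (n False + n True) + int (N False + N True)) * z (Suc (Suc i))"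
      unfolding z1 z2 by (simp add: powi_mult_left add_ac)
    have nd: "node False = i" "node True = Suc i" by (simp_all add: node_def)
    have mm: "m False = mu (Suc i) - mu i" "m True = mu (Suc (Suc i)) - mu (Suc i)" by (simp_all add: m_def nd)
    have r: "refl_act k x k = x (Suc k)" "refl_act k x (Suc k) = x k" "refl_act (Suc k) x k = x k" "refl_act k x (Suc (Suc k)) = x (Suc (Suc k))"
      for k and x :: "nat \<Rightarrow> complex" by (simp_all add: refl_act_def transpose_def)
    have r': "refl_act k x k = x (Suc k)" "refl_act k x (Suc k) = x k" "refl_act (Suc k) x k = x k" "refl_act k x (Suc (Suc k)) = x (Suc (Suc k))"
      for k and x :: "nat \<Rightarrow> int" by (simp_all add: refl_act_def transpose_def)
    note N' = N(3)[of False, unfolded mm] N(3)[of True, unfolded mm]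
    have F: "R.S.step_op False N' n' D u = smul U (step_scalar N' n') (A_op q U i nu x u)" "A_regular M q U i nu x"
      if "N' \<ge> 1" "n' \<ge> 1" "nu (Suc i) - nu i = int n' - int N'" "x (Suc i) \<noteq> 0" "x i = q powi (int n' + int N') * x (Suc i)" for N' n' nu x u
      using step_op[where b = False and N = N' and n = n' and nu = nu and x = x and u = u] reg1[where b = False and N = N' and n = n' and nu = nu and x = x] that by (simp_all add: nd)
    have T: "R.S.step_op True N' n' D u = smul U (step_scalar N' n') (A_op q U (Suc i) nu x u)" "A_regular M q U (Suc i) nu x"
      if "N' \<ge> 1" "n' \<ge> 1" "nu (Suc (Suc i)) - nu (Suc i) = int n' - int N'" "x (Suc (Suc i)) \<noteq> 0" "x (Suc i) = q powi (int n' + int N') * x (Suc (Suc i))" for N' n' nu x u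
      using step_op[where b = True and N = N' and n = n' and nu = nu and x = x and u = u] reg1[where b = True and N = N' and n = n' and nu = nu and x = x] that by (simp_all add: nd)
    have sum1: "N False + N True \<ge> 1" "n False + n True \<ge> 1" using N(1)[of False] N(2)[of False] by simp_all
    let ?s = "refl_act i" and ?t = "refl_act (Suc i)"
    have a1: "R.S.step_op False (N False) (n False) D u = smul U (step_scalar (N False) (n False)) (A_op q U i mu z u)" "A_regular M q U i mu z" for u
      using F[OF N(1,2) _ z' z1, where nu = mu] N' by simp_all
    have a2: "R.S.step_op True (N False + N True) (n False + n True) D u = smul U (step_scalar (N False + N True) (n False + n True)) (A_op q U (Suc i) (?s mu) (?s z) u)"
      "A_regular M q U (Suc i) (?s mu) (?s z)" for u
      using T[OF sum1, where nu = "?s mu" and x = "?s z"] N' z z3 by (simp_all add: r r')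
    have a3: "R.S.step_op False (N True) (n True) D u = smul U (step_scalar (N True) (n True)) (A_op q U i (?t (?s mu)) (?t (?s z)) u)"
      "A_regular M q U i (?t (?s mu)) (?t (?s z))" for u
      using F[OF N(1,2)[of True], where nu = "?t (?s mu)" and x = "?t (?s z)"] N' z z2 by (simp_all add: r r')
    have b1: "R.S.step_op True (N True) (n True) D u = smul U (step_scalar (N True) (n True)) (A_op q U (Suc i) mu z u)" "A_regular M q U (Suc i) mu z" for u
      using T[OF N(1,2) _ z z2, where nu = mu] N' by simp_all
    have b2: "R.S.step_op False (N False + N True) (n False + n True) D u = smul U (step_scalar (N False + N True) (n False + n True)) (A_op q U i (?t mu) (?t z) u)"
      "A_regular M q U i (?t mu) (?t z)" for u
      using F[OF sum1, where nu = "?t mu" and x = "?t z"] N' z z3 by (simp_all add: r r')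
    have b3: "R.S.step_op True (N False) (n False) D u = smul U (step_scalar (N False) (n False)) (A_op q U (Suc i) (?s (?t mu)) (?s (?t z)) u)"
      "A_regular M q U (Suc i) (?s (?t mu)) (?s (?t z))" for u
      using T[OF N(1,2)[of False], where nu = "?s (?t mu)" and x = "?s (?t z)"] N' z' z1 by (simp_all add: r r')
    have "R.wt (\<lambda>j. int (n j) - int (N j)) v" using wt unfolding N(3) .
    from R.braid_integral[OF this N(2,1) order_refl gen]
    have "smul U (step_scalar (N False) (n False) * step_scalar (N False + N True) (n False + n True) * step_scalar (N True) (n True)) (A_word q U [i, Suc i, i] mu z v) =
      smul U (step_scalar (N False) (n False) * step_scalar (N False + N True) (n False + n True) * step_scalar (N True) (n True)) (A_word q U [Suc i, i, Suc i] mu z v)"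
      unfolding a1(1) a2(1) a3(1) b1(1) b2(1) b3(1) by (simp add: A_op_scale[OF i(1)] A_op_scale[OF i(2)] mult_ac)
    then have "A_word q U [i, Suc i, i] mu z v = A_word q U [Suc i, i, Suc i] mu z v"
      using step_scalar_nonzero[OF N(1,2)] step_scalar_nonzero[OF sum1] by (simp only: scale_cancel_left mult_eq_0_iff) auto
    then show "word_regular M q U [i, Suc i, i] mu z \<and> word_regular M q U [Suc i, i, Suc i] mu z \<and> A_word q U [i, Suc i, i] mu z v = A_word q U [Suc i, i, Suc i] mu z v"
      using a1(2) a2(2) a3(2) b1(2) b2(2) b3(2) by simp
  qed
qed

end

theorem theorem4p1:
  fixes M :: nat and q :: complex and U :: "'v::ab_group_add uq_rep" and mu :: "nat \<Rightarrow> int"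
  assumes "M \<ge> 2"
    and "q \<noteq> 0"
    and "\<forall>n::nat. n \<ge> 1 \<longrightarrow> q ^ n \<noteq> 1"
    and "uq_gl_module M q U"
    and "\<exists>B. finite_dimensional_vector_space (smul U) B"
    and "type_I M q U"
    and "mu \<in> lattice M"
  shows
    "(\<forall>i \<in> {1..M - 1}. \<forall>z. A_regular M q U i mu z \<longrightarrow>
        (\<forall>v \<in> weight_space M q U mu. A_op q U i mu z v \<in> weight_space M q U (refl_act i mu))) \<and>
     (\<forall>i \<in> {1..M - 1}. \<forall>j \<in> {1..M - 1}. \<forall>z. \<bar>int i - int j\<bar> \<ge> 2 \<longrightarrow>
        A_regular M q U j mu z \<longrightarrow>
        A_regular M q U i (refl_act j mu) (refl_act j z) \<longrightarrow>
        A_regular M q U i mu z \<longrightarrow>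
        A_regular M q U j (refl_act i mu) (refl_act i z) \<longrightarrow>
        (\<forall>v \<in> weight_space M q U mu.
          A_op q U i (refl_act j mu) (refl_act j z) (A_op q U j mu z v) =
          A_op q U j (refl_act i mu) (refl_act i z) (A_op q U i mu z v))) \<and>
     (\<forall>i \<in> {1..M - 1}. \<forall>z.
        A_regular M q U i mu z \<longrightarrow>
        A_regular M q U i (refl_act i mu) (refl_act i z) \<longrightarrow>
        (\<forall>v \<in> weight_space M q U mu.
          A_op q U i (refl_act i mu) (refl_act i z) (A_op q U i mu z v) = v)) \<and>
     (\<forall>i \<in> {1..M - 2}. \<forall>z.
        A_regular M q U i mu z \<longrightarrow>
        A_regular M q U (i + 1) (refl_act i mu) (refl_act i z) \<longrightarrow>
        A_regular M q U i (refl_act (i + 1) (refl_act i mu)) (refl_act (i + 1) (refl_act i z)) \<longrightarrow>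
        A_regular M q U (i + 1) mu z \<longrightarrow>
        A_regular M q U i (refl_act (i + 1) mu) (refl_act (i + 1) z) \<longrightarrow>
        A_regular M q U (i + 1) (refl_act i (refl_act (i + 1) mu)) (refl_act i (refl_act (i + 1) z)) \<longrightarrow>
        (\<forall>v \<in> weight_space M q U mu.
          A_op q U i (refl_act (i + 1) (refl_act i mu)) (refl_act (i + 1) (refl_act i z))
            (A_op q U (i + 1) (refl_act i mu) (refl_act i z) (A_op q U i mu z v)) =
          A_op q U (i + 1) (refl_act i (refl_act (i + 1) mu)) (refl_act i (refl_act (i + 1) z))
            (A_op q U i (refl_act (i + 1) mu) (refl_act (i + 1) z) (A_op q U (i + 1) mu z v))))"
proof -
  have "vector_space (smul U)" using assms(4) by (rule uq_gl_module.vector_space_smul)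
  then interpret gl_module M q U
    using assms by (intro gl_module.intro gl_module_axioms.intro quantum_parameter.intro complex_vector_space.intro) auto
  have idx: "i \<in> {1..<M}" if "i \<in> {1..M - 1}" for i using that by auto
  have idx2: "i \<in> {1..<M}" "Suc i \<in> {1..<M}" if "i \<in> {1..M - 2}" for i using that by auto
  show ?thesis
  proof (intro conjI ballI allI impI)
    fix i z v assume "i \<in> {1..M - 1}" "v \<in> weight_space M q U mu"
    then show "A_op q U i mu z v \<in> weight_space M q U (refl_act i mu)" by (intro A_op_weight idx)
  next
    fix i j z v assume "i \<in> {1..M - 1}" "j \<in> {1..M - 1}" "\<bar>int i - int j\<bar> \<ge> 2"
    then show "A_op q U i (refl_act j mu) (refl_act j z) (A_op q U j mu z v) = A_op q U j (refl_act i mu) (refl_act i z) (A_op q U i mu z v)"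
      by (intro A_op_commute_far idx)
  next
    fix i z v assume "i \<in> {1..M - 1}" "A_regular M q U i mu z" "A_regular M q U i (refl_act i mu) (refl_act i z)"
      "v \<in> weight_space M q U mu"
    then show "A_op q U i (refl_act i mu) (refl_act i z) (A_op q U i mu z v) = v"
      using A_op_unitarity[OF idx \<open>mu \<in> lattice M\<close>, of i v z] by simp
  next
    fix i z v assume "i \<in> {1..M - 2}" "A_regular M q U i mu z" "A_regular M q U (i + 1) (refl_act i mu) (refl_act i z)"
      "A_regular M q U i (refl_act (i + 1) (refl_act i mu)) (refl_act (i + 1) (refl_act i z))"
      "A_regular M q U (i + 1) mu z" "A_regular M q U i (refl_act (i + 1) mu) (refl_act (i + 1) z)"
      "A_regular M q U (i + 1) (refl_act i (refl_act (i + 1) mu)) (refl_act i (refl_act (i + 1) z))"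
      "v \<in> weight_space M q U mu"
    then show "A_op q U i (refl_act (i + 1) (refl_act i mu)) (refl_act (i + 1) (refl_act i z))
            (A_op q U (i + 1) (refl_act i mu) (refl_act i z) (A_op q U i mu z v)) =
          A_op q U (i + 1) (refl_act i (refl_act (i + 1) mu)) (refl_act i (refl_act (i + 1) z))
            (A_op q U i (refl_act (i + 1) mu) (refl_act (i + 1) z) (A_op q U (i + 1) mu z v))"
      using A_op_braid[OF idx2 \<open>mu \<in> lattice M\<close>, of i v z] by simp
  qed
qed

end
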